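(* Let $X=(\mathfrak g,\mathfrak k)$ be a symmetric pair of even type from one of the four classical series, $\mathfrak a$ an even Cartan subspace, $\mathfrak L$ the Laplace–Beltrami operator, and let $$\mathfrak L_{rad}=\Delta+\sum_{\alpha\in R_+(X)}\mu_\alpha\,\frac{e^{2\alpha}+1}{e^{2\alpha}-1}\,\partial_\alpha ,$$ acting on $S(\mathfrak a)^*_{loc}$. Then, for the restriction map $i^*:\mathcal Z(X)\to S(\mathfrak a)^*\subset S(\mathfrak a)^*_{loc}$ from zonal functions, one has $$ i^*\circ\mathfrak L=\mathfrak L_{rad}\circ i^* \quad\text{on } \mathcal Z(X).$$
   Context: A symmetric pair $X=(\mathfrak g,\mathfrak k)$ consists of a complex Lie superalgebra $\mathfrak g$ with involutive automorphism $\theta$, $\mathfrak g=\mathfrak k\oplus\mathfrak p$ the decomposition into $\pm1$ eigenspaces. The four classical series are $(\mathfrak{gl}(n,2m),\mathfrak{osp}(n,2m))$, $(\mathfrak{osp}(2l,2m),\mathfrak{gl}(l,m))$, $(\mathfrak{gl}(n_1+n_2,m_1+m_2),\mathfrak{gl}(n_1,m_1)\oplus\mathfrak{gl}(n_2,m_2))$, $(\mathfrak{osp}(n_1+n_2,2m_1+2m_2),\mathfrak{osp}(n_1,2m_1)\oplus\mathfrak{osp}(n_2,2m_2))$. A Cartan subspace is a commutative subalgebra $\mathfrak a\subset\mathfrak p$, reductive in $\mathfrak g$, whose centraliser in $\mathfrak p$ is $\mathfrak a$; even type means that it can be chosen (and is chosen) inside the even part of $\mathfrak g$. $\mathfrak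 g$ carries an even invariant supersymmetric non-degenerate form $(\,,)$ with non-degenerate restriction to $\mathfrak a$; the induced form on $\mathfrak a^*$ is denoted the same way. $\mathfrak h\supset\mathfrak a$ is a ($\theta$-stable) Cartan subalgebra, $R$ the root system of $\mathfrak g$ with root vectors $X_\alpha$. Restricted roots: $R(X)\subset\mathfrak a^*\setminus\{0\}$ is the set of nonzero weights of $\mathfrak a$ on $\mathfrak g$; $\mu_\alpha$ is the superdimension (even minus odd dimension) of the weight space $\mathfrak g^{\mathfrak a}_\alpha$; $R_+(X)$ is a choice of positive half. Zonal functions: $\mathcal Z(X)=\{f\in U(\mathfrak g)^*: f(xu)=f(ux)=0,\ x\in\mathfrak k,\ u\in U(\mathfrak g)\}$. With an orthogonal basis $h_i$ of $\mathfrak h$, the quadratic Casimir is $\mathcal C_2=\sum_i\frac{h_i^2}{(h_i,h_i)}+\sum_{\alpha\in R}\frac{X_\alpha X_{-\alpha}}{(X_{-\alpha},X_\alpha)}$, and $(\mathfrak Lf)(x)=f(x\,\mathcal C_2)$. $S(\mathfrak a)^*$ is identified with formal power series on $\mathfrak a$: for a basis $e_1,\dots,e_N$ of $\mathfrak a$ with dual basis $x_1,\dots,x_N$, $f\mapsto\sum_{M}f\big(\tfrac{e_1^{m_1}\cdots e_N^{m_N}}{m_1!\cdots m_N!}\big)x^M$; $e^{\lambda}$ ($\lambda\in\mathfrak a^*$) is the exponential series. $S(\mathfrak a)^*_{loc}$ is the localisation at the multiplicative set generated by $e^{2\alpha}-1$, $\alpha\in R(X)$. $\Delta$ is the Laplace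 operator on $\mathfrak a$ of the form $(\,,)$, i.e. $\Delta e^\lambda=(\lambda,\lambda)e^\lambda$, and $\partial_\alpha$ is the derivation with $\partial_\alpha e^\lambda=(\alpha,\lambda)e^\lambda$.
   Formalization: The form ( , ) is also assumed to be invariant under θ; this is automatic except for so(4) with k = so(1)⊕so(3), where taking different multiples of the Killing form on the two sl(2) ideals swapped by θ makes the claim false. *)

theory Defs
  imports
    Complex_Main
    "HOL-Library.Multiset_Order"
    "HOL-Library.Poly_Mapping"
    "HOL-Library.Function_Algebras"
    "HOL-Library.FuncSet"
    "HOL-Computational_Algebra.Fraction_Field"
    "HOL-Algebra.QuotRing"
begin

section \<open>Matrix Lie superalgebras with involution\<close>

text \<open>
  All Lie superalgebras below are subalgebras of some gl(p,q), realised by complex matrices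
  supported on rows and columns with index less than p + q.  The basis vectors with index
  less than p are even, the others are odd.
\<close>

type_synonym cmat = "nat \<Rightarrow> nat \<Rightarrow> complex"

definition cscale :: "complex \<Rightarrow> cmat \<Rightarrow> cmat" where
  "cscale c x = (\<lambda>i j. c * x i j)"

interpretation cmat: vector_space cscale
  by unfold_locales (auto simp: cscale_def fun_eq_iff algebra_simps)

definition mmul :: "nat \<Rightarrow> cmat \<Rightarrow> cmat \<Rightarrow> cmat" where
  "mmul d x y = (\<lambda>i j. \<Sum>k<d. x i k * y k j)"

definition mtrans :: "cmat \<Rightarrow> cmat" where
  "mtrans x = (\<lambda>i j. x j i)"

definition parity :: "nat \<Rightarrow> nat \<Rightarrow> nat" where
  "parity p i = (if i < p then 0 else 1)"

text \<open>
  The component of parity s of a Lie superalgebra is \<open>part G s\<close>; only s = 0 and s = 1 are used.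
\<close>

record lie_super =
  part :: "nat \<Rightarrow> cmat set"
  brk :: "cmat \<Rightarrow> cmat \<Rightarrow> cmat"

record sym_pair = lie_super +
  invol :: "cmat \<Rightarrow> cmat"

definition whole :: "'a lie_super_scheme \<Rightarrow> cmat set" where
  "whole G = {x + y | x y. x \<in> part G 0 \<and> y \<in> part G 1}"

definition kk :: "'a sym_pair_scheme \<Rightarrow> cmat set" where
  "kk X = {x \<in> whole X. invol X x = x}"

definition pp :: "'a sym_pair_scheme \<Rightarrow> cmat set" where
  "pp X = {x \<in> whole X. invol X x = - x}"

definition gl_part :: "nat \<Rightarrow> nat \<Rightarrow> nat \<Rightarrow> cmat set" where
  "gl_part p q s =
     {x. \<forall>i j. x i j \<noteq> 0 \<longrightarrow> i < p + q \<and> j < p + q \<and> even (parity p i + parity p j + s)}"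

text \<open>
  The bilinear extension of \<open>xy - (-1)^(|x||y|) yx\<close>: in the second product the matrix unit
  at (i,k) contributed by y has parity |i| + |k| and the one at (k,j) contributed by x has
  parity |k| + |j|.
\<close>

definition super_comm :: "nat \<Rightarrow> nat \<Rightarrow> cmat \<Rightarrow> cmat \<Rightarrow> cmat" where
  "super_comm p q x y = (\<lambda>i j. \<Sum>k<p + q. x i k * y k j
      - (-1) ^ ((parity p i + parity p k) * (parity p k + parity p j)) * (y i k * x k j))"

text \<open>For x with diagonal blocks A, D and off-diagonal blocks B, C this is
  (A\<open>\<^sup>t\<close>, C\<open>\<^sup>t\<close>; -B\<open>\<^sup>t\<close>, D\<open>\<^sup>t\<close>).\<close>

definition supertranspose :: "nat \<Rightarrow> cmat \<Rightarrow> cmat" where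
  "supertranspose p x = (\<lambda>i j. (-1) ^ ((parity p i + parity p j) * parity p i) * x j i)"

text \<open>Block diagonal with blocks (0, 1; -1, 0) on the index pairs (2j, 2j+1).\<close>

definition rot :: cmat where
  "rot = (\<lambda>i j. if even i \<and> j = i + 1 then 1 else if odd i \<and> i = j + 1 then -1 else 0)"

text \<open>
  Gram matrix of the even supersymmetric form on the space of dimension (p, 2q): the standard
  symmetric form on the even part, the standard symplectic form on the odd part.  The equation in
  \<open>osp_part\<close> is the matrix form of \<open>B(xv,w) + (-1)^(|x||v|) B(v,xw) = 0\<close>.
\<close>

definition gram :: "nat \<Rightarrow> cmat" where
  "gram p = (\<lambda>i j. if i < p \<or> j < p then (if i = j then 1 else 0) else rot (i - p) (j - p))"

definition osp_part :: "nat \<Rightarrow> nat \<Rightarrow> nat \<Rightarrow> cmat set" where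
  "osp_part p q s = {x \<in> gl_part p (2 * q) s.
     mmul (p + 2 * q) (supertranspose p x) (gram p) + mmul (p + 2 * q) (gram p) x = 0}"

subsection \<open>The four classical series\<close>

text \<open>The involution is \<open>-B\<^sup>-\<^sup>1 x^st B\<close>, where B is the Gram matrix above and
  \<open>B\<^sup>-\<^sup>1\<close> is its transpose.\<close>

definition gl_osp :: "nat \<Rightarrow> nat \<Rightarrow> sym_pair" where
  "gl_osp n m = \<lparr>part = gl_part n (2 * m), brk = super_comm n (2 * m),
     invol = (\<lambda>x. - mmul (n + 2 * m) (mtrans (gram n))
                        (mmul (n + 2 * m) (supertranspose n x) (gram n)))\<rparr>"

text \<open>
  The orthosymplectic matrix \<open>rot\<close> has square -1; its eigenspaces for the
  two eigenvalues are dual isotropic subspaces of dimension (l, m), and its centraliser in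
  osp(2l,2m) is gl(l,m).  The involution is conjugation by it.
\<close>

definition osp_gl :: "nat \<Rightarrow> nat \<Rightarrow> sym_pair" where
  "osp_gl l m = \<lparr>part = osp_part (2 * l) m, brk = super_comm (2 * l) (2 * m),
     invol = (\<lambda>x. mmul (2 * l + 2 * m) rot (mmul (2 * l + 2 * m) x (mtrans rot)))\<rparr>"

text \<open>Conjugation by the diagonal matrix with entries 1 (n1 times), -1 (n2 times),
  1 (m1 times), -1 (m2 times).\<close>

definition split_sign :: "nat \<Rightarrow> nat \<Rightarrow> nat \<Rightarrow> nat \<Rightarrow> complex" where
  "split_sign n1 n2 m1 i = (if i < n1 \<or> n1 + n2 \<le> i \<and> i < n1 + n2 + m1 then 1 else -1)"

definition split_invol :: "nat \<Rightarrow> nat \<Rightarrow> nat \<Rightarrow> cmat \<Rightarrow> cmat" where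
  "split_invol n1 n2 m1 x = (\<lambda>i j. split_sign n1 n2 m1 i * x i j * split_sign n1 n2 m1 j)"

definition gl_gl :: "nat \<Rightarrow> nat \<Rightarrow> nat \<Rightarrow> nat \<Rightarrow> sym_pair" where
  "gl_gl n1 n2 m1 m2 = \<lparr>part = gl_part (n1 + n2) (m1 + m2),
     brk = super_comm (n1 + n2) (m1 + m2), invol = split_invol n1 n2 m1\<rparr>"

definition osp_osp :: "nat \<Rightarrow> nat \<Rightarrow> nat \<Rightarrow> nat \<Rightarrow> sym_pair" where
  "osp_osp n1 n2 m1 m2 = \<lparr>part = osp_part (n1 + n2) (m1 + m2),
     brk = super_comm (n1 + n2) (2 * m1 + 2 * m2), invol = split_invol n1 n2 (2 * m1)\<rparr>"

definition classical_pairs :: "sym_pair set" where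
  "classical_pairs = {gl_osp n m | n m. True} \<union> {osp_gl l m | l m. True}
     \<union> {gl_gl n1 n2 m1 m2 | n1 n2 m1 m2. True} \<union> {osp_osp n1 n2 m1 m2 | n1 n2 m1 m2. True}"


section \<open>Forms, Cartan subspaces and roots\<close>

definition is_basis :: "cmat list \<Rightarrow> cmat set \<Rightarrow> bool" where
  "is_basis bs V \<longleftrightarrow> distinct bs \<and> cmat.independent (set bs) \<and> cmat.span (set bs) = V"

definition invariant_form :: "'a lie_super_scheme \<Rightarrow> (cmat \<Rightarrow> cmat \<Rightarrow> complex) \<Rightarrow> bool" where
  "invariant_form G b \<longleftrightarrow>
     (\<forall>x\<in>whole G. \<forall>y\<in>whole G. \<forall>z\<in>whole G.
        b (x + y) z = b x z + b y z \<and> b z (x + y) = b z x + b z y) \<and>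
     (\<forall>x\<in>whole G. \<forall>y\<in>whole G. \<forall>c. b (cscale c x) y = c * b x y \<and> b x (cscale c y) = c * b x y) \<and>
     (\<forall>x\<in>part G 0. \<forall>y\<in>part G 1. b x y = 0 \<and> b y x = 0) \<and>
     (\<forall>s\<in>{0,1}. \<forall>t\<in>{0,1}. \<forall>x\<in>part G s. \<forall>y\<in>part G t. b x y = (-1) ^ (s * t) * b y x) \<and>
     (\<forall>x\<in>whole G. \<forall>y\<in>whole G. \<forall>z\<in>whole G. b (brk G x y) z = b x (brk G y z))"

definition nondegenerate_on :: "cmat set \<Rightarrow> (cmat \<Rightarrow> cmat \<Rightarrow> complex) \<Rightarrow> bool" where
  "nondegenerate_on V b \<longleftrightarrow> (\<forall>x\<in>V. (\<forall>y\<in>V. b x y = 0) \<longrightarrow> x = 0)"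

definition ad_stable :: "'a lie_super_scheme \<Rightarrow> cmat set \<Rightarrow> cmat set \<Rightarrow> bool" where
  "ad_stable G a V \<longleftrightarrow> (\<forall>h\<in>a. \<forall>x\<in>V. brk G h x \<in> V)"

text \<open>Reductive in G: the adjoint action of a on G is completely reducible.\<close>

definition reductive_in :: "'a lie_super_scheme \<Rightarrow> cmat set \<Rightarrow> bool" where
  "reductive_in G a \<longleftrightarrow>
     (\<forall>V. cmat.subspace V \<and> V \<subseteq> whole G \<and> ad_stable G a V \<longrightarrow>
        (\<exists>W. cmat.subspace W \<and> W \<subseteq> whole G \<and> ad_stable G a W \<and>
             V \<inter> W = {0} \<and> {v + w | v w. v \<in> V \<and> w \<in> W} = whole G))"

definition commutative_in :: "'a lie_super_scheme \<Rightarrow> cmat set \<Rightarrow> bool" where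
  "commutative_in G a \<longleftrightarrow> (\<forall>x\<in>a. \<forall>y\<in>a. brk G x y = 0)"

definition centraliser :: "'a lie_super_scheme \<Rightarrow> cmat set \<Rightarrow> cmat set \<Rightarrow> cmat set" where
  "centraliser G V a = {x \<in> V. \<forall>h\<in>a. brk G h x = 0}"

text \<open>A pair is of even type iff it has such a subspace.\<close>

definition even_cartan_subspace :: "'a sym_pair_scheme \<Rightarrow> cmat set \<Rightarrow> bool" where
  "even_cartan_subspace X a \<longleftrightarrow>
     cmat.subspace a \<and> a \<subseteq> pp X \<and> a \<subseteq> part X 0 \<and>
     commutative_in X a \<and> reductive_in X a \<and> centraliser X (pp X) a = a"

text \<open>The analogue of a Cartan subspace with G in place of the -1 eigenspace.  For gl and osp these
  are the Cartan subalgebras of the even part, which is reductive and in which the Cartan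
  subalgebras are the maximal toral ones; they are self-centralising in G.\<close>

definition cartan_subalgebra :: "'a lie_super_scheme \<Rightarrow> cmat set \<Rightarrow> bool" where
  "cartan_subalgebra G h \<longleftrightarrow>
     cmat.subspace h \<and> h \<subseteq> part G 0 \<and>
     commutative_in G h \<and> reductive_in G h \<and> centraliser G (whole G) h = h"

text \<open>
  A linear functional on V is represented by the function that is 0 outside V; so sets of weights
  are finite, and negation and scaling of weights are pointwise.
\<close>

definition dual_space :: "cmat set \<Rightarrow> (cmat \<Rightarrow> complex) set" where
  "dual_space V = {\<phi>. (\<forall>x\<in>V. \<forall>y\<in>V. \<phi> (x + y) = \<phi> x + \<phi> y) \<and>
     (\<forall>c. \<forall>x\<in>V. \<phi> (cscale c x) = c * \<phi> x) \<and> (\<forall>x. x \<notin> V \<longrightarrow> \<phi> x = 0)}"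

definition weight_space ::
  "'a lie_super_scheme \<Rightarrow> cmat set \<Rightarrow> (cmat \<Rightarrow> complex) \<Rightarrow> cmat set" where
  "weight_space G a \<alpha> = {x \<in> whole G. \<forall>h\<in>a. brk G h x = cscale (\<alpha> h) x}"

text \<open>Used both for the root system R (a Cartan subalgebra) and the restricted roots R(X)
  (a Cartan subspace).\<close>

definition nonzero_weights ::
  "'a lie_super_scheme \<Rightarrow> cmat set \<Rightarrow> (cmat \<Rightarrow> complex) set" where
  "nonzero_weights G a = {\<alpha> \<in> dual_space a. \<alpha> \<noteq> 0 \<and> weight_space G a \<alpha> \<noteq> {0}}"

definition mult_super ::
  "'a lie_super_scheme \<Rightarrow> cmat set \<Rightarrow> (cmat \<Rightarrow> complex) \<Rightarrow> int" where
  "mult_super G a \<alpha> = int (cmat.dim (weight_space G a \<alpha> \<inter> part G 0))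
                     - int (cmat.dim (weight_space G a \<alpha> \<inter> part G 1))"

definition positive_half :: "(cmat \<Rightarrow> complex) set \<Rightarrow> (cmat \<Rightarrow> complex) set \<Rightarrow> bool" where
  "positive_half R P \<longleftrightarrow> P \<inter> uminus ` P = {} \<and> P \<union> uminus ` P = R"

text \<open>The root spaces with respect to a Cartan subalgebra of gl or osp are lines;
  a root vector is a generator of its root space.\<close>

definition root_vectors ::
  "'a lie_super_scheme \<Rightarrow> cmat set \<Rightarrow> ((cmat \<Rightarrow> complex) \<Rightarrow> cmat) \<Rightarrow> bool" where
  "root_vectors G h E \<longleftrightarrow>
     (\<forall>\<alpha>\<in>nonzero_weights G h. E \<alpha> \<noteq> 0 \<and> weight_space G h \<alpha> = cmat.span {E \<alpha>})"

definition dual_vector ::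
  "cmat set \<Rightarrow> (cmat \<Rightarrow> cmat \<Rightarrow> complex) \<Rightarrow> (cmat \<Rightarrow> complex) \<Rightarrow> cmat" where
  "dual_vector a b \<phi> = (THE v. v \<in> a \<and> (\<forall>w\<in>a. b v w = \<phi> w))"

definition dual_form :: "cmat set \<Rightarrow> (cmat \<Rightarrow> cmat \<Rightarrow> complex) \<Rightarrow>
    (cmat \<Rightarrow> complex) \<Rightarrow> (cmat \<Rightarrow> complex) \<Rightarrow> complex" where
  "dual_form a b \<phi> \<psi> = b (dual_vector a b \<phi>) (dual_vector a b \<psi>)"

text \<open>The element of the dual basis belonging to the i-th vector of the basis es of a.\<close>

definition coord :: "cmat set \<Rightarrow> cmat list \<Rightarrow> nat \<Rightarrow> cmat \<Rightarrow> complex" where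
  "coord a es i = (THE \<phi>. \<phi> \<in> dual_space a \<and>
     (\<forall>j<length es. \<phi> (es ! j) = (if j = i then 1 else 0)))"


section \<open>The universal enveloping algebra and zonal functions\<close>

text \<open>
  Finitely supported functions on words form the free associative unital algebra on the letters.
  The enveloping algebra is the quotient of the free algebra on the elements of G by the ideal
  generated by the linearity relations and the supercommutation relations, that is, the tensor
  algebra of G modulo the supercommutation relations.
\<close>

datatype 'a word = Word (letters: "'a list")

instantiation word :: (type) monoid_add
begin

definition zero_word :: "'a word" where "zero_word = Word []"

definition plus_word :: "'a word \<Rightarrow> 'a word \<Rightarrow> 'a word" where
  "plus_word v w = Word (letters v @ letters w)"

instance
  by intro_classes (simp_all add: zero_word_def plus_word_def)

end

type_synonym free_alg = "cmat word \<Rightarrow>\<^sub>0 complex"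

definition gen :: "cmat \<Rightarrow> free_alg" where
  "gen x = Poly_Mapping.single (Word [x]) 1"

definition scal :: "complex \<Rightarrow> free_alg" where
  "scal c = Poly_Mapping.single 0 c"

definition free_ring :: "'a lie_super_scheme \<Rightarrow> free_alg ring" where
  "free_ring G = \<lparr>carrier = {t. \<forall>w\<in>Poly_Mapping.keys t. set (letters w) \<subseteq> whole G},
     monoid.mult = (*), one = 1, zero = 0, add = (+)\<rparr>"

definition env_relations :: "'a lie_super_scheme \<Rightarrow> free_alg set" where
  "env_relations G =
     {gen (x + y) - gen x - gen y | x y. x \<in> whole G \<and> y \<in> whole G} \<union>
     {gen (cscale c x) - scal c * gen x | c x. x \<in> whole G} \<union>
     {gen x * gen y - scal ((-1) ^ (s * t)) * (gen y * gen x) - gen (brk G x y) | x y s t.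
        s \<in> {0,1} \<and> t \<in> {0,1} \<and> x \<in> part G s \<and> y \<in> part G t}"

definition env_ideal :: "'a lie_super_scheme \<Rightarrow> free_alg set" where
  "env_ideal G = genideal (free_ring G) (env_relations G)"

definition UEA :: "'a lie_super_scheme \<Rightarrow> free_alg set ring" where
  "UEA G = free_ring G Quot env_ideal G"

definition env_class :: "'a lie_super_scheme \<Rightarrow> free_alg \<Rightarrow> free_alg set" where
  "env_class G t = env_ideal G +>\<^bsub>free_ring G\<^esub> t"

definition uea_dual :: "'a lie_super_scheme \<Rightarrow> (free_alg set \<Rightarrow> complex) set" where
  "uea_dual G = {f.
     (\<forall>u\<in>carrier (UEA G). \<forall>v\<in>carrier (UEA G). f (u \<oplus>\<^bsub>UEA G\<^esub> v) = f u + f v) \<and>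
     (\<forall>c. \<forall>u\<in>carrier (UEA G). f (env_class G (scal c) \<otimes>\<^bsub>UEA G\<^esub> u) = c * f u)}"

definition zonal :: "'a sym_pair_scheme \<Rightarrow> (free_alg set \<Rightarrow> complex) set" where
  "zonal X = {f \<in> uea_dual X. \<forall>x\<in>kk X. \<forall>u\<in>carrier (UEA X).
     f (env_class X (gen x) \<otimes>\<^bsub>UEA X\<^esub> u) = 0 \<and> f (u \<otimes>\<^bsub>UEA X\<^esub> env_class X (gen x)) = 0}"

text \<open>hs is an orthogonal basis of the Cartan subalgebra h, and E the family of root vectors.\<close>

definition casimir :: "'a lie_super_scheme \<Rightarrow> (cmat \<Rightarrow> cmat \<Rightarrow> complex) \<Rightarrow> cmat set \<Rightarrow>
    cmat list \<Rightarrow> ((cmat \<Rightarrow> complex) \<Rightarrow> cmat) \<Rightarrow> free_alg set" where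
  "casimir G b h hs E = env_class G
     ((\<Sum>i<length hs. scal (1 / b (hs ! i) (hs ! i)) * (gen (hs ! i) * gen (hs ! i))) +
      (\<Sum>\<alpha>\<in>nonzero_weights G h. scal (1 / b (E (- \<alpha>)) (E \<alpha>)) * (gen (E \<alpha>) * gen (E (- \<alpha>)))))"

definition laplace_beltrami :: "'a lie_super_scheme \<Rightarrow> free_alg set \<Rightarrow>
    (free_alg set \<Rightarrow> complex) \<Rightarrow> free_alg set \<Rightarrow> complex" where
  "laplace_beltrami G C f = (\<lambda>u. f (u \<otimes>\<^bsub>UEA G\<^esub> C))"


section \<open>Formal power series in several variables\<close>

text \<open>
  Variables are indexed by natural numbers and the monomial \<open>x^M\<close> by a multiset M, in which
  \<open>count M i\<close> is the exponent of the i-th variable.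
\<close>

typedef mfps = "UNIV :: (nat multiset \<Rightarrow> complex) set"
  morphisms mcoeff Mfps by simp

setup_lifting type_definition_mfps

lemma mfps_eqI: "(\<And>M. mcoeff f M = mcoeff g M) \<Longrightarrow> f = g"
  by (simp add: mcoeff_inject[symmetric] fun_eq_iff)

lemma finite_sub_mset: "finite {A. A \<subseteq># (M :: 'a multiset)}"
proof (induction M)
  case empty
  then show ?case by simp
next
  case (add x M)
  have "{A. A \<subseteq># add_mset x M} \<subseteq> {A. A \<subseteq># M} \<union> add_mset x ` {A. A \<subseteq># M}"
  proof
    fix A assume A: "A \<in> {A. A \<subseteq># add_mset x M}"
    show "A \<in> {A. A \<subseteq># M} \<union> add_mset x ` {A. A \<subseteq># M}"
    proof (cases "x \<in># A")
      case True
      then obtain B where "A = add_mset x B" by (metis insert_DiffM)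
      with A show ?thesis by auto
    next
      case False
      have "count A y \<le> count M y" for y
        using False A mset_subset_eq_count[of A "add_mset x M" y]
        by (cases "y = x") (auto simp: not_in_iff)
      then show ?thesis by (auto simp: subseteq_mset_def)
    qed
  qed
  with add show ?case by (auto intro: finite_subset)
qed

lemma nested_sub_mset:
  assumes "B \<subseteq># A" "A \<subseteq># (M :: 'a multiset)"
  shows "B \<subseteq># M" "A - B \<subseteq># M - B" "B + (A - B) = A" "M - B - (A - B) = M - A"
  using assms by (auto simp: subseteq_mset_def multiset_eq_iff diff_le_mono intro: le_trans)

lemma sum_sub_mset:
  assumes "B \<subseteq># M" "D \<subseteq># (M :: 'a multiset) - B"
  shows "B + D \<subseteq># M"
  using assms by (auto simp: subseteq_mset_def multiset_eq_iff le_diff_conv2 add.commute)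

instantiation mfps :: comm_ring_1
begin

lift_definition zero_mfps :: mfps is "\<lambda>M. 0" .

lift_definition one_mfps :: mfps is "\<lambda>M. if M = {#} then 1 else 0" .

lift_definition plus_mfps :: "mfps \<Rightarrow> mfps \<Rightarrow> mfps" is "\<lambda>f g M. f M + g M" .

lift_definition minus_mfps :: "mfps \<Rightarrow> mfps \<Rightarrow> mfps" is "\<lambda>f g M. f M - g M" .

lift_definition uminus_mfps :: "mfps \<Rightarrow> mfps" is "\<lambda>f M. - f M" .

lift_definition times_mfps :: "mfps \<Rightarrow> mfps \<Rightarrow> mfps" is
  "\<lambda>f g M. \<Sum>A\<in>{A. A \<subseteq># M}. f A * g (M - A)" .

instance
proof
  fix a b c :: mfps
  show "a * b * c = a * (b * c)"
  proof (rule mfps_eqI)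
    fix M
    have "mcoeff (a * b * c) M =
        (\<Sum>(A, B)\<in>(SIGMA A:{A. A \<subseteq># M}. {B. B \<subseteq># A}).
           mcoeff a B * mcoeff b (A - B) * mcoeff c (M - A))"
      by (simp add: times_mfps.rep_eq sum_distrib_right sum.Sigma finite_sub_mset)
    also have "\<dots> = (\<Sum>(B, D)\<in>(SIGMA B:{B. B \<subseteq># M}. {D. D \<subseteq># M - B}).
           mcoeff a B * mcoeff b D * mcoeff c (M - B - D))"
      by (rule sum.reindex_bij_witness
            [where i = "\<lambda>(B, D). (B + D, B)" and j = "\<lambda>(A, B). (B, A - B)"])
         (auto simp: nested_sub_mset sum_sub_mset)
    also have "\<dots> = mcoeff (a * (b * c)) M"
      by (simp add: times_mfps.rep_eq sum_distrib_left sum.Sigma finite_sub_mset mult.assoc)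
    finally show "mcoeff (a * b * c) M = mcoeff (a * (b * c)) M" .
  qed
  show "a * b = b * a"
  proof (rule mfps_eqI)
    fix M :: "nat multiset"
    have diff2: "M - (M - A) = A" if "A \<subseteq># M" for A
      using that by (simp add: subseteq_mset_def multiset_eq_iff)
    show "mcoeff (a * b) M = mcoeff (b * a) M"
      unfolding times_mfps.rep_eq
      by (rule sum.reindex_bij_witness[where i = "\<lambda>A. M - A" and j = "\<lambda>A. M - A"])
         (auto simp: diff2 mult.commute)
  qed
  show "1 * a = a"
  proof (rule mfps_eqI)
    fix M
    have "mcoeff (1 * a) M =
        (\<Sum>A\<in>{A. A \<subseteq># M}. if A = {#} then mcoeff a (M - A) else 0)"
      by (auto simp: times_mfps.rep_eq one_mfps.rep_eq intro!: sum.cong)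
    also have "\<dots> = mcoeff a M"
      by (simp add: sum.delta finite_sub_mset)
    finally show "mcoeff (1 * a) M = mcoeff a M" .
  qed
  show "(a + b) * c = a * c + b * c"
    by (rule mfps_eqI) (simp add: times_mfps.rep_eq plus_mfps.rep_eq distrib_right sum.distrib)
  show "(0::mfps) \<noteq> 1"
    by transfer (metis zero_neq_one)
qed (rule mfps_eqI; simp add: plus_mfps.rep_eq zero_mfps.rep_eq minus_mfps.rep_eq uminus_mfps.rep_eq)+

end

instance mfps :: idom
proof
  fix f g :: mfps
  assume f: "f \<noteq> 0" and g: "g \<noteq> 0"
  define F where "F = (LEAST M. mcoeff f M \<noteq> 0)"
  define G where "G = (LEAST M. mcoeff g M \<noteq> 0)"
  have exf: "\<exists>M. mcoeff f M \<noteq> 0" and exg: "\<exists>M. mcoeff g M \<noteq> 0"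
    using f g by (metis mfps_eqI zero_mfps.rep_eq)+
  have F: "mcoeff f F \<noteq> 0" "\<And>M. mcoeff f M \<noteq> 0 \<Longrightarrow> F \<le> M"
    unfolding F_def using LeastI_ex[OF exf] by (auto intro: Least_le)
  have G: "mcoeff g G \<noteq> 0" "\<And>M. mcoeff g M \<noteq> 0 \<Longrightarrow> G \<le> M"
    unfolding G_def using LeastI_ex[OF exg] by (auto intro: Least_le)
  have "mcoeff f A * mcoeff g (F + G - A) = (if A = F then mcoeff f F * mcoeff g G else 0)"
    if "A \<subseteq># F + G" for A
  proof (cases "A = F")
    case False
    have "mcoeff f A = 0 \<or> mcoeff g (F + G - A) = 0"
    proof (rule ccontr)
      assume "\<not> ?thesis"
      then have "F < A" "G \<le> F + G - A"
        using F(2)[of A] G(2)[of "F + G - A"] False by auto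
      then have "F + G < A + (F + G - A)" by (rule add_less_le_mono)
      with that show False by simp
    qed
    with False show ?thesis by auto
  qed simp
  then have "mcoeff (f * g) (F + G) =
      (\<Sum>A\<in>{A. A \<subseteq># F + G}. if A = F then mcoeff f F * mcoeff g G else 0)"
    by (auto simp: times_mfps.rep_eq intro!: sum.cong)
  also have "\<dots> = mcoeff f F * mcoeff g G"
    by (simp add: finite_sub_mset)
  finally show "f * g \<noteq> 0"
    using F(1) G(1) by (auto simp: zero_mfps.rep_eq)
qed

lift_definition mconst :: "complex \<Rightarrow> mfps" is "\<lambda>c M. if M = {#} then c else 0" .

text \<open>Partial derivative in the i-th variable.\<close>

lift_definition mpartial :: "nat \<Rightarrow> mfps \<Rightarrow> mfps" is
  "\<lambda>i f M. of_nat (count M i + 1) * f (add_mset i M)" .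

lemma mpartial_mult: "mpartial i (f * g) = mpartial i f * g + f * mpartial i g"
proof (rule mfps_eqI)
  fix M
  let ?S = "{A. A \<subseteq># add_mset i M}" and ?T = "{A. A \<subseteq># M}"
  let ?t = "\<lambda>A. mcoeff f A * mcoeff g (add_mset i M - A)"
  have left: "(\<Sum>A\<in>?S. of_nat (count A i) * ?t A) = mcoeff (mpartial i f * g) M"
  proof -
    have "(\<Sum>A\<in>?S. of_nat (count A i) * ?t A) =
        (\<Sum>A\<in>add_mset i ` ?T. of_nat (count A i) * ?t A)"
    proof (rule sum.mono_neutral_right)
      show "finite ?S" by (rule finite_sub_mset)
      show "add_mset i ` ?T \<subseteq> ?S" by auto
      show "\<forall>A\<in>?S - add_mset i ` ?T. of_nat (count A i) * ?t A = 0"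
      proof
        fix A assume A: "A \<in> ?S - add_mset i ` ?T"
        have "i \<notin># A"
        proof
          assume "i \<in># A"
          then obtain B where "A = add_mset i B" by (metis insert_DiffM)
          with A show False by auto
        qed
        then show "of_nat (count A i) * ?t A = 0" by (simp add: not_in_iff)
      qed
    qed
    also have "\<dots> = mcoeff (mpartial i f * g) M"
      by (simp add: sum.reindex inj_on_def times_mfps.rep_eq mpartial.rep_eq mult.assoc)
    finally show ?thesis .
  qed
  have right: "(\<Sum>A\<in>?S. of_nat (count (add_mset i M - A) i) * ?t A) = mcoeff (f * mpartial i g) M"
  proof -
    have "(\<Sum>A\<in>?S. of_nat (count (add_mset i M - A) i) * ?t A) =
        (\<Sum>A\<in>?T. of_nat (count (add_mset i M - A) i) * ?t A)"
    proof (rule sum.mono_neutral_right)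
      show "finite ?S" by (rule finite_sub_mset)
      show "?T \<subseteq> ?S" by (auto intro: subset_mset.order_trans)
      show "\<forall>A\<in>?S - ?T. of_nat (count (add_mset i M - A) i) * ?t A = 0"
      proof
        fix A assume A: "A \<in> ?S - ?T"
        have "\<not> count A i \<le> count M i"
        proof
          assume "count A i \<le> count M i"
          moreover have "count A y \<le> count M y" if "y \<noteq> i" for y
            using A that mset_subset_eq_count[of A "add_mset i M" y] by auto
          ultimately have "A \<subseteq># M" by (metis subseteq_mset_def)
          with A show False by simp
        qed
        then show "of_nat (count (add_mset i M - A) i) * ?t A = 0" by simp
      qed
    qed
    also have "\<dots> = mcoeff (f * mpartial i g) M"
      unfolding times_mfps.rep_eq mpartial.rep_eq
    proof (rule sum.cong)
      fix A assume "A \<in> ?T"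
      then have A: "A \<subseteq># M" by simp
      then have "add_mset i M - A = add_mset i (M - A)"
        using subset_mset.add_diff_assoc2[of A M "{#i#}"] by simp
      then show "of_nat (count (add_mset i M - A) i) * ?t A =
          mcoeff f A * (of_nat (count (M - A) i + 1) * mcoeff g (add_mset i (M - A)))"
        by simp
    qed simp
    finally show ?thesis .
  qed
  have "mcoeff (mpartial i (f * g)) M = (\<Sum>A\<in>?S. of_nat (count (add_mset i M) i) * ?t A)"
    by (simp add: mpartial.rep_eq times_mfps.rep_eq sum_distrib_left)
  also have "\<dots> = (\<Sum>A\<in>?S. of_nat (count A i) * ?t A +
      of_nat (count (add_mset i M - A) i) * ?t A)"
  proof (rule sum.cong)
    fix A assume "A \<in> ?S"
    then have "count A i \<le> count (add_mset i M) i"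
      by (intro mset_subset_eq_count) simp
    then have "count (add_mset i M) i = count A i + count (add_mset i M - A) i"
      by simp
    then have "of_nat (count (add_mset i M) i) =
        (of_nat (count A i) + of_nat (count (add_mset i M - A) i) :: complex)"
      by (metis of_nat_add)
    then show "of_nat (count (add_mset i M) i) * ?t A =
        of_nat (count A i) * ?t A + of_nat (count (add_mset i M - A) i) * ?t A"
      by (simp only: distrib_right)
  qed simp
  also have "\<dots> = mcoeff (mpartial i f * g + f * mpartial i g) M"
    by (simp only: sum.distrib left right plus_mfps.rep_eq)
  finally show "mcoeff (mpartial i (f * g)) M = mcoeff (mpartial i f * g + f * mpartial i g) M" .
qed

lemma quotient_rule_well_defined:
  fixes f g f' g' p q p' q' :: mfps
  assumes eq: "f * g' = f' * g" and deriv: "p * g' + f * q' = p' * g + f' * q"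
  shows "(p * g - f * q) * (g' * g') = (p' * g' - f' * q') * (g * g)"
proof -
  have deriv': "p * g' = p' * g + f' * q - f * q'"
    using deriv by (simp add: eq_diff_eq)
  have "(p * g - f * q) * (g' * g') = (p * g') * (g * g') - (f * g') * (g' * q)"
    by (simp add: algebra_simps)
  also have "\<dots> = (p' * g + f' * q - f * q') * (g * g') - (f' * g) * (g' * q)"
    by (simp only: deriv' eq)
  also have "\<dots> = (p' * g') * (g * g) - (f * g') * (g * q')"
    by (simp add: algebra_simps)
  also have "\<dots> = (p' * g' - f' * q') * (g * g)"
    unfolding eq by (simp add: algebra_simps)
  finally show ?thesis .
qed

text \<open>Extension of a partial derivative to fractions by the quotient rule.\<close>

lift_definition fract_partial :: "nat \<Rightarrow> mfps fract \<Rightarrow> mfps fract" is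
  "\<lambda>i (f, g). (mpartial i f * g - f * mpartial i g, g * g)"
proof clarsimp
  fix i and f g f' g' :: mfps
  assume eq: "f * g' = f' * g"
  then have "mpartial i f * g' + f * mpartial i g' = mpartial i f' * g + f' * mpartial i g"
    by (metis mpartial_mult)
  with eq show "(mpartial i f * g - f * mpartial i g) * (g' * g') =
      (mpartial i f' * g' - f' * mpartial i g') * (g * g)"
    by (rule quotient_rule_well_defined)
qed

lemma fract_partial_Fract:
  "g \<noteq> 0 \<Longrightarrow> fract_partial i (Fract f g) = Fract (mpartial i f * g - f * mpartial i g) (g * g)"
  by transfer simp


section \<open>The radial part of the Laplace-Beltrami operator\<close>

text \<open>\<open>S(a)\<^sup>*\<close>: the power series in the first N variables, N the dimension of a.\<close>

definition power_series :: "nat \<Rightarrow> mfps set" where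
  "power_series N = {f. \<forall>M. mcoeff f M \<noteq> 0 \<longrightarrow> set_mset M \<subseteq> {..<N}}"

lift_definition mexp :: "cmat list \<Rightarrow> (cmat \<Rightarrow> complex) \<Rightarrow> mfps" is
  "\<lambda>es \<phi> M. if set_mset M \<subseteq> {..<length es}
     then (\<Prod>i<length es. \<phi> (es ! i) ^ count M i / fact (count M i)) else 0" .

inductive_set denominators :: "cmat list \<Rightarrow> (cmat \<Rightarrow> complex) set \<Rightarrow> mfps set"
  for es R where
  one: "1 \<in> denominators es R"
| mult: "s \<in> denominators es R \<Longrightarrow> \<alpha> \<in> R \<Longrightarrow>
    s * (mexp es (\<lambda>v. 2 * \<alpha> v) - 1) \<in> denominators es R"

text \<open>Power series form a domain, so their localisation is a subring of the fraction field.\<close>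

definition localised :: "cmat list \<Rightarrow> (cmat \<Rightarrow> complex) set \<Rightarrow> mfps fract set" where
  "localised es R = {Fract f s | f s. f \<in> power_series (length es) \<and> s \<in> denominators es R}"

text \<open>
  In the coordinates \<open>x_i\<close> dual to the basis es, the conditions
  \<open>\<partial>\<^sub>\<alpha> e^\<lambda> = (\<alpha>,\<lambda>) e^\<lambda>\<close> and \<open>\<Delta> e^\<lambda> = (\<lambda>,\<lambda>) e^\<lambda>\<close> say that
  \<open>\<partial>\<^sub>\<alpha>\<close> is the sum of the \<open>(\<alpha>,x_i) \<partial>/\<partial>x_i\<close> and \<open>\<Delta>\<close> the sum of the
  \<open>(x_i,x_j) \<partial>\<^sup>2/\<partial>x_i\<partial>x_j\<close>.
\<close>

definition root_deriv :: "(cmat \<Rightarrow> cmat \<Rightarrow> complex) \<Rightarrow> cmat set \<Rightarrow> cmat list \<Rightarrow>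
    (cmat \<Rightarrow> complex) \<Rightarrow> mfps fract \<Rightarrow> mfps fract" where
  "root_deriv b a es \<alpha> F =
     (\<Sum>i<length es. Fract (mconst (dual_form a b \<alpha> (coord a es i))) 1 * fract_partial i F)"

definition laplacian :: "(cmat \<Rightarrow> cmat \<Rightarrow> complex) \<Rightarrow> cmat set \<Rightarrow> cmat list \<Rightarrow>
    mfps fract \<Rightarrow> mfps fract" where
  "laplacian b a es F =
     (\<Sum>i<length es. \<Sum>j<length es.
        Fract (mconst (dual_form a b (coord a es i) (coord a es j))) 1 *
        fract_partial i (fract_partial j F))"

definition L_rad :: "'a lie_super_scheme \<Rightarrow> (cmat \<Rightarrow> cmat \<Rightarrow> complex) \<Rightarrow> cmat set \<Rightarrow>
    cmat list \<Rightarrow> (cmat \<Rightarrow> complex) set \<Rightarrow> mfps fract \<Rightarrow> mfps fract" where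
  "L_rad G b a es P = (\<lambda>F\<in>localised es (nonzero_weights G a).
     laplacian b a es F +
     (\<Sum>\<alpha>\<in>P. of_int (mult_super G a \<alpha>) *
        (Fract (mexp es (\<lambda>v. 2 * \<alpha> v) + 1) 1 / Fract (mexp es (\<lambda>v. 2 * \<alpha> v) - 1) 1) *
        root_deriv b a es \<alpha> F))"

text \<open>Restriction of a functional to \<open>S(a) = U(a)\<close> (a is commutative and even), written as a
  power series and embedded into the fraction field.\<close>

lift_definition restrict_series :: "'a lie_super_scheme \<Rightarrow> cmat list \<Rightarrow>
    (free_alg set \<Rightarrow> complex) \<Rightarrow> mfps" is
  "\<lambda>G es f M. if set_mset M \<subseteq> {..<length es}
     then f (env_class G (prod_list (map (\<lambda>i. gen (es ! i) ^ count M i) [0..<length es])))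
          / (\<Prod>i<length es. fact (count M i))
     else 0" .

definition i_star :: "'a lie_super_scheme \<Rightarrow> cmat list \<Rightarrow>
    (free_alg set \<Rightarrow> complex) \<Rightarrow> mfps fract" where
  "i_star G es f = Fract (restrict_series G es f) 1"

end

theory Submission
  imports Defs "HOL-Computational_Algebra.Fundamental_Theorem_Algebra"
begin

text \<open>
  For a zonal functional f and an element v of the enveloping algebra, let \<open>\<Phi>(v)\<close> be the power
  series on a of the functional sending u to \<open>f (u v)\<close>, so that
  \<open>\<partial>\<Phi>(v)/\<partial>x_i = \<Phi>(e_i v)\<close>.  If x has weight \<open>\<alpha>\<close> for a, then
  \<open>G(v) = \<Phi>(x v) + e^{2\<alpha>} \<Phi>(\<theta>x v)\<close> satisfies
  \<open>\<partial>G(v)/\<partial>x_i = G(e_i v) + \<alpha>(e_i) G(v)\<close>, and its constant term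
  \<open>f ((x + \<theta>x) v)\<close> vanishes because \<open>x + \<theta>x\<close> is fixed by \<open>\<theta>\<close>; hence \<open>G = 0\<close>.
  Moving \<open>x + \<theta>x\<close> to the right, where it is killed as well, gives
  \<open>(e^{2\<alpha>} - 1) \<Phi>(x y) = e^{2\<alpha>} \<Phi>([x,y] + [\<theta>x,y])\<close>.

  For a restricted root \<open>\<alpha>\<close>, sum this over the normalised pairs of root vectors belonging to the
  roots \<open>\<beta>\<close> that restrict to \<open>\<alpha>\<close>.  The brackets \<open>[\<theta>x,y]\<close> of \<open>\<beta>\<close> and
  \<open>-\<theta>\<beta>\<close> cancel, and the brackets \<open>[x,y]\<close> have the same projection to a up to the sign of the
  parity, so that they add up to \<open>\<mu>\<^sub>\<alpha> \<partial>\<^sub>\<alpha>\<close>.  Roots vanishing on a have root vectors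
  fixed by \<open>\<theta>\<close> and contribute nothing, and the Cartan part of the Casimir element restricts to
  the Laplace operator of a.
\<close>

section \<open>Symmetric superpairs\<close>

text \<open>The four series enter only through the axioms of \<open>sym_superpair\<close>: each
  algebra is the fixed point set in some gl of an involutive automorphism (the identity for gl
  itself), and \<theta> is an automorphism commuting with it. The Jacobi identity is taken with an
  even first argument, the form in which a Cartan subalgebra acts by derivations.

  Identities of the enveloping algebra are handled in the free algebra, as equalities between values
  of a functional that vanishes on the ideal of relations.

  The exponent 2\<alpha> comes from \<theta>x having weight -\<alpha>: differentiating the
  exponential adds 2\<alpha>, so that both summands of G acquire the same factor \<alpha>.

  The coefficient e^{2\<alpha>}/(e^{2\<alpha>} - 1) obtained for \<alpha> differs from that of the
  theorem. The negative root supplies the rest: \<mu> is the same for -\<alpha>, the derivation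
  changes sign, and the two coefficients add up to e^{2\<alpha>}/(e^{2\<alpha>} - 1) +
  1/(e^{2\<alpha>} - 1).\<close>

locale sym_superpair =
  fixes X :: "'a sym_pair_scheme"
  assumes subspace_part: "s \<in> {0,1} \<Longrightarrow> cmat.subspace (part X s)"
    and part_Int: "part X 0 \<inter> part X 1 = {0}"
    and finite_dim: "\<exists>B. finite B \<and> whole X \<subseteq> cmat.span B"
    and brk_add_left: "brk X (x + y) z = brk X x z + brk X y z"
    and brk_add_right: "brk X z (x + y) = brk X z x + brk X z y"
    and brk_scale_left: "brk X (cscale c x) z = cscale c (brk X x z)"
    and brk_scale_right: "brk X z (cscale c x) = cscale c (brk X z x)"
    and brk_part: "\<lbrakk>s \<in> {0,1}; t \<in> {0,1}; x \<in> part X s; y \<in> part X t\<rbrakk>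
      \<Longrightarrow> brk X x y \<in> part X ((s + t) mod 2)"
    and brk_swap: "\<lbrakk>s \<in> {0,1}; t \<in> {0,1}; x \<in> part X s; y \<in> part X t\<rbrakk>
      \<Longrightarrow> brk X x y = cscale (- ((-1) ^ (s * t))) (brk X y x)"
    and even_derivation: "\<lbrakk>u \<in> part X 0; x \<in> whole X; y \<in> whole X\<rbrakk>
      \<Longrightarrow> brk X u (brk X x y) = brk X (brk X u x) y + brk X x (brk X u y)"
    and invol_add: "\<lbrakk>x \<in> whole X; y \<in> whole X\<rbrakk>
      \<Longrightarrow> invol X (x + y) = invol X x + invol X y"
    and invol_scale: "x \<in> whole X \<Longrightarrow> invol X (cscale c x) = cscale c (invol X x)"
    and invol_part: "\<lbrakk>s \<in> {0,1}; x \<in> part X s\<rbrakk> \<Longrightarrow> invol X x \<in> part X s"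
    and invol_invol: "x \<in> whole X \<Longrightarrow> invol X (invol X x) = x"
    and invol_brk: "\<lbrakk>x \<in> whole X; y \<in> whole X\<rbrakk>
      \<Longrightarrow> invol X (brk X x y) = brk X (invol X x) (invol X y)"

section \<open>The matrix Lie superalgebra gl(p,q)\<close>

lemma parity_cases: "parity p i = 0 \<or> parity p i = 1"
  by (simp add: parity_def)

lemma minus_one_power_cong:
  "even (m + n) \<Longrightarrow> (-1) ^ m = ((-1) ^ n :: 'a::ring_1)"
  by (metis even_add minus_one_power_iff)

lemma gl_part_support:
  assumes "x \<in> gl_part p q s" "x i j \<noteq> 0"
  shows "i < p + q" "j < p + q" "even (parity p i + parity p j + s)"
  using assms by (auto simp: gl_part_def)

lemma subspace_gl_part: "cmat.subspace (gl_part p q s)"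
proof (rule cmat.subspaceI)
  show "0 \<in> gl_part p q s"
    by (simp add: gl_part_def)
  show "x + y \<in> gl_part p q s" if "x \<in> gl_part p q s" "y \<in> gl_part p q s" for x y
    unfolding gl_part_def
  proof (clarify, goal_cases)
    case (1 i j)
    then have "x i j \<noteq> 0 \<or> y i j \<noteq> 0" by auto
    then show ?case
      using that gl_part_support[of x p q s i j] gl_part_support[of y p q s i j] by blast
  qed
  show "cscale c x \<in> gl_part p q s" if "x \<in> gl_part p q s" for c x
    using that by (auto simp: gl_part_def cscale_def)
qed

lemma gl_part_Int: "gl_part p q 0 \<inter> gl_part p q 1 = {0}"
proof -
  have "x = 0" if "x \<in> gl_part p q 0" "x \<in> gl_part p q 1" for x
  proof (intro ext)
    fix i j
    show "x i j = 0 i j"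
      using gl_part_support(3)[OF that(1), of i j] gl_part_support(3)[OF that(2), of i j] by auto
  qed
  then show ?thesis
    using cmat.subspace_0[OF subspace_gl_part] by blast
qed

definition matrix_unit :: "nat \<Rightarrow> nat \<Rightarrow> cmat" where
  "matrix_unit i j = (\<lambda>k l. if k = i \<and> l = j then 1 else 0)"

lemma supported_in_span_units:
  assumes "\<And>i j. x i j \<noteq> 0 \<Longrightarrow> i < d \<and> j < d"
  shows "x \<in> cmat.span ((\<lambda>(i, j). matrix_unit i j) ` ({..<d} \<times> {..<d}))"
proof -
  have "x = (\<Sum>ij\<in>{..<d} \<times> {..<d}. cscale (x (fst ij) (snd ij)) (matrix_unit (fst ij) (snd ij)))"
    (is "x = ?s")
  proof (intro ext)
    fix k l
    have ev: "(sum f A) k l = (\<Sum>z\<in>A. f z k l)" for f :: "nat \<times> nat \<Rightarrow> cmat" and A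
      by (induction A rule: infinite_finite_induct) auto
    have "?s k l = (\<Sum>ij\<in>{..<d} \<times> {..<d}. if ij = (k, l) then x k l else 0)"
      unfolding ev by (rule sum.cong) (auto simp: cscale_def matrix_unit_def)
    also have "\<dots> = x k l"
      using assms[of k l] by (auto simp: sum.delta)
    finally show "x k l = ?s k l" ..
  qed
  also have "\<dots> \<in> cmat.span ((\<lambda>(i, j). matrix_unit i j) ` ({..<d} \<times> {..<d}))"
    by (intro cmat.span_sum cmat.span_scale cmat.span_base) auto
  finally show ?thesis .
qed

text \<open>The sign in \<open>super_comm\<close> is attached to single entries. Where
  \<open>y i k\<close> and \<open>x k j\<close> are both nonzero, the parities of these entries are
  t and s, so the sign is (-1)^(st); elsewhere it multiplies zero.\<close>

lemma super_comm_homogeneous: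
  assumes "x \<in> gl_part p q s" "y \<in> gl_part p q t"
  shows "super_comm p q x y = (\<lambda>i j. \<Sum>k<p + q. x i k * y k j - (-1) ^ (s * t) * (y i k * x k j))"
proof (intro ext, unfold super_comm_def, rule sum.cong)
  fix i j k
  have "(-1) ^ ((parity p i + parity p k) * (parity p k + parity p j)) = ((-1) ^ (s * t) :: complex)"
    if "y i k \<noteq> 0" "x k j \<noteq> 0"
    using gl_part_support(3)[OF assms(1) that(2)] gl_part_support(3)[OF assms(2) that(1)]
    by (intro minus_one_power_cong) auto
  then show "x i k * y k j - (-1) ^ ((parity p i + parity p k) * (parity p k + parity p j)) *
      (y i k * x k j) = x i k * y k j - (-1) ^ (s * t) * (y i k * x k j)"
    by (cases "y i k = 0 \<or> x k j = 0") auto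
qed simp

lemma super_comm_swap:
  assumes "x \<in> gl_part p q s" "y \<in> gl_part p q t"
  shows "super_comm p q x y = cscale (- ((-1) ^ (s * t))) (super_comm p q y x)"
  unfolding super_comm_homogeneous[OF assms] super_comm_homogeneous[OF assms(2,1)]
  by (cases "even (s * t)")
     (auto simp: cscale_def fun_eq_iff sum_distrib_left algebra_simps sum_negf[symmetric]
       intro!: sum.cong)

lemma super_comm_nonzeroE:
  assumes "super_comm p q x y i j \<noteq> 0"
  obtains k where "x i k \<noteq> 0" "y k j \<noteq> 0" | k where "y i k \<noteq> 0" "x k j \<noteq> 0"
proof -
  obtain k where "x i k * y k j - (-1) ^ ((parity p i + parity p k) * (parity p k + parity p j)) *
      (y i k * x k j) \<noteq> 0"
    using assms unfolding super_comm_def by (rule sum.not_neutral_contains_not_neutral)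
  then show thesis
    using that(1)[of k] that(2)[of k] by (cases "x i k = 0 \<or> y k j = 0") auto
qed

lemma super_comm_gl_part:
  assumes x: "x \<in> gl_part p q s" and y: "y \<in> gl_part p q t" and "s \<in> {0,1}" "t \<in> {0,1}"
  shows "super_comm p q x y \<in> gl_part p q ((s + t) mod 2)"
proof -
  have "i < p + q \<and> j < p + q \<and> even (parity p i + parity p j + (s + t) mod 2)"
    if "super_comm p q x y i j \<noteq> 0" for i j
    using that
  proof (cases rule: super_comm_nonzeroE)
    case (1 k)
    then show ?thesis
      using gl_part_support[OF x 1(1)] gl_part_support[OF y 1(2)] by presburger
  next
    case (2 k)
    then show ?thesis
      using gl_part_support[OF y 2(1)] gl_part_support[OF x 2(2)] by presburger
  qed
  then show ?thesis by (simp add: gl_part_def)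
qed

lemma super_comm_linear:
  "super_comm p q (x + y) z = super_comm p q x z + super_comm p q y z"
  "super_comm p q z (x + y) = super_comm p q z x + super_comm p q z y"
  "super_comm p q (cscale c x) z = cscale c (super_comm p q x z)"
  "super_comm p q z (cscale c x) = cscale c (super_comm p q z x)"
  by (auto simp: super_comm_def cscale_def fun_eq_iff sum_distrib_left algebra_simps
      sum.distrib[symmetric] sum_subtractf[symmetric] intro!: sum.cong)

text \<open>The term of the supercommutator in which the factors are exchanged, sign included.
  Separating it from the ordinary product reduces the derivation property to associativity
  rules.\<close>

definition twisted_mul :: "nat \<Rightarrow> nat \<Rightarrow> cmat \<Rightarrow> cmat \<Rightarrow> cmat" where
  "twisted_mul p d y x = (\<lambda>i j. \<Sum>k<d.
     (-1) ^ ((parity p i + parity p k) * (parity p k + parity p j)) * (y i k * x k j))"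

lemma super_comm_eq: "super_comm p q x y = mmul (p + q) x y - twisted_mul p (p + q) y x"
  by (simp add: super_comm_def mmul_def twisted_mul_def sum_subtractf fun_eq_iff)

lemma mmul_assoc: "mmul d (mmul d x y) z = mmul d x (mmul d y z)"
proof (intro ext)
  fix i j
  show "mmul d (mmul d x y) z i j = mmul d x (mmul d y z) i j"
    unfolding mmul_def sum_distrib_left sum_distrib_right
    by (subst sum.swap) (simp add: mult.assoc)
qed

lemma mmul_diff:
  "mmul d (x - y) z = mmul d x z - mmul d y z" "mmul d z (x - y) = mmul d z x - mmul d z y"
  by (auto simp: mmul_def fun_eq_iff algebra_simps sum_subtractf)

lemma twisted_mul_diff:
  "twisted_mul p d (x - y) z = twisted_mul p d x z - twisted_mul p d y z"
  "twisted_mul p d z (x - y) = twisted_mul p d z x - twisted_mul p d z y"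
  by (auto simp: twisted_mul_def fun_eq_iff algebra_simps sum_subtractf)

lemma parity_even_part: "u \<in> gl_part p q 0 \<Longrightarrow> u i j \<noteq> 0 \<Longrightarrow> parity p i = parity p j"
  using gl_part_support(3)[of u p q 0 i j] parity_cases[of p i] parity_cases[of p j] by auto

text \<open>An even matrix links only indices of equal parity, so multiplying by it leaves every
  sign of \<open>twisted_mul\<close> unchanged. The signed product therefore associates with even
  factors, and it agrees with the ordinary one as soon as one factor is even.\<close>

lemma twisted_mul_even:
  assumes u: "u \<in> gl_part p q 0"
  shows "mmul d u (twisted_mul p d y x) = twisted_mul p d (mmul d u y) x"
    and "mmul d (twisted_mul p d y x) u = twisted_mul p d y (mmul d x u)"
    and "twisted_mul p d (mmul d y u) x = twisted_mul p d y (mmul d u x)"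
    and "twisted_mul p d x u = mmul d x u"
    and "twisted_mul p d u x = mmul d u x"
proof -
  have par: "u i j = 0 \<or> parity p i = parity p j" for i j
    using parity_even_part[OF u] by blast
  show "mmul d u (twisted_mul p d y x) = twisted_mul p d (mmul d u y) x"
  proof (intro ext)
    fix i j
    have eq: "u i l * ((-1) ^ ((parity p l + parity p k) * (parity p k + parity p j)) * (y l k * x k j))
      = (-1) ^ ((parity p i + parity p k) * (parity p k + parity p j)) * (u i l * y l k * x k j)"
      for k l using par[of i l] by auto
    show "mmul d u (twisted_mul p d y x) i j = twisted_mul p d (mmul d u y) x i j"
      unfolding mmul_def twisted_mul_def sum_distrib_left sum_distrib_right
      by (subst sum.swap) (simp only: eq)
  qed
  show "mmul d (twisted_mul p d y x) u = twisted_mul p d y (mmul d x u)"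
  proof (intro ext)
    fix i j
    have eq: "(-1) ^ ((parity p i + parity p k) * (parity p k + parity p l)) * (y i k * x k l) * u l j
      = (-1) ^ ((parity p i + parity p k) * (parity p k + parity p j)) * (y i k * (x k l * u l j))"
      for k l using par[of l j] by auto
    show "mmul d (twisted_mul p d y x) u i j = twisted_mul p d y (mmul d x u) i j"
      unfolding mmul_def twisted_mul_def sum_distrib_left sum_distrib_right
      by (subst sum.swap) (simp only: eq)
  qed
  show "twisted_mul p d (mmul d y u) x = twisted_mul p d y (mmul d u x)"
  proof (intro ext)
    fix i j
    have "twisted_mul p d (mmul d y u) x i j = (\<Sum>k<d. \<Sum>l<d.
        (-1) ^ ((parity p i + parity p k) * (parity p k + parity p j)) * (y i l * u l k * x k j))"
      by (simp add: mmul_def twisted_mul_def sum_distrib_left sum_distrib_right)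
    also have "\<dots> = (\<Sum>k<d. \<Sum>l<d.
        (-1) ^ ((parity p i + parity p l) * (parity p l + parity p j)) * (y i l * u l k * x k j))"
    proof (intro sum.cong refl)
      fix k l
      show "(-1) ^ ((parity p i + parity p k) * (parity p k + parity p j)) * (y i l * u l k * x k j)
        = (-1) ^ ((parity p i + parity p l) * (parity p l + parity p j)) * (y i l * u l k * x k j)"
        using par[of l k] by auto
    qed
    also have "\<dots> = twisted_mul p d y (mmul d u x) i j"
      by (subst sum.swap) (simp add: mmul_def twisted_mul_def sum_distrib_left mult.assoc)
    finally show "twisted_mul p d (mmul d y u) x i j = twisted_mul p d y (mmul d u x) i j" .
  qed
  have eqs: "(-1) ^ ((parity p i + parity p k) * (parity p k + parity p j)) * (x i k * u k j) = x i k * u k j"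
    "(-1) ^ ((parity p i + parity p k) * (parity p k + parity p j)) * (u i k * x k j) = u i k * x k j"
    for i j k
    using par[of i k] par[of k j] by auto
  show "twisted_mul p d x u = mmul d x u" "twisted_mul p d u x = mmul d u x"
    by (simp_all only: mmul_def twisted_mul_def eqs)
qed

lemma super_comm_even_derivation:
  assumes "u \<in> gl_part p q 0"
  shows "super_comm p q u (super_comm p q x y) =
    super_comm p q (super_comm p q u x) y + super_comm p q x (super_comm p q u y)"
  unfolding super_comm_eq mmul_diff twisted_mul_diff mmul_assoc twisted_mul_even[OF assms]
    diff_diff_eq2
  by (simp add: twisted_mul_even[OF assms] mmul_assoc algebra_simps)

section \<open>Involutive automorphisms of gl and their fixed points\<close>

definition supported :: "nat \<Rightarrow> cmat \<Rightarrow> bool" where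
  "supported d x \<longleftrightarrow> (\<forall>i j. x i j \<noteq> 0 \<longrightarrow> i < d \<and> j < d)"

lemma supportedD: "supported d x \<Longrightarrow> \<not> (i < d \<and> j < d) \<Longrightarrow> x i j = 0"
  by (auto simp: supported_def)

lemma supported_gl_part: "x \<in> gl_part p q s \<Longrightarrow> supported (p + q) x"
  by (auto simp: supported_def gl_part_def)

lemma supported_add: "supported d x \<Longrightarrow> supported d y \<Longrightarrow> supported d (x + y)"
  unfolding supported_def by (metis add.right_neutral plus_fun_apply)

lemma supported_cscale: "supported d x \<Longrightarrow> supported d (cscale c x)"
  by (auto simp: supported_def cscale_def)

text \<open>Apart from the grading, the conditions range over all matrices, also those with entries
  outside the p + q square. The truncated products that define the involutions of
  \<open>gl_osp\<close> and \<open>osp_gl\<close> are not involutive there; they are replaced by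
  entry formulas with the same values on \<open>supported\<close> matrices.\<close>

definition gl_involution :: "nat \<Rightarrow> nat \<Rightarrow> (cmat \<Rightarrow> cmat) \<Rightarrow> bool" where
  "gl_involution p q \<phi> \<longleftrightarrow>
     (\<forall>x y. \<phi> (x + y) = \<phi> x + \<phi> y) \<and> (\<forall>c x. \<phi> (cscale c x) = cscale c (\<phi> x)) \<and>
     (\<forall>s. \<forall>x\<in>gl_part p q s. \<phi> x \<in> gl_part p q s) \<and> (\<forall>x. \<phi> (\<phi> x) = x) \<and>
     (\<forall>x y. \<phi> (super_comm p q x y) = super_comm p q (\<phi> x) (\<phi> y))"

lemma gl_involution_id: "gl_involution p q (\<lambda>x. x)"
  by (simp add: gl_involution_def)

text \<open>The fixed points of an automorphism \<psi> inherit the axioms from gl, and an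
  automorphism \<phi> that commutes with \<psi> maps them to themselves. The identity as \<psi>
  gives gl itself.\<close>

lemma sym_superpair_fixed_points:
  fixes X :: "'a sym_pair_scheme"
  assumes \<phi>: "gl_involution p q \<phi>" and \<psi>: "gl_involution p q \<psi>"
    and comm: "\<And>x. \<phi> (\<psi> x) = \<psi> (\<phi> x)"
    and part: "\<And>s. part X s = {x \<in> gl_part p q s. \<psi> x = x}"
    and brk: "brk X = super_comm p q"
    and invol: "\<And>x. supported (p + q) x \<Longrightarrow> invol X x = \<phi> x"
  shows "sym_superpair X"
proof -
  have \<psi>_zero: "\<psi> 0 = 0"
  proof -
    have "\<psi> (0 + 0) = \<psi> 0 + \<psi> 0"
      using \<psi> unfolding gl_involution_def by blast
    then show ?thesis by simp
  qed
  have sub: "cmat.subspace (part X s)" for s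
    using subspace_gl_part[of p q s] \<psi> \<psi>_zero
    by (auto simp: part cmat.subspace_def gl_involution_def)
  have gl: "x \<in> gl_part p q s" if "x \<in> part X s" for x s
    using that by (simp add: part)
  have whole_supp: "supported (p + q) x" if "x \<in> whole X" for x
    using that by (auto simp: whole_def intro!: supported_add dest!: gl supported_gl_part)
  have part_whole: "x \<in> whole X" if "x \<in> part X s" "s \<in> {0,1}" for x s
  proof -
    have "x + 0 \<in> whole X" if "x \<in> part X 0" for x
      using that cmat.subspace_0[OF sub[of 1]] unfolding whole_def by blast
    moreover have "0 + x \<in> whole X" if "x \<in> part X 1" for x
      using that cmat.subspace_0[OF sub[of 0]] unfolding whole_def by blast
    ultimately show ?thesis using that by auto
  qed
  show ?thesis
  proof
    show "cmat.subspace (part X s)" for s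
      by (rule sub)
    show "part X 0 \<inter> part X 1 = {0}"
      using gl_part_Int[of p q] cmat.subspace_0[OF sub] by (auto simp: part)
    show "\<exists>B. finite B \<and> whole X \<subseteq> cmat.span B"
    proof (intro exI conjI subsetI)
      show "finite ((\<lambda>(i, j). matrix_unit i j) ` ({..<p + q} \<times> {..<p + q}))" by simp
      show "x \<in> cmat.span ((\<lambda>(i, j). matrix_unit i j) ` ({..<p + q} \<times> {..<p + q}))"
        if "x \<in> whole X" for x
        using whole_supp[OF that] by (intro supported_in_span_units) (auto simp: supported_def)
    qed
    show "brk X x y \<in> part X ((s + t) mod 2)"
      if "s \<in> {0,1}" "t \<in> {0,1}" "x \<in> part X s" "y \<in> part X t" for s t x y
    proof -
      have "\<psi> (super_comm p q x y) = super_comm p q x y"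
        using \<psi> that by (simp add: part gl_involution_def)
      then show ?thesis
        using super_comm_gl_part[OF gl gl] that by (simp add: part brk)
    qed
    show "brk X x y = cscale (- ((-1) ^ (s * t))) (brk X y x)"
      if "x \<in> part X s" "y \<in> part X t" for s t x y
      unfolding brk using super_comm_swap[OF gl[OF that(1)] gl[OF that(2)]] .
    show "brk X u (brk X x y) = brk X (brk X u x) y + brk X x (brk X u y)"
      if "u \<in> part X 0" for u x y
      using super_comm_even_derivation[OF gl] that by (simp add: brk)
    show "invol X (x + y) = invol X x + invol X y" if "x \<in> whole X" "y \<in> whole X" for x y
      using \<phi> that[THEN whole_supp] by (simp add: invol supported_add gl_involution_def)
    show "invol X (cscale c x) = cscale c (invol X x)" if "x \<in> whole X" for c x
      using \<phi> that[THEN whole_supp] by (simp add: invol supported_cscale gl_involution_def)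
    have inv_part: "invol X x \<in> part X s" if "x \<in> part X s" for s x
      using \<phi> comm[of x] that gl[OF that] supported_gl_part[OF gl[OF that]]
      by (simp add: invol part gl_involution_def)
    then show "invol X x \<in> part X s" if "x \<in> part X s" for s x
      using that .
    have \<phi>_whole: "supported (p + q) (\<phi> x)" if xX: "x \<in> whole X" for x
    proof -
      obtain y z where "x = y + z" "y \<in> part X 0" "z \<in> part X 1"
        using xX unfolding whole_def by blast
      moreover have "\<phi> (y + z) = \<phi> y + \<phi> z"
        using \<phi> by (simp add: gl_involution_def)
      moreover have "supported (p + q) (\<phi> y)" "supported (p + q) (\<phi> z)"
        using \<phi> calculation(2,3) unfolding gl_involution_def
        by (meson gl supported_gl_part)+
      ultimately show ?thesis by (simp add: supported_add)
    qed
    then show "invol X (invol X x) = x" if "x \<in> whole X" for x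
      using \<phi> that whole_supp[OF that] by (simp add: invol gl_involution_def)
    have "supported (p + q) (super_comm p q x y)" if "supported (p + q) x" "supported (p + q) y" for x y
      using that by (auto simp: supported_def elim!: super_comm_nonzeroE)
    then show "invol X (brk X x y) = brk X (invol X x) (invol X y)"
      if "x \<in> whole X" "y \<in> whole X" for x y
      using \<phi> that[THEN whole_supp] by (simp add: invol brk gl_involution_def)
  qed (simp_all add: brk super_comm_linear)
qed

section \<open>Conjugation by signed permutation matrices\<close>

definition signed_conj :: "(nat \<Rightarrow> complex) \<Rightarrow> (nat \<Rightarrow> nat) \<Rightarrow> cmat \<Rightarrow> cmat" where
  "signed_conj c \<pi> x = (\<lambda>i j. c i * c j * x (\<pi> i) (\<pi> j))"

lemma sum_lessThan_involution:
  fixes d :: nat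
  assumes "\<And>i. \<pi> (\<pi> i) = i" "\<And>i. \<pi> i < d \<longleftrightarrow> i < d"
  shows "(\<Sum>k<d. f (\<pi> k)) = (\<Sum>k<d. f k)"
  by (rule sum.reindex_bij_witness[where i = \<pi> and j = \<pi>]) (use assms in auto)

text \<open>\<open>signed_conj c \<pi>\<close> is conjugation by the matrix M with entry
  \<open>c i\<close> at \<open>(i, \<pi> i)\<close>, whose inverse is its transpose because the
  entries are 1 or -1. The constant e is the scalar M^2: it is 1 for a diagonal matrix of signs and
  -1 for \<open>rot\<close>.\<close>

lemma gl_involution_signed_conj:
  assumes \<pi>: "\<And>i. \<pi> (\<pi> i) = i" "\<And>i. \<pi> i < p + q \<longleftrightarrow> i < p + q"
    "\<And>i. parity p (\<pi> i) = parity p i"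
    and c: "\<And>i. c i * c i = 1" "\<And>i. c i * c (\<pi> i) = e" "e * e = 1"
  shows "gl_involution p q (signed_conj c \<pi>)"
  unfolding gl_involution_def
proof (intro conjI allI ballI)
  fix x y a
  show "signed_conj c \<pi> (x + y) = signed_conj c \<pi> x + signed_conj c \<pi> y"
    by (simp add: signed_conj_def fun_eq_iff algebra_simps)
  show "signed_conj c \<pi> (cscale a x) = cscale a (signed_conj c \<pi> x)"
    by (simp add: signed_conj_def cscale_def fun_eq_iff)
  show "signed_conj c \<pi> x \<in> gl_part p q s" if "x \<in> gl_part p q s" for s
    unfolding gl_part_def
  proof (clarify, goal_cases)
    case (1 i j)
    then have "x (\<pi> i) (\<pi> j) \<noteq> 0" by (auto simp: signed_conj_def)
    then show ?case
      using gl_part_support[OF that] \<pi> by metis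
  qed
  show "signed_conj c \<pi> (signed_conj c \<pi> x) = x"
  proof (intro ext)
    fix i j
    have "signed_conj c \<pi> (signed_conj c \<pi> x) i j = (c i * c (\<pi> i)) * (c j * c (\<pi> j)) * x i j"
      by (simp add: signed_conj_def \<pi> mult_ac)
    then show "signed_conj c \<pi> (signed_conj c \<pi> x) i j = x i j"
      by (simp only: c mult_1)
  qed
  show "signed_conj c \<pi> (super_comm p q x y) =
      super_comm p q (signed_conj c \<pi> x) (signed_conj c \<pi> y)"
  proof (intro ext)
    fix i j
    have cc: "c i * c k * z * (c k * c j * w) = c i * c j * (z * w)" for k z w
    proof -
      have "c i * c k * z * (c k * c j * w) = (c k * c k) * (c i * c j * (z * w))"
        by (simp only: mult_ac)
      then show ?thesis by (simp only: c(1) mult_1)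
    qed
    have "super_comm p q (signed_conj c \<pi> x) (signed_conj c \<pi> y) i j =
      (\<Sum>k<p + q. c i * c j * (x (\<pi> i) (\<pi> k) * y (\<pi> k) (\<pi> j)
        - (-1) ^ ((parity p (\<pi> i) + parity p (\<pi> k)) * (parity p (\<pi> k) + parity p (\<pi> j)))
          * (y (\<pi> i) (\<pi> k) * x (\<pi> k) (\<pi> j))))"
      unfolding super_comm_def signed_conj_def cc \<pi>(3) by (simp add: right_diff_distrib mult_ac)
    also have "\<dots> = signed_conj c \<pi> (super_comm p q x y) i j"
      by (subst sum_lessThan_involution[OF \<pi>(1,2), where f = "\<lambda>k. c i * c j * (x (\<pi> i) k * y k (\<pi> j)
        - (-1) ^ ((parity p (\<pi> i) + parity p k) * (parity p k + parity p (\<pi> j)))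
          * (y (\<pi> i) k * x k (\<pi> j)))"])
         (simp add: super_comm_def signed_conj_def sum_distrib_left)
    finally show "signed_conj c \<pi> (super_comm p q x y) i j =
      super_comm p q (signed_conj c \<pi> x) (signed_conj c \<pi> y) i j" ..
  qed
qed

section \<open>The Gram matrix, the orthosymplectic adjoint and the rotation\<close>

definition twin :: "nat \<Rightarrow> nat" where "twin i = (if even i then i + 1 else i - 1)"

definition alt_sign :: "nat \<Rightarrow> complex" where "alt_sign i = (if even i then 1 else -1)"

lemma twin_twin: "twin (twin i) = i"
  by (auto simp: twin_def elim: oddE)

lemma twin_less_double: "twin i < 2 * n \<longleftrightarrow> i < 2 * n"
  unfolding twin_def by presburger

lemma alt_sign_twin: "alt_sign (twin i) = - alt_sign i"
  by (auto simp: twin_def alt_sign_def elim!: oddE)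

lemma alt_sign_square: "alt_sign i * alt_sign i = 1"
  by (simp add: alt_sign_def)

lemma rot_eq: "rot i j = (if j = twin i then alt_sign i else 0)"
proof -
  have "j = i - 1 \<longleftrightarrow> i = j + 1" if "odd i"
    using that by (auto elim: oddE)
  then show ?thesis by (auto simp: rot_def twin_def alt_sign_def)
qed

text \<open>Column of the only nonzero entry in row i of the Gram matrix. The shift by p is kept
  because p may be odd: the symplectic pairs start at p, which need not be an even index.\<close>

definition gram_perm :: "nat \<Rightarrow> nat \<Rightarrow> nat" where
  "gram_perm p i = (if i < p then i else p + twin (i - p))"

definition gram_sign :: "nat \<Rightarrow> nat \<Rightarrow> complex" where
  "gram_sign p i = (if i < p then 1 else alt_sign (i - p))"

lemma gram_perm_perm: "gram_perm p (gram_perm p i) = i"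
  by (simp add: gram_perm_def twin_twin)

lemma gram_perm_less: "gram_perm p i < p + 2 * q \<longleftrightarrow> i < p + 2 * q"
  using twin_less_double[of "i - p" q] by (auto simp: gram_perm_def)

lemma parity_gram_perm: "parity p (gram_perm p i) = parity p i"
  by (simp add: gram_perm_def parity_def)

text \<open>The form is symmetric on the even part and skew on the odd part, so exchanging the two
  indices of a pair changes the sign exactly on the odd part.\<close>

lemma gram_sign_perm: "gram_sign p (gram_perm p i) = (-1) ^ parity p i * gram_sign p i"
  by (simp add: gram_perm_def gram_sign_def parity_def alt_sign_twin)

lemma gram_sign_square: "gram_sign p i * gram_sign p i = 1"
  by (simp add: gram_sign_def alt_sign_square)

lemma gram_eq: "gram p i j = (if j = gram_perm p i then gram_sign p i else 0)"
  by (auto simp: gram_def gram_perm_def gram_sign_def rot_eq)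

lemma gram_perm_eq_iff: "j = gram_perm p i \<longleftrightarrow> i = gram_perm p j"
  by (metis gram_perm_perm)

text \<open>The map -B^-1 x^st B written in entries, B being the Gram matrix. It serves twice: as
  the involution of \<open>gl_osp\<close>, and as the automorphism of gl whose fixed points are
  osp.\<close>

definition gram_adjoint :: "nat \<Rightarrow> cmat \<Rightarrow> cmat" where
  "gram_adjoint p x = (\<lambda>i j. - (gram_sign p (gram_perm p i) * gram_sign p (gram_perm p j) *
     (-1) ^ ((parity p i + parity p j) * parity p i)) * x (gram_perm p j) (gram_perm p i))"

text \<open>The supertranspose applied twice multiplies the entry (i,j) by (-1)^(|i|+|j|). Skewness
  of the odd block of the Gram matrix contributes the same sign, so the square of the map is the
  identity.\<close>

lemma gl_involution_gram_adjoint: "gl_involution p (2 * q) (gram_adjoint p)"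
  unfolding gl_involution_def
proof (intro conjI allI ballI)
  fix x y a
  let ?\<pi> = "gram_perm p"
  let ?G = "\<lambda>i. gram_sign p (?\<pi> i)"
  let ?P = "parity p"
  show "gram_adjoint p (x + y) = gram_adjoint p x + gram_adjoint p y"
    by (simp add: gram_adjoint_def fun_eq_iff algebra_simps)
  show "gram_adjoint p (cscale a x) = cscale a (gram_adjoint p x)"
    by (simp add: gram_adjoint_def cscale_def fun_eq_iff)
  show "gram_adjoint p x \<in> gl_part p (2 * q) s" if "x \<in> gl_part p (2 * q) s" for s
    unfolding gl_part_def
  proof (clarify, goal_cases)
    case (1 i j)
    then have "x (?\<pi> j) (?\<pi> i) \<noteq> 0" by (auto simp: gram_adjoint_def)
    then show ?case
      using gl_part_support[OF that, of "?\<pi> j" "?\<pi> i"]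
      by (simp add: gram_perm_less parity_gram_perm add_ac)
  qed
  show "gram_adjoint p (gram_adjoint p x) = x"
  proof (intro ext)
    fix i j
    have "gram_adjoint p (gram_adjoint p x) i j =
      ((-1) ^ ?P i * (-1) ^ ?P j * ((-1) ^ ((?P i + ?P j) * ?P i) * (-1) ^ ((?P j + ?P i) * ?P j))) *
      ((gram_sign p i * gram_sign p i) * (gram_sign p j * gram_sign p j)) * x i j"
      by (simp add: gram_adjoint_def gram_perm_perm parity_gram_perm gram_sign_perm[of p i]
          gram_sign_perm[of p j] mult_ac)
    moreover have "(-1) ^ ?P i * (-1) ^ ?P j * ((-1) ^ ((?P i + ?P j) * ?P i) *
        (-1) ^ ((?P j + ?P i) * ?P j)) = (1 :: complex)"
      using parity_cases[of p i] parity_cases[of p j] by auto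
    ultimately show "gram_adjoint p (gram_adjoint p x) i j = x i j"
      by (simp only: gram_sign_square mult_1)
  qed
  show "gram_adjoint p (super_comm p (2 * q) x y) =
      super_comm p (2 * q) (gram_adjoint p x) (gram_adjoint p y)"
  proof (intro ext)
    fix i j
    let ?e = "\<lambda>i j. (-1) ^ ((?P i + ?P j) * ?P i) :: complex"
    let ?s = "\<lambda>k. (-1) ^ ((?P i + ?P k) * (?P k + ?P j)) :: complex"
    \<comment> \<open>The signs of the supertranspose are multiplicative only up to the sign of the
      supercommutator. So reversing the order of the factors exchanges the plain and the signed
      product of the bracket.\<close>
    have e: "?e i k * ?e k j = ?e i j * ?s k" and s: "?s k * ?s k = 1" for k
      using parity_cases[of p i] parity_cases[of p j] parity_cases[of p k] by auto
    have GG: "?G k * ?G k = 1" for k by (rule gram_sign_square)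
    have prod: "gram_adjoint p u i k * gram_adjoint p v k j =
      ?G i * ?G j * ?e i j * ?s k * (v (?\<pi> j) (?\<pi> k) * u (?\<pi> k) (?\<pi> i))" for u v k
    proof -
      have "gram_adjoint p u i k * gram_adjoint p v k j =
        ?G i * ?G j * (?G k * ?G k) * (?e i k * ?e k j) * (v (?\<pi> j) (?\<pi> k) * u (?\<pi> k) (?\<pi> i))"
        by (simp add: gram_adjoint_def mult_ac)
      then show ?thesis by (simp only: GG e) (simp add: mult_ac)
    qed
    let ?f = "\<lambda>k. - (?G i * ?G j * ?e i j) * (x (?\<pi> j) k * y k (?\<pi> i)
        - (-1) ^ ((?P (?\<pi> j) + ?P k) * (?P k + ?P (?\<pi> i))) * (y (?\<pi> j) k * x k (?\<pi> i)))"
    have "super_comm p (2 * q) (gram_adjoint p x) (gram_adjoint p y) i j =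
        (\<Sum>k<p + 2 * q. ?f (?\<pi> k))"
      unfolding super_comm_def
    proof (rule sum.cong)
      fix k
      have "?s k * (gram_adjoint p y i k * gram_adjoint p x k j) =
        (?s k * ?s k) * (?G i * ?G j * ?e i j * (x (?\<pi> j) (?\<pi> k) * y (?\<pi> k) (?\<pi> i)))"
        unfolding prod by (simp only: mult_ac)
      also have "\<dots> = ?G i * ?G j * ?e i j * (x (?\<pi> j) (?\<pi> k) * y (?\<pi> k) (?\<pi> i))"
        by (simp only: s mult_1)
      finally show "gram_adjoint p x i k * gram_adjoint p y k j -
          ?s k * (gram_adjoint p y i k * gram_adjoint p x k j) = ?f (?\<pi> k)"
        by (simp only: prod parity_gram_perm) (simp add: algebra_simps)
    qed simp
    also have "\<dots> = (\<Sum>k<p + 2 * q. ?f k)"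
      by (rule sum_lessThan_involution) (simp_all add: gram_perm_perm gram_perm_less)
    also have "\<dots> = gram_adjoint p (super_comm p (2 * q) x y) i j"
      by (simp add: gram_adjoint_def super_comm_def sum_distrib_left)
    finally show "gram_adjoint p (super_comm p (2 * q) x y) i j =
      super_comm p (2 * q) (gram_adjoint p x) (gram_adjoint p y) i j" ..
  qed
qed

text \<open>The first and third hypotheses say that the signed permutation matrix commutes with the
  inverse of the Gram matrix, the second that it is even, so that conjugation by it is compatible
  with the supertranspose.\<close>

lemma signed_conj_gram_adjoint_commute:
  assumes "\<And>i. \<pi> (gram_perm p i) = gram_perm p (\<pi> i)" "\<And>i. parity p (\<pi> i) = parity p i"
    and "\<And>i. c (gram_perm p i) * gram_sign p (gram_perm p i) = c i * gram_sign p (gram_perm p (\<pi> i))"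
  shows "signed_conj c \<pi> (gram_adjoint p x) = gram_adjoint p (signed_conj c \<pi> x)"
proof (intro ext)
  fix i j
  let ?G = "\<lambda>i. gram_sign p (gram_perm p i)"
  let ?e = "(-1) ^ ((parity p i + parity p j) * parity p i) :: complex"
  have "signed_conj c \<pi> (gram_adjoint p x) i j =
    - ((c i * ?G (\<pi> i)) * (c j * ?G (\<pi> j)) * ?e) * x (gram_perm p (\<pi> j)) (gram_perm p (\<pi> i))"
    by (simp add: signed_conj_def gram_adjoint_def assms(2) mult_ac)
  also have "\<dots> = gram_adjoint p (signed_conj c \<pi> x) i j"
    by (simp add: signed_conj_def gram_adjoint_def assms(1) assms(3)[symmetric] mult_ac)
  finally show "signed_conj c \<pi> (gram_adjoint p x) i j = gram_adjoint p (signed_conj c \<pi> x) i j" .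
qed

lemma mmul_gram:
  "mmul (p + 2 * q) (gram p) x i j =
     (if i < p + 2 * q then gram_sign p i * x (gram_perm p i) j else 0)"
  "mmul (p + 2 * q) (mtrans (gram p)) x i j =
     (if i < p + 2 * q then gram_sign p (gram_perm p i) * x (gram_perm p i) j else 0)"
  "mmul (p + 2 * q) x (gram p) i j =
     (if j < p + 2 * q then gram_sign p (gram_perm p j) * x i (gram_perm p j) else 0)"
proof -
  have "mmul (p + 2 * q) (gram p) x i j =
      (\<Sum>k<p + 2 * q. if gram_perm p i = k then gram_sign p i * x k j else 0)"
    unfolding mmul_def gram_eq by (rule sum.cong) auto
  then show "mmul (p + 2 * q) (gram p) x i j =
     (if i < p + 2 * q then gram_sign p i * x (gram_perm p i) j else 0)"
    by (simp add: sum.delta' gram_perm_less)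
  have "mmul (p + 2 * q) (mtrans (gram p)) x i j =
      (\<Sum>k<p + 2 * q. if gram_perm p i = k then gram_sign p k * x k j else 0)"
    unfolding mmul_def gram_eq mtrans_def gram_perm_eq_iff[of i] by (rule sum.cong) auto
  then show "mmul (p + 2 * q) (mtrans (gram p)) x i j =
     (if i < p + 2 * q then gram_sign p (gram_perm p i) * x (gram_perm p i) j else 0)"
    by (simp add: sum.delta' gram_perm_less)
  have "mmul (p + 2 * q) x (gram p) i j =
      (\<Sum>k<p + 2 * q. if gram_perm p j = k then gram_sign p k * x i k else 0)"
    unfolding mmul_def gram_eq gram_perm_eq_iff[of j] by (rule sum.cong) auto
  then show "mmul (p + 2 * q) x (gram p) i j =
     (if j < p + 2 * q then gram_sign p (gram_perm p j) * x i (gram_perm p j) else 0)"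
    by (simp add: sum.delta' gram_perm_less)
qed

lemma gram_adjoint_eq:
  assumes "supported (p + 2 * q) x"
  shows "- mmul (p + 2 * q) (mtrans (gram p)) (mmul (p + 2 * q) (supertranspose p x) (gram p))
    = gram_adjoint p x"
proof (intro ext)
  fix i j
  show "(- mmul (p + 2 * q) (mtrans (gram p)) (mmul (p + 2 * q) (supertranspose p x) (gram p))) i j
    = gram_adjoint p x i j"
    using supportedD[OF assms, of "gram_perm p j" "gram_perm p i"]
    by (auto simp: mmul_gram gram_adjoint_def supertranspose_def parity_gram_perm gram_perm_less)
qed

text \<open>Multiplication of the defining equation x^st B + B x = 0 by B^-1 turns it into x = -B^-1
  x^st B.\<close>

lemma osp_part_eq: "osp_part p q s = {x \<in> gl_part p (2 * q) s. gram_adjoint p x = x}"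
proof -
  have "mmul (p + 2 * q) (supertranspose p x) (gram p) + mmul (p + 2 * q) (gram p) x = 0 \<longleftrightarrow>
    gram_adjoint p x = x" (is "?l + ?r = 0 \<longleftrightarrow> _") if "x \<in> gl_part p (2 * q) s" for x
  proof -
    let ?\<pi> = "gram_perm p"
    have supp: "supported (p + 2 * q) x"
      using that by (rule supported_gl_part)
    \<comment> \<open>The Gram matrix has one entry in each row, so the equation at
      \<open>(?\<pi> i, j)\<close> is, up to a sign, the fixed point condition at
      \<open>(i, j)\<close>. The first alternative covers indices outside the square.\<close>
    have key: "x i j = 0 \<and> gram_adjoint p x i j = 0 \<or>
        gram_sign p (?\<pi> i) * (x i j - gram_adjoint p x i j) = (?l + ?r) (?\<pi> i) j" for i j
    proof (cases "i < p + 2 * q \<and> j < p + 2 * q")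
      case True
      have "gram_sign p (?\<pi> i) * gram_adjoint p x i j =
        - (gram_sign p (?\<pi> i) * gram_sign p (?\<pi> i)) * (gram_sign p (?\<pi> j) *
          (-1) ^ ((parity p i + parity p j) * parity p i) * x (?\<pi> j) (?\<pi> i))"
        by (simp add: gram_adjoint_def mult_ac)
      then have "gram_sign p (?\<pi> i) * gram_adjoint p x i j =
        - (gram_sign p (?\<pi> j) * (-1) ^ ((parity p i + parity p j) * parity p i) * x (?\<pi> j) (?\<pi> i))"
        by (simp only: gram_sign_square) simp
      then have "gram_sign p (?\<pi> i) * (x i j - gram_adjoint p x i j) = (?l + ?r) (?\<pi> i) j"
        using True by (simp add: mmul_gram gram_perm_less gram_perm_perm supertranspose_def
            parity_gram_perm right_diff_distrib)
      then show ?thesis ..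
    next
      case False
      then show ?thesis
        using supportedD[OF supp, of i j] supportedD[OF supp, of "?\<pi> j" "?\<pi> i"]
        by (auto simp: gram_adjoint_def gram_perm_less)
    qed
    have nz: "gram_sign p i \<noteq> 0" for i
      using gram_sign_square[of p i] by auto
    show ?thesis
    proof
      assume z: "?l + ?r = 0"
      show "gram_adjoint p x = x"
      proof (intro ext)
        fix i j
        show "gram_adjoint p x i j = x i j"
          using key[of i j] nz[of "?\<pi> i"] unfolding z by auto
      qed
    next
      assume fixed: "gram_adjoint p x = x"
      show "?l + ?r = 0"
      proof (intro ext)
        fix i j
        show "(?l + ?r) i j = 0 i j"
        proof (cases "i < p + 2 * q \<and> j < p + 2 * q")
          case True
          have "gram_sign p i * (gram_sign p i * x (?\<pi> i) j) = gram_sign p i * - ?l i j"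
            using True fun_cong[OF fun_cong[OF fixed], of "?\<pi> i" j] gram_sign_square[of p i]
            by (simp add: gram_adjoint_def gram_perm_perm mmul_gram supertranspose_def
                parity_gram_perm mult.assoc[symmetric])
          then have "gram_sign p i * x (?\<pi> i) j = - ?l i j"
            using nz[of i] by (simp only: mult_cancel_left) simp
          then show ?thesis
            using True by (simp add: mmul_gram)
        next
          case False
          then show ?thesis
            using supportedD[OF supp, of "?\<pi> i" j] supportedD[OF supp, of "?\<pi> j" i]
            by (auto simp: mmul_gram gram_perm_less supertranspose_def)
        qed
      qed
    qed
  qed
  then show ?thesis unfolding osp_part_def by blast
qed

lemma rot_conj_eq:
  assumes "supported (2 * n) x"
  shows "mmul (2 * n) rot (mmul (2 * n) x (mtrans rot)) = signed_conj alt_sign twin x"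
proof (intro ext)
  fix i j
  have rot_left: "mmul (2 * n) rot y i j = (if i < 2 * n then alt_sign i * y (twin i) j else 0)" for y
  proof -
    have "mmul (2 * n) rot y i j = (\<Sum>k<2 * n. if twin i = k then alt_sign i * y k j else 0)"
      unfolding mmul_def rot_eq by (rule sum.cong) auto
    then show ?thesis by (simp add: sum.delta' twin_less_double)
  qed
  have rot_right: "mmul (2 * n) x (mtrans rot) i j =
      (if j < 2 * n then alt_sign j * x i (twin j) else 0)" for i
  proof -
    have "mmul (2 * n) x (mtrans rot) i j =
        (\<Sum>k<2 * n. if twin j = k then alt_sign j * x i k else 0)"
      unfolding mmul_def rot_eq mtrans_def by (rule sum.cong) auto
    then show ?thesis by (simp add: sum.delta' twin_less_double)
  qed
  show "mmul (2 * n) rot (mmul (2 * n) x (mtrans rot)) i j = signed_conj alt_sign twin x i j"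
    using supportedD[OF assms, of "twin i" "twin j"]
    by (auto simp: rot_left rot_right signed_conj_def twin_less_double)
qed

lemma parity_twin: "parity (2 * l) (twin i) = parity (2 * l) i"
  by (simp add: parity_def twin_less_double)

text \<open>As 2l is even, the symplectic pairs beyond it are the pairs exchanged by
  \<open>twin\<close>.\<close>

lemma gram_perm_double: "gram_perm (2 * l) i = (if i < 2 * l then i else twin i)"
  by (auto simp: gram_perm_def twin_def elim!: oddE)

lemma gram_sign_double: "gram_sign (2 * l) i = (if i < 2 * l then 1 else alt_sign i)"
  by (auto simp: gram_sign_def alt_sign_def)

section \<open>The four classical series\<close>

lemma gl_involution_split:
  "gl_involution p q (signed_conj (split_sign n1 n2 m1) (\<lambda>i. i))"
  by (rule gl_involution_signed_conj[where e = 1]) (auto simp: split_sign_def)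

lemma gl_involution_rot: "gl_involution (2 * l) (2 * m) (signed_conj alt_sign twin)"
  by (rule gl_involution_signed_conj[where e = "-1"])
     (simp_all add: twin_twin parity_twin alt_sign_twin alt_sign_square
       twin_less_double[where n = "l + m", unfolded distrib_left])

lemma split_invol_eq: "split_invol n1 n2 m1 = signed_conj (split_sign n1 n2 m1) (\<lambda>i. i)"
  by (simp add: split_invol_def signed_conj_def fun_eq_iff mult_ac)

theorem sym_superpair_classical:
  assumes "X \<in> classical_pairs"
  shows "sym_superpair X"
proof -
  have "sym_superpair (gl_osp n m)" for n m
    by (rule sym_superpair_fixed_points[OF gl_involution_gram_adjoint[of n m] gl_involution_id])
       (simp_all add: gl_osp_def gram_adjoint_eq)
  moreover have "sym_superpair (osp_gl l m)" for l m
  proof (rule sym_superpair_fixed_points[OF gl_involution_rot[of l m]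
        gl_involution_gram_adjoint[of "2 * l" m]])
    show "signed_conj alt_sign twin (gram_adjoint (2 * l) x) =
        gram_adjoint (2 * l) (signed_conj alt_sign twin x)" for x
      by (rule signed_conj_gram_adjoint_commute)
         (simp_all add: gram_perm_double gram_sign_double parity_twin twin_less_double twin_twin
           alt_sign_twin)
    show "invol (osp_gl l m) x = signed_conj alt_sign twin x"
      if "supported (2 * l + 2 * m) x" for x
      using rot_conj_eq[of "l + m" x] that by (simp add: osp_gl_def distrib_left)
  qed (simp_all add: osp_gl_def osp_part_eq)
  moreover have "sym_superpair (gl_gl n1 n2 m1 m2)" for n1 n2 m1 m2
    by (rule sym_superpair_fixed_points[OF gl_involution_split[of "n1 + n2" "m1 + m2" n1 n2 m1]
          gl_involution_id])
       (simp_all add: gl_gl_def split_invol_eq)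
  moreover have "sym_superpair (osp_osp n1 n2 m1 m2)" for n1 n2 m1 m2
  proof (rule sym_superpair_fixed_points[OF
        gl_involution_split[of "n1 + n2" "2 * (m1 + m2)" n1 n2 "2 * m1"]
        gl_involution_gram_adjoint[of "n1 + n2" "m1 + m2"]])
    show "signed_conj (split_sign n1 n2 (2 * m1)) (\<lambda>i. i) (gram_adjoint (n1 + n2) x) =
        gram_adjoint (n1 + n2) (signed_conj (split_sign n1 n2 (2 * m1)) (\<lambda>i. i) x)" for x
    proof (rule signed_conj_gram_adjoint_commute)
      fix i
      \<comment> \<open>Among the odd indices the sign changes after an even number of them, 2 m1,
        so both members of a symplectic pair carry the same sign.\<close>
      have "split_sign n1 n2 (2 * m1) (gram_perm (n1 + n2) i) = split_sign n1 n2 (2 * m1) i"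
        using twin_less_double[of "i - (n1 + n2)" m1]
        by (auto simp: split_sign_def gram_perm_def)
      then show "split_sign n1 n2 (2 * m1) (gram_perm (n1 + n2) i) *
          gram_sign (n1 + n2) (gram_perm (n1 + n2) i) =
          split_sign n1 n2 (2 * m1) i * gram_sign (n1 + n2) (gram_perm (n1 + n2) i)"
        by simp
    qed simp_all
  qed (simp_all add: osp_osp_def osp_part_eq split_invol_eq distrib_left)
  ultimately show ?thesis
    using assms by (auto simp: classical_pairs_def)
qed

section \<open>Simultaneous diagonalisation\<close>

definition linear_map :: "(cmat \<Rightarrow> cmat) \<Rightarrow> bool" where
  "linear_map T \<longleftrightarrow> (\<forall>x y. T (x + y) = T x + T y) \<and> (\<forall>c x. T (cscale c x) = cscale c (T x))"

lemma linear_map_zero: "linear_map T \<Longrightarrow> T 0 = 0"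
  unfolding linear_map_def by (metis cmat.scale_zero_left)

lemma linear_map_diff: "linear_map T \<Longrightarrow> T (x - y) = T x - T y"
  unfolding linear_map_def by (metis add_diff_cancel diff_add_cancel)

lemma linear_map_sum:
  assumes "linear_map T"
  shows "T (\<Sum>i\<in>A. f i) = (\<Sum>i\<in>A. T (f i))"
proof (cases "finite A")
  case True
  have add: "T (x + y) = T x + T y" for x y
    using assms by (simp add: linear_map_def)
  from True show ?thesis
    by (induction A) (simp_all only: sum.empty sum.insert linear_map_zero[OF assms] add not_False_eq_True)
qed (simp add: linear_map_zero[OF assms])

definition poly_act :: "(cmat \<Rightarrow> cmat) \<Rightarrow> complex poly \<Rightarrow> cmat \<Rightarrow> cmat" where
  "poly_act T p v = (\<Sum>i\<le>degree p. cscale (coeff p i) ((T ^^ i) v))"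

lemma poly_act_bound:
  assumes "degree p \<le> n"
  shows "poly_act T p v = (\<Sum>i\<le>n. cscale (coeff p i) ((T ^^ i) v))"
  unfolding poly_act_def
  by (rule sum.mono_neutral_left) (use assms in \<open>auto simp: coeff_eq_0\<close>)

lemma poly_act_factor:
  assumes T: "linear_map T"
  shows "poly_act T ([:- c, 1:] * q) v = T (poly_act T q v) - cscale c (poly_act T q v)"
proof -
  let ?n = "degree q"
  have "degree ([:- c, 1:] * q) \<le> Suc ?n"
    using degree_mult_le[of "[:- c, 1:]" q] by simp
  then have "poly_act T ([:- c, 1:] * q) v =
      (\<Sum>i\<le>Suc ?n. cscale (coeff ([:- c, 1:] * q) i) ((T ^^ i) v))"
    by (rule poly_act_bound)
  also have "\<dots> = (\<Sum>i\<le>Suc ?n. cscale (coeff (pCons 0 q) i) ((T ^^ i) v)) -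
      (\<Sum>i\<le>Suc ?n. cscale (c * coeff q i) ((T ^^ i) v))"
    by (simp only: sum_subtractf[symmetric] cmat.scale_left_diff_distrib[symmetric])
       (simp add: algebra_simps)
  also have "(\<Sum>i\<le>Suc ?n. cscale (coeff (pCons 0 q) i) ((T ^^ i) v)) =
      (\<Sum>i\<le>?n. cscale (coeff q i) ((T ^^ Suc i) v))"
    by (subst sum.atMost_Suc_shift) simp
  also have "\<dots> = T (poly_act T q v)"
    using T by (simp add: poly_act_def linear_map_sum[OF T]) (simp add: linear_map_def)
  also have "(\<Sum>i\<le>Suc ?n. cscale (c * coeff q i) ((T ^^ i) v)) = cscale c (poly_act T q v)"
    unfolding poly_act_bound[OF le_SucI[OF order_refl], of _ q]
    by (simp only: cmat.scale_sum_right cmat.scale_scale)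
  finally show ?thesis .
qed

text \<open>Split off a root c of p as p = (z - c) q. Either q(T) v = 0 and the degree has dropped,
  or q(T) v is an eigenvector with eigenvalue c.\<close>

lemma eigenvector_of_annihilator:
  assumes T: "linear_map T" and V: "cmat.subspace V" "\<And>x. x \<in> V \<Longrightarrow> T x \<in> V"
    and v: "v \<in> V" "v \<noteq> 0"
  shows "p \<noteq> 0 \<Longrightarrow> poly_act T p v = 0 \<Longrightarrow> \<exists>w\<in>V. w \<noteq> 0 \<and> (\<exists>c. T w = cscale c w)"
proof (induction "degree p" arbitrary: p)
  case 0
  then obtain k where "p = [:k:]" "k \<noteq> 0"
    by (metis degree_eq_zeroE pCons_0_0)
  have "poly_act T p v = 0" by (rule 0)
  then have "cscale k v = 0"
    by (simp add: \<open>p = [:k:]\<close> poly_act_def)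
  then have False
    using \<open>k \<noteq> 0\<close> v(2) by simp
  then show ?case ..
next
  case (Suc n)
  have p: "p \<noteq> 0" "poly_act T p v = 0"
    by (rule Suc.prems)+
  have "\<not> constant (poly p)"
    using Suc.hyps(2)
    by (simp add: constant_degree)
  then obtain c where "poly p c = 0"
    using fundamental_theorem_of_algebra by blast
  then obtain q where q: "p = [:- c, 1:] * q"
    by (metis dvdE poly_eq_0_iff_dvd)
  have "q \<noteq> 0" using q p by auto
  have "degree q = n"
    using Suc.hyps(2) \<open>q \<noteq> 0\<close> degree_mult_eq[of "[:- c, 1:]" q] unfolding q by simp
  have pow: "(T ^^ i) v \<in> V" for i
    by (induction i) (simp_all add: v V)
  have w: "poly_act T q v \<in> V"
    unfolding poly_act_def by (intro cmat.subspace_sum cmat.subspace_scale V(1) pow)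
  show "\<exists>w\<in>V. w \<noteq> 0 \<and> (\<exists>c. T w = cscale c w)"
  proof (cases "poly_act T q v = 0")
    case True
    then show ?thesis
      by (rule Suc.hyps(1)[OF \<open>degree q = n\<close>[symmetric] \<open>q \<noteq> 0\<close>])
  next
    case False
    have "T (poly_act T q v) = cscale c (poly_act T q v)"
      using p(2) poly_act_factor[OF T, of c q v] unfolding q by (metis right_minus_eq)
    then show ?thesis using False w by blast
  qed
qed

lemma eigenvector_exists:
  assumes T: "linear_map T" and V: "cmat.subspace V" "\<And>x. x \<in> V \<Longrightarrow> T x \<in> V"
    and B: "finite B" "V \<subseteq> cmat.span B" and nz: "V \<noteq> {0}"
  shows "\<exists>w\<in>V. w \<noteq> 0 \<and> (\<exists>c. T w = cscale c w)"
proof -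
  obtain v where v: "v \<in> V" "v \<noteq> 0"
    using nz cmat.subspace_0[OF V(1)] by blast
  have pow: "(T ^^ i) v \<in> V" for i
    by (induction i) (simp_all add: v V)
  define f where "f i = (T ^^ i) v" for i
  let ?n = "card B"
  obtain p where p: "p \<noteq> 0" "poly_act T p v = 0"
  \<comment> \<open>Linear dependence is a property of the set of iterates and does not see a
    repetition among them. Two equal iterates give a difference of monomials; otherwise the
    \<open>card B + 1\<close> distinct iterates are dependent.\<close>
  proof (cases "inj_on f {..?n}")
    case False
    then obtain i j where ij: "i \<le> ?n" "j \<le> ?n" "i \<noteq> j" "f i = f j"
      by (auto simp: inj_on_def)
    let ?p = "monom 1 i - monom 1 j :: complex poly"
    have "coeff ?p i \<noteq> 0" using ij by simp
    then have "?p \<noteq> 0" by (metis coeff_0)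
    moreover have "degree ?p \<le> ?n"
      using ij by (intro degree_diff_le) (simp_all add: degree_monom_eq)
    then have "poly_act T ?p v = (\<Sum>k\<le>?n. (if i = k then f k else 0) - (if j = k then f k else 0))"
      by (subst poly_act_bound) (auto simp: f_def cmat.scale_left_diff_distrib intro!: sum.cong)
    then have "poly_act T ?p v = 0"
      using ij by (simp add: sum_subtractf)
    ultimately show ?thesis using that by blast
  next
    case True
    have "card (f ` {..?n}) = Suc ?n" using True by (simp add: card_image)
    moreover have "f ` {..?n} \<subseteq> cmat.span B"
      using pow B(2) by (auto simp: f_def)
    ultimately have "cmat.dependent (f ` {..?n})"
      using cmat.independent_span_bound[OF B(1), of "f ` {..?n}"] by linarith
    then obtain u where u: "\<exists>w\<in>f ` {..?n}. u w \<noteq> 0" "(\<Sum>w\<in>f ` {..?n}. cscale (u w) w) = 0"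
      using cmat.dependent_finite[of "f ` {..?n}"] by auto
    define p where "p = (\<Sum>k\<le>?n. monom (u (f k)) k)"
    have c: "coeff p k = (if k \<le> ?n then u (f k) else 0)" for k
      by (simp add: p_def coeff_sum)
    have "p \<noteq> 0"
    proof
      assume "p = 0"
      then have "u (f k) = 0" if "k \<le> ?n" for k
        using c[of k] that by simp
      then show False using u(1) by auto
    qed
    moreover have "degree p \<le> ?n"
      by (rule degree_le) (simp add: c)
    then have "poly_act T p v = (\<Sum>k\<le>?n. cscale (u (f k)) (f k))"
      by (simp add: poly_act_bound c f_def)
    then have "poly_act T p v = 0"
      using u(2) True by (simp add: sum.reindex)
    ultimately show ?thesis using that by blast
  qed
  show ?thesis
    by (rule eigenvector_of_annihilator[OF T V v p])
qed

lemma dim_less_of_not_in: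
  assumes V: "cmat.subspace V" "V \<subseteq> U" "x \<in> U" "x \<notin> V" and B: "finite B" "U \<subseteq> cmat.span B"
  shows "cmat.dim V < cmat.dim U"
proof -
  obtain S where S: "S \<subseteq> V" "cmat.independent S" "V \<subseteq> cmat.span S" "card S = cmat.dim V"
    using cmat.basis_exists[of V] by blast
  have "cmat.span S = V"
    using S V(1) by (metis cmat.span_minimal subset_antisym)
  then have "cmat.independent (insert x S)"
    using S(2) V(4) by (simp add: cmat.independent_insert)
  moreover have "insert x S \<subseteq> U" using S(1) V by blast
  ultimately obtain C where C: "insert x S \<subseteq> C" "C \<subseteq> U" "cmat.independent C" "U \<subseteq> cmat.span C"
    using cmat.maximal_independent_subset_extend by metis
  have "finite C"
    using cmat.independent_span_bound[OF B(1) C(3)] C(2) B(2) by blast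
  have "x \<notin> S" using S(1) V(4) by blast
  have "card S < card (insert x S)"
    using finite_subset[OF C(1) \<open>finite C\<close>] \<open>x \<notin> S\<close> by simp
  also have "\<dots> \<le> card C"
    using \<open>finite C\<close> C(1) by (rule card_mono)
  also have "card C = cmat.dim U"
    using C by (intro cmat.basis_card_eq_dim) auto
  finally show ?thesis using S(4) by simp
qed

text \<open>In a nonzero stable subspace of least dimension, a nonzero eigenspace of any
  \<open>T h\<close> is again stable, by commutation, and hence is everything. So every
  \<open>T h\<close> acts there as a scalar.\<close>

lemma common_eigenvector:
  assumes lin: "\<And>h. h \<in> H \<Longrightarrow> linear_map (T h)"
    and W: "cmat.subspace W" "W \<noteq> {0}" "\<And>h x. h \<in> H \<Longrightarrow> x \<in> W \<Longrightarrow> T h x \<in> W"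
    and B: "finite B" "W \<subseteq> cmat.span B"
    and comm: "\<And>h h' x. h \<in> H \<Longrightarrow> h' \<in> H \<Longrightarrow> x \<in> W \<Longrightarrow> T h (T h' x) = T h' (T h x)"
  shows "\<exists>w\<in>W. w \<noteq> 0 \<and> (\<forall>h\<in>H. \<exists>c. T h w = cscale c w)"
proof -
  let ?Q = "\<lambda>U. cmat.subspace U \<and> U \<noteq> {0} \<and> U \<subseteq> W \<and> (\<forall>h\<in>H. \<forall>x\<in>U. T h x \<in> U)"
  have "?Q W" using W by auto
  then obtain U where U: "?Q U" and min: "\<And>U'. ?Q U' \<Longrightarrow> cmat.dim U \<le> cmat.dim U'"
    using ex_has_least_nat[of ?Q W cmat.dim] by blast
  have UB: "U \<subseteq> cmat.span B" using U B(2) by blast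
  have scalar: "\<exists>c. \<forall>x\<in>U. T h x = cscale c x" if h: "h \<in> H" for h
  proof -
    obtain v c where v: "v \<in> U" "v \<noteq> 0" "T h v = cscale c v"
      using eigenvector_exists[OF lin[OF h], of U B] U h B(1) UB by blast
    let ?U = "{x \<in> U. T h x = cscale c x}"
    have sub: "cmat.subspace ?U"
      using U lin[OF h] linear_map_zero[OF lin[OF h]]
      by (auto simp: cmat.subspace_def linear_map_def cmat.scale_right_distrib mult.commute)
    have "?Q ?U"
    proof (intro conjI ballI)
      show "?U \<noteq> {0}" using v by blast
      show "?U \<subseteq> W" using U by blast
      fix k x assume k: "k \<in> H" "x \<in> ?U"
      then have "T h (T k x) = T k (T h x)"
        using comm[OF h k(1)] U by blast
      then show "T k x \<in> ?U"
        using U k lin[OF k(1)] by (auto simp: linear_map_def)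
    qed (rule sub)
    then have "\<not> cmat.dim ?U < cmat.dim U" using min[of ?U] by simp
    then have "x \<in> ?U" if "x \<in> U" for x
      using dim_less_of_not_in[OF sub, of U x B] that B(1) UB by blast
    then show ?thesis by blast
  qed
  obtain w where "w \<in> U" "w \<noteq> 0"
    using U cmat.subspace_0 by blast
  moreover have "\<exists>c. T h w = cscale c w" if "h \<in> H" for h
    using scalar[OF that] \<open>w \<in> U\<close> by blast
  moreover have "w \<in> W" using U \<open>w \<in> U\<close> by blast
  ultimately show ?thesis by blast
qed

section \<open>Brackets, gradings and weight spaces\<close>

context sym_superpair
begin

lemma zero_part: "s \<in> {0,1} \<Longrightarrow> 0 \<in> part X s"
  by (rule cmat.subspace_0[OF subspace_part])

lemma part_whole: assumes "s \<in> {0,1}" "x \<in> part X s" shows "x \<in> whole X"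
proof -
  have "x = x + 0" "x = 0 + x" by simp_all
  then show ?thesis
    using assms zero_part[of 0] zero_part[of 1] unfolding whole_def by blast
qed

lemma wholeE:
  assumes "x \<in> whole X"
  obtains y z where "x = y + z" "y \<in> part X 0" "z \<in> part X 1"
  using assms unfolding whole_def by blast

lemma subspace_whole: "cmat.subspace (whole X)"
  using cmat.subspace_sums[OF subspace_part[of 0] subspace_part[of 1]]
  by (simp add: whole_def)

lemma brk_linear_right: "linear_map (brk X x)"
  by (simp add: linear_map_def brk_add_right brk_scale_right)

lemma brk_linear_left: "linear_map (\<lambda>x. brk X x y)"
  by (simp add: linear_map_def brk_add_left brk_scale_left)

lemmas brk_zero = linear_map_zero[OF brk_linear_right] linear_map_zero[OF brk_linear_left]

lemma brk_whole: assumes "x \<in> whole X" "y \<in> whole X" shows "brk X x y \<in> whole X"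
proof -
  obtain x0 x1 where x: "x = x0 + x1" "x0 \<in> part X 0" "x1 \<in> part X 1"
    using assms(1) by (rule wholeE)
  obtain y0 y1 where y: "y = y0 + y1" "y0 \<in> part X 0" "y1 \<in> part X 1"
    using assms(2) by (rule wholeE)
  have "brk X u v \<in> whole X" if "u \<in> part X s" "v \<in> part X t" "s \<in> {0,1}" "t \<in> {0,1}" for u v s t
    using brk_part[OF that(3,4,1,2)] by (rule part_whole[rotated]) auto
  then have "brk X x0 y0 \<in> whole X" "brk X x0 y1 \<in> whole X"
      "brk X x1 y0 \<in> whole X" "brk X x1 y1 \<in> whole X"
    using x y by blast+
  then show ?thesis
    by (simp add: x(1) y(1) brk_add_left brk_add_right cmat.subspace_add[OF subspace_whole])
qed

lemma brk_even_part:
  "u \<in> part X 0 \<Longrightarrow> s \<in> {0,1} \<Longrightarrow> x \<in> part X s \<Longrightarrow> brk X u x \<in> part X s"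
  using brk_part[of 0 s u x] by auto

lemma brk_swap_even:
  assumes "u \<in> part X 0" "x \<in> whole X"
  shows "brk X u x = - brk X x u"
proof -
  obtain x0 x1 where x: "x = x0 + x1" "x0 \<in> part X 0" "x1 \<in> part X 1"
    using assms(2) by (rule wholeE)
  have "brk X u x0 = cscale (-1) (brk X x0 u)" "brk X u x1 = cscale (-1) (brk X x1 u)"
    using brk_swap[of 0 0 u x0] brk_swap[of 0 1 u x1] assms(1) x by auto
  then show ?thesis
    by (simp add: x(1) brk_add_left brk_add_right)
qed

lemma invol_whole: assumes "x \<in> whole X" shows "invol X x \<in> whole X"
proof -
  obtain x0 x1 where x: "x = x0 + x1" "x0 \<in> part X 0" "x1 \<in> part X 1"
    using assms by (rule wholeE)
  have "invol X x = invol X x0 + invol X x1"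
    unfolding x(1) using part_whole[of 0 x0] part_whole[of 1 x1] x by (intro invol_add) auto
  moreover have "invol X x0 \<in> whole X" "invol X x1 \<in> whole X"
    using invol_part[of 0 x0] invol_part[of 1 x1] x part_whole by auto
  ultimately show ?thesis
    by (simp add: cmat.subspace_add[OF subspace_whole])
qed

lemma invol_diff: "x \<in> whole X \<Longrightarrow> y \<in> whole X \<Longrightarrow> invol X (x - y) = invol X x - invol X y"
  using invol_add[of "x - y" y] cmat.subspace_diff[OF subspace_whole]
  by (simp add: algebra_simps)

lemma plus_invol_kk: "x \<in> whole X \<Longrightarrow> x + invol X x \<in> kk X"
  by (simp add: kk_def cmat.subspace_add[OF subspace_whole] invol_whole invol_add invol_invol
      add.commute)

lemma subspace_weight_space: "cmat.subspace (weight_space X c \<alpha>)"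
  using cmat.subspace_0[OF subspace_whole] cmat.subspace_add[OF subspace_whole]
    cmat.subspace_scale[OF subspace_whole]
  by (auto simp: cmat.subspace_def weight_space_def brk_zero brk_add_right brk_scale_right
      cmat.scale_right_distrib mult.commute)

lemma weight_space_whole: "x \<in> weight_space X c \<alpha> \<Longrightarrow> x \<in> whole X"
  by (simp add: weight_space_def)

lemma weight_space_brk: "x \<in> weight_space X c \<alpha> \<Longrightarrow> u \<in> c \<Longrightarrow> brk X u x = cscale (\<alpha> u) x"
  by (simp add: weight_space_def)

lemma brk_weight_space:
  assumes c: "c \<subseteq> part X 0" and x: "x \<in> weight_space X c \<alpha>" and y: "y \<in> weight_space X c \<beta>"
  shows "brk X x y \<in> weight_space X c (\<alpha> + \<beta>)"
proof -
  have "brk X u (brk X x y) = cscale ((\<alpha> + \<beta>) u) (brk X x y)" if "u \<in> c" for u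
  proof -
    have "brk X u (brk X x y) = brk X (brk X u x) y + brk X x (brk X u y)"
      using c that x y by (intro even_derivation) (auto simp: weight_space_def)
    then show ?thesis
      using x y that by (simp add: weight_space_def brk_scale_left brk_scale_right
          cmat.scale_left_distrib)
  qed
  then show ?thesis
    using x y by (simp add: weight_space_def brk_whole)
qed

text \<open>c acts by even operators, so the weight equation splits by parity: the defect of the
  even component is minus that of the odd one and therefore lies in both parts.\<close>

lemma weight_space_graded:
  assumes c: "c \<subseteq> part X 0" and x: "x0 + x1 \<in> weight_space X c \<alpha>"
    and x0: "x0 \<in> part X 0" and x1: "x1 \<in> part X 1"
  shows "x0 \<in> weight_space X c \<alpha> \<and> x1 \<in> weight_space X c \<alpha>"
proof -
  have "brk X u x0 = cscale (\<alpha> u) x0 \<and> brk X u x1 = cscale (\<alpha> u) x1" if u: "u \<in> c" for u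
  proof -
    let ?d0 = "brk X u x0 - cscale (\<alpha> u) x0" and ?d1 = "brk X u x1 - cscale (\<alpha> u) x1"
    have "?d0 \<in> part X 0"
      using brk_even_part[of u 0 x0] c u x0
      by (intro cmat.subspace_diff[OF subspace_part] cmat.subspace_scale[OF subspace_part]) auto
    moreover have "?d1 \<in> part X 1"
      using brk_even_part[of u 1 x1] c u x1
      by (intro cmat.subspace_diff[OF subspace_part] cmat.subspace_scale[OF subspace_part]) auto
    moreover have "?d0 = cscale (-1) ?d1"
      using weight_space_brk[OF x u] by (simp add: brk_add_right cmat.scale_right_distrib algebra_simps)
    moreover have "cscale (-1) ?d1 \<in> part X 1"
      by (rule cmat.subspace_scale[OF subspace_part]) (use calculation(2) in auto)
    ultimately have "?d0 \<in> part X 0 \<inter> part X 1" by simp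
    then have "?d0 = 0" using part_Int by blast
    with \<open>?d0 = cscale (-1) ?d1\<close> have "?d1 = 0" by simp
    with \<open>?d0 = 0\<close> show ?thesis by simp
  qed
  then show ?thesis
    using part_whole[of 0 x0] part_whole[of 1 x1] x0 x1 by (simp add: weight_space_def)
qed

lemma dual_space_neqE:
  assumes "\<beta> \<in> dual_space c" "\<gamma> \<in> dual_space c" "\<beta> \<noteq> \<gamma>"
  obtains u where "u \<in> c" "\<beta> u \<noteq> \<gamma> u"
proof -
  obtain u where u: "\<beta> u \<noteq> \<gamma> u" using assms(3) by (auto simp: fun_eq_iff)
  have "u \<in> c"
  proof (rule ccontr)
    assume "u \<notin> c"
    with u assms(1,2) show False by (simp add: dual_space_def)
  qed
  with u show thesis using that by blast
qed

text \<open>For u in c, the operator ad u - \<gamma> u kills the term of \<gamma> and multiplies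
  that of \<delta> by \<delta> u - \<gamma> u, which is nonzero for a u separating the two.
  \<open>Q\<close> quantifies over v because the induction hypothesis is applied to the rescaled
  vectors.\<close>

lemma weight_vectors_independent:
  assumes "finite S" "S \<subseteq> dual_space c" "\<And>\<beta>. \<beta> \<in> S \<Longrightarrow> v \<beta> \<in> weight_space X c \<beta>"
    and "(\<Sum>\<beta>\<in>S. v \<beta>) = 0" and "\<beta> \<in> S"
  shows "v \<beta> = 0"
proof -
  define Q where "Q S \<longleftrightarrow> (S \<subseteq> dual_space c \<longrightarrow>
    (\<forall>v. (\<forall>\<beta>\<in>S. v \<beta> \<in> weight_space X c \<beta>) \<longrightarrow> (\<Sum>\<beta>\<in>S. v \<beta>) = 0 \<longrightarrow> (\<forall>\<beta>\<in>S. v \<beta> = 0)))" for S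
  have step: "v \<beta> = 0" if S: "finite S" "\<gamma> \<notin> S" and "Q S" and dual: "insert \<gamma> S \<subseteq> dual_space c"
      and wt: "\<And>\<beta>. \<beta> \<in> insert \<gamma> S \<Longrightarrow> v \<beta> \<in> weight_space X c \<beta>"
      and zero: "(\<Sum>\<beta>\<in>insert \<gamma> S. v \<beta>) = 0" and \<beta>: "\<beta> \<in> insert \<gamma> S" for \<gamma> S v \<beta>
  proof -
    have vS: "v \<delta> = 0" if \<delta>: "\<delta> \<in> S" for \<delta>
    proof -
      have ne: "\<delta> \<noteq> \<gamma>" using \<delta> S(2) by blast
      obtain u where u: "u \<in> c" "\<delta> u \<noteq> \<gamma> u"
        using dual_space_neqE[OF _ _ ne] dual \<delta> by blast
      have "(\<Sum>\<beta>\<in>insert \<gamma> S. cscale (\<beta> u - \<gamma> u) (v \<beta>)) =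
          (\<Sum>\<beta>\<in>insert \<gamma> S. brk X u (v \<beta>) - cscale (\<gamma> u) (v \<beta>))"
        using weight_space_brk[OF wt u(1)]
        by (intro sum.cong refl) (simp only: cmat.scale_left_diff_distrib)
      also have "\<dots> = brk X u (\<Sum>\<beta>\<in>insert \<gamma> S. v \<beta>) - cscale (\<gamma> u) (\<Sum>\<beta>\<in>insert \<gamma> S. v \<beta>)"
        by (simp only: linear_map_sum[OF brk_linear_right] cmat.scale_sum_right sum_subtractf)
      also have "\<dots> = 0"
        by (simp only: zero brk_zero cmat.scale_zero_right diff_zero)
      finally have "(\<Sum>\<beta>\<in>S. cscale (\<beta> u - \<gamma> u) (v \<beta>)) = 0"
        using S by simp
      then have "cscale (\<delta> u - \<gamma> u) (v \<delta>) = 0"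
        using \<open>Q S\<close> dual \<delta> cmat.subspace_scale[OF subspace_weight_space wt]
        unfolding Q_def by (elim impE allE[of _ "\<lambda>\<beta>. cscale (\<beta> u - \<gamma> u) (v \<beta>)"]) auto
      then show ?thesis using u(2) by simp
    qed
    then have "(\<Sum>\<beta>\<in>S. v \<beta>) = 0" by (intro sum.neutral) blast
    then have "v \<gamma> = 0"
      using zero S by simp
    then show "v \<beta> = 0" using \<beta> vS by blast
  qed
  from \<open>finite S\<close> have "Q S"
  proof (induction S)
    case (insert \<gamma> S)
    then show ?case using step[of S \<gamma>] unfolding Q_def[of "insert \<gamma> S"] by blast
  qed (simp add: Q_def)
  then show ?thesis using assms(2-5) unfolding Q_def by blast
qed

end

section \<open>Roots and restricted roots\<close>

locale cartan_setting = sym_superpair X for X :: sym_pair +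
  fixes a h :: "cmat set"
    and b :: "cmat \<Rightarrow> cmat \<Rightarrow> complex"
    and es hs :: "cmat list"
    and E :: "(cmat \<Rightarrow> complex) \<Rightarrow> cmat"
  assumes cartan_subspace: "even_cartan_subspace X a"
    and form: "invariant_form X b"
    and form_nondeg: "nondegenerate_on (whole X) b"
    and form_invol: "\<forall>x\<in>whole X. \<forall>y\<in>whole X. b (invol X x) (invol X y) = b x y"
    and form_nondeg_a: "nondegenerate_on a b"
    and cartan_subalgebra: "cartan_subalgebra X h" "a \<subseteq> h" "invol X ` h \<subseteq> h"
    and orth_basis: "is_basis hs h"
      "\<forall>i<length hs. \<forall>j<length hs. i \<noteq> j \<longrightarrow> b (hs ! i) (hs ! j) = 0"
    and root_vectors: "root_vectors X h E"
    and basis_a: "is_basis es a"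
begin

abbreviation roots where "roots \<equiv> nonzero_weights X h"

lemma h_even: "u \<in> h \<Longrightarrow> u \<in> part X 0"
  using cartan_subalgebra(1) by (auto simp: cartan_subalgebra_def)

lemma h_subspace: "cmat.subspace h"
  using cartan_subalgebra(1) by (simp add: cartan_subalgebra_def)

lemma a_subspace: "cmat.subspace a"
  using cartan_subspace by (simp add: even_cartan_subspace_def)

lemma a_pp: "u \<in> a \<Longrightarrow> u \<in> pp X"
  using cartan_subspace by (auto simp: even_cartan_subspace_def)

lemma a_h: "u \<in> a \<Longrightarrow> u \<in> h"
  using cartan_subalgebra(2) by blast

lemma invol_h: "u \<in> h \<Longrightarrow> invol X u \<in> h"
  using cartan_subalgebra(3) by blast

lemma h_whole: "u \<in> h \<Longrightarrow> u \<in> whole X"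
  using h_even part_whole[of 0] by blast

lemma h_commute: "u \<in> h \<Longrightarrow> v \<in> h \<Longrightarrow> brk X u v = 0"
  using cartan_subalgebra(1) by (simp add: cartan_subalgebra_def commutative_in_def)

lemma h_self_centralising: "x \<in> whole X \<Longrightarrow> (\<And>u. u \<in> h \<Longrightarrow> brk X u x = 0) \<Longrightarrow> x \<in> h"
  using cartan_subalgebra(1) by (auto simp: cartan_subalgebra_def centraliser_def)

lemma a_self_centralising: "x \<in> pp X \<Longrightarrow> (\<And>u. u \<in> a \<Longrightarrow> brk X u x = 0) \<Longrightarrow> x \<in> a"
  using cartan_subspace by (auto simp: even_cartan_subspace_def centraliser_def)

lemma ad_h_commute:
  assumes "u \<in> h" "v \<in> h" "x \<in> whole X"
  shows "brk X u (brk X v x) = brk X v (brk X u x)"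
  using even_derivation[OF h_even[OF assms(1)] h_whole[OF assms(2)] assms(3)]
  by (simp add: h_commute assms brk_zero)

lemma zero_weight_space: "weight_space X h 0 = h"
  using h_self_centralising h_commute h_whole by (auto simp: weight_space_def)

lemma zero_dual_space: "0 \<in> dual_space c"
  by (simp add: dual_space_def)

lemma roots_dual: "\<beta> \<in> roots \<Longrightarrow> \<beta> \<in> dual_space h"
  by (simp add: nonzero_weights_def)

lemma root_nonzeroE:
  assumes "\<beta> \<in> roots"
  obtains u where "u \<in> h" "\<beta> u \<noteq> 0"
proof -
  have "\<beta> \<noteq> 0" using assms by (simp add: nonzero_weights_def)
  from dual_space_neqE[OF roots_dual[OF assms] zero_dual_space this]
  show thesis using that by auto
qed

lemma root_vector_nonzero: "\<beta> \<in> roots \<Longrightarrow> E \<beta> \<noteq> 0"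
  using root_vectors by (simp add: root_vectors_def)

lemma root_space: "\<beta> \<in> roots \<Longrightarrow> weight_space X h \<beta> = cmat.span {E \<beta>}"
  using root_vectors by (simp add: root_vectors_def)

lemma root_vector: "\<beta> \<in> roots \<Longrightarrow> E \<beta> \<in> weight_space X h \<beta>"
  by (simp add: root_space cmat.span_base)

lemma root_vector_whole: "\<beta> \<in> roots \<Longrightarrow> E \<beta> \<in> whole X"
  by (rule weight_space_whole[OF root_vector])

lemma root_spaceE:
  assumes "\<beta> \<in> roots" "x \<in> weight_space X h \<beta>"
  obtains c where "x = cscale c (E \<beta>)"
  using assms by (auto simp: root_space cmat.span_singleton)

lemma rootI:
  assumes "x \<in> weight_space X h \<beta>" "x \<noteq> 0" "\<beta> \<in> dual_space h" "\<beta> \<noteq> 0"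
  shows "\<beta> \<in> roots"
  using assms by (auto simp: nonzero_weights_def)

text \<open>Comparing multiples of the nonzero vector x shows that the eigenvalue depends linearly
  on u.\<close>

lemma weight_dual:
  assumes x: "x \<noteq> 0" and "\<And>u. u \<in> c \<Longrightarrow> brk X u x = cscale (\<beta> u) x"
    and "\<And>u. u \<notin> c \<Longrightarrow> \<beta> u = 0" and c: "cmat.subspace c"
  shows "\<beta> \<in> dual_space c"
proof -
  have "cscale (\<beta> (u + v)) x = cscale (\<beta> u + \<beta> v) x" if "u \<in> c" "v \<in> c" for u v
    using assms(2)[of "u + v"] assms(2) that cmat.subspace_add[OF c that]
    by (simp add: brk_add_left cmat.scale_left_distrib)
  moreover have "cscale (\<beta> (cscale k u)) x = cscale (k * \<beta> u) x" if "u \<in> c" for u k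
    using assms(2)[of "cscale k u"] assms(2)[of u] that cmat.subspace_scale[OF c that]
    by (metis brk_scale_left cmat.scale_scale)
  ultimately show ?thesis
    using x assms(3) by (auto simp: dual_space_def cmat.scale_cancel_right)
qed

text \<open>Complete reducibility gives an h-stable complement W of the span. If W were nonzero, the
  commuting operators ad u would have a common eigenvector in it; being a weight vector, it lies in
  h or in a root line, hence in the span as well.\<close>

lemma whole_eq_span: "whole X = cmat.span (h \<union> E ` roots)"
proof -
  let ?V = "cmat.span (h \<union> E ` roots)"
  have sub: "cmat.subspace ?V" by (rule cmat.subspace_span)
  have V_whole: "?V \<subseteq> whole X"
    using h_whole root_vector_whole by (intro cmat.span_minimal subspace_whole) blast
  have stable: "brk X u x \<in> ?V" if u: "u \<in> h" and x: "x \<in> ?V" for u x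
    using x
  proof (rule cmat.span_induct)
    show "cmat.subspace {x. brk X u x \<in> ?V}"
      using sub by (auto simp: cmat.subspace_def brk_zero brk_add_right brk_scale_right)
    show "brk X u y \<in> ?V" if y: "y \<in> h \<union> E ` roots" for y
    proof (cases "y \<in> h")
      case True
      then show ?thesis by (simp add: h_commute u cmat.span_zero)
    next
      case False
      then obtain \<beta> where "\<beta> \<in> roots" "y = E \<beta>" using y by blast
      then show ?thesis
        using weight_space_brk[OF root_vector u, of \<beta>]
        by (simp add: cmat.span_scale cmat.span_base)
    qed
  qed
  have "ad_stable X h ?V" unfolding ad_stable_def using stable by blast
  then obtain W where W: "cmat.subspace W" "W \<subseteq> whole X" "ad_stable X h W"
      "?V \<inter> W = {0}" "{v + w | v w. v \<in> ?V \<and> w \<in> W} = whole X"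
    using cartan_subalgebra(1) sub V_whole
    unfolding cartan_subalgebra_def reductive_in_def by blast
  obtain B where B: "finite B" "whole X \<subseteq> cmat.span B"
    using finite_dim by blast
  have "W = {0}"
  proof (rule ccontr)
    assume "W \<noteq> {0}"
    then have "\<exists>w\<in>W. w \<noteq> 0 \<and> (\<forall>u\<in>h. \<exists>c. brk X u w = cscale c w)"
    proof (intro common_eigenvector[OF brk_linear_right W(1) _ _ B(1)])
      show "W \<subseteq> cmat.span B" using W(2) B(2) by blast
      show "brk X u x \<in> W" if "u \<in> h" "x \<in> W" for u x
        using W(3) that by (simp add: ad_stable_def)
      show "brk X u (brk X v x) = brk X v (brk X u x)" if "u \<in> h" "v \<in> h" "x \<in> W" for u v x
        using ad_h_commute that W(2) by blast
    qed
    then obtain w l where w: "w \<in> W" "w \<noteq> 0" and l: "\<And>u. u \<in> h \<Longrightarrow> brk X u w = cscale (l u) w"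
      by metis
    \<comment> \<open>Extended by 0 outside h, as \<open>dual_space\<close> demands.\<close>
    define \<beta> where "\<beta> u = (if u \<in> h then l u else 0)" for u
    have "\<beta> \<in> dual_space h"
      by (rule weight_dual[OF w(2) _ _ h_subspace]) (simp_all add: \<beta>_def l)
    moreover have wt: "w \<in> weight_space X h \<beta>"
      using w W(2) l by (auto simp: weight_space_def \<beta>_def)
    ultimately have "w \<in> ?V"
    proof (cases "\<beta> = 0")
      case True
      then show ?thesis using wt zero_weight_space cmat.span_base by blast
    next
      case False
      then have "\<beta> \<in> roots" using rootI[OF wt w(2)] \<open>\<beta> \<in> dual_space h\<close> by blast
      then obtain c where "w = cscale c (E \<beta>)" using root_spaceE wt by blast
      then show ?thesis
        using \<open>\<beta> \<in> roots\<close> by (simp add: cmat.span_scale cmat.span_base)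
    qed
    then show False using W(4) w by blast
  qed
  then have "whole X \<subseteq> ?V" using W(5) by force
  then show ?thesis using V_whole by blast
qed

lemma root_vectors_inj: "inj_on E roots"
proof (rule inj_onI, rule ccontr)
  fix \<beta> \<gamma> assume \<beta>: "\<beta> \<in> roots" and \<gamma>: "\<gamma> \<in> roots" and eq: "E \<beta> = E \<gamma>" and "\<beta> \<noteq> \<gamma>"
  then obtain u where u: "u \<in> h" "\<beta> u \<noteq> \<gamma> u"
    using dual_space_neqE roots_dual by blast
  have "cscale (\<beta> u) (E \<beta>) = cscale (\<gamma> u) (E \<beta>)"
    using weight_space_brk[OF root_vector[OF \<beta>] u(1)] weight_space_brk[OF root_vector[OF \<gamma>] u(1)]
    by (metis eq)
  then show False
    using u(2) root_vector_nonzero[OF \<beta>] by (simp add: cmat.scale_cancel_right)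
qed

lemma root_vectors_independent: "cmat.independent (E ` roots)"
proof
  assume "cmat.dependent (E ` roots)"
  then obtain t k where t: "finite t" "t \<subseteq> E ` roots" "(\<Sum>v\<in>t. cscale (k v) v) = 0"
      "\<exists>v\<in>t. k v \<noteq> 0"
    unfolding cmat.dependent_explicit by blast
  then obtain S where S: "S \<subseteq> roots" "inj_on E S" "t = E ` S"
    by (meson subset_image_inj)
  have "finite S" using S t(1) finite_imageD by blast
  have "(\<Sum>\<beta>\<in>S. cscale (k (E \<beta>)) (E \<beta>)) = 0"
    using t(3) S by (simp add: sum.reindex)
  then have "cscale (k (E \<beta>)) (E \<beta>) = 0" if "\<beta> \<in> S" for \<beta>
    using S(1) roots_dual root_vector that
    by (intro weight_vectors_independent[OF \<open>finite S\<close>, where v = "\<lambda>\<beta>. cscale (k (E \<beta>)) (E \<beta>)"])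
       (auto intro!: cmat.subspace_scale[OF subspace_weight_space])
  then have "k (E \<beta>) = 0" if "\<beta> \<in> S" for \<beta>
    using root_vector_nonzero S(1) that by (metis cmat.scale_eq_0_iff subsetD)
  then show False using t(4) S(3) by blast
qed

lemma finite_roots: "finite roots"
proof -
  obtain B where B: "finite B" "whole X \<subseteq> cmat.span B"
    using finite_dim by blast
  have "finite (E ` roots)"
    using cmat.independent_span_bound[OF B(1) root_vectors_independent] root_vector_whole B(2)
    by blast
  then show ?thesis using root_vectors_inj finite_imageD by blast
qed

lemma root_decomposition:
  assumes "x \<in> whole X"
  obtains u c where "u \<in> h" "x = u + (\<Sum>\<beta>\<in>roots. cscale (c \<beta>) (E \<beta>))"
proof -
  have "x \<in> {y + z | y z. y \<in> cmat.span h \<and> z \<in> cmat.span (E ` roots)}"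
    using assms unfolding whole_eq_span cmat.span_Un .
  then obtain u z where x: "x = u + z" "u \<in> cmat.span h" "z \<in> cmat.span (E ` roots)" by blast
  have "u \<in> h" using x(2) h_subspace by (metis cmat.span_eq_iff)
  obtain k where "z = (\<Sum>v\<in>E ` roots. cscale (k v) v)"
    using x(3) finite_roots by (auto simp: cmat.span_finite)
  then have "z = (\<Sum>\<beta>\<in>roots. cscale (k (E \<beta>)) (E \<beta>))"
    by (simp add: sum.reindex root_vectors_inj)
  then show thesis
    using that[OF \<open>u \<in> h\<close>, of "\<lambda>\<beta>. k (E \<beta>)"] x(1) by simp
qed

definition par :: "(cmat \<Rightarrow> complex) \<Rightarrow> nat" where
  "par \<beta> = (if E \<beta> \<in> part X 0 then 0 else 1)"

lemma par_cases: "par \<beta> \<in> {0, 1}"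
  by (simp add: par_def)

text \<open>The even component of \<open>E \<beta>\<close> also has weight \<beta>, so it is a
  multiple of \<open>E \<beta>\<close>: either it is zero and \<open>E \<beta>\<close> is odd, or
  \<open>E \<beta>\<close> itself is even. Thus the default value 1 in \<open>par\<close> is the
  true parity.\<close>

lemma root_vector_part:
  assumes "\<beta> \<in> roots"
  shows "E \<beta> \<in> part X (par \<beta>)"
proof -
  obtain x0 x1 where x: "E \<beta> = x0 + x1" "x0 \<in> part X 0" "x1 \<in> part X 1"
    using root_vector_whole[OF assms] by (rule wholeE)
  have "x0 \<in> weight_space X h \<beta>"
    using weight_space_graded[of h x0 x1 \<beta>] h_even root_vector[OF assms] x by auto
  then obtain c where c: "x0 = cscale c (E \<beta>)"
    using root_spaceE assms by blast
  show ?thesis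
  proof (cases "c = 0")
    case True
    then show ?thesis using c x by (auto simp: par_def)
  next
    case False
    then have "E \<beta> = cscale (1 / c) x0" by (simp add: c)
    then have "E \<beta> \<in> part X 0"
      using cmat.subspace_scale[OF subspace_part[of 0] x(2)] by simp
    then show ?thesis by (simp add: par_def)
  qed
qed

lemma root_vector_part_iff:
  assumes "\<beta> \<in> roots" "s \<in> {0,1}" "E \<beta> \<in> part X s"
  shows "par \<beta> = s"
proof -
  have "par \<beta> \<noteq> 0 \<Longrightarrow> s \<noteq> 0" "par \<beta> = 0 \<Longrightarrow> s = 1 \<Longrightarrow> E \<beta> \<in> part X 0 \<inter> part X 1"
    using assms by (auto simp: par_def split: if_splits)
  then show ?thesis
    using assms(2) par_cases[of \<beta>] root_vector_nonzero[OF assms(1)] part_Int by auto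
qed

section \<open>Root spaces and the invariant form\<close>

lemma form_add:
  "x \<in> whole X \<Longrightarrow> y \<in> whole X \<Longrightarrow> z \<in> whole X \<Longrightarrow> b (x + y) z = b x z + b y z"
  "x \<in> whole X \<Longrightarrow> y \<in> whole X \<Longrightarrow> z \<in> whole X \<Longrightarrow> b z (x + y) = b z x + b z y"
  using form by (simp_all add: invariant_form_def)

lemma form_scale:
  "x \<in> whole X \<Longrightarrow> y \<in> whole X \<Longrightarrow> b (cscale c x) y = c * b x y"
  "x \<in> whole X \<Longrightarrow> y \<in> whole X \<Longrightarrow> b x (cscale c y) = c * b x y"
  using form by (simp_all add: invariant_form_def)

lemma form_swap:
  "s \<in> {0,1} \<Longrightarrow> t \<in> {0,1} \<Longrightarrow> x \<in> part X s \<Longrightarrow> y \<in> part X t \<Longrightarrow> b x y = (-1) ^ (s * t) * b y x"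
  using form unfolding invariant_form_def by blast

lemma form_parity: "x \<in> part X 0 \<Longrightarrow> y \<in> part X 1 \<Longrightarrow> b x y = 0 \<and> b y x = 0"
  using form by (simp add: invariant_form_def)

lemma form_brk:
  "x \<in> whole X \<Longrightarrow> y \<in> whole X \<Longrightarrow> z \<in> whole X \<Longrightarrow> b (brk X x y) z = b x (brk X y z)"
  using form by (simp add: invariant_form_def)

lemma form_zero: "x \<in> whole X \<Longrightarrow> b x 0 = 0" "x \<in> whole X \<Longrightarrow> b 0 x = 0"
  using form_scale(2)[of x x 0] form_scale(1)[of x x 0] by simp_all

lemma sum_whole: "(\<And>i. i \<in> I \<Longrightarrow> f i \<in> whole X) \<Longrightarrow> sum f I \<in> whole X"
  by (rule cmat.subspace_sum[OF subspace_whole])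

lemma scale_whole: "x \<in> whole X \<Longrightarrow> cscale c x \<in> whole X"
  by (rule cmat.subspace_scale[OF subspace_whole])

lemma form_sum_right:
  assumes x: "x \<in> whole X" and "\<And>i. i \<in> I \<Longrightarrow> f i \<in> whole X"
  shows "b x (sum f I) = (\<Sum>i\<in>I. b x (f i))"
  using assms(2)
  by (induction I rule: infinite_finite_induct) (simp_all add: form_zero x form_add sum_whole)

lemma form_h_swap: "x \<in> h \<Longrightarrow> y \<in> h \<Longrightarrow> b x y = b y x"
  using form_swap[of 0 0 x y] h_even by simp

text \<open>Invariance moves u from one argument of the form to the other, which gives
  \<open>- \<beta> u * b x y = \<gamma> u * b x y\<close>.\<close>

lemma weight_spaces_orthogonal:
  assumes x: "x \<in> weight_space X h \<beta>" and y: "y \<in> weight_space X h \<gamma>"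
    and u: "u \<in> h" "\<beta> u + \<gamma> u \<noteq> 0"
  shows "b x y = 0"
proof -
  note wh = weight_space_whole[OF x] weight_space_whole[OF y] h_whole[OF u(1)]
  have "brk X x u = cscale (- \<beta> u) x"
    using brk_swap_even[OF h_even[OF u(1)] wh(1)] weight_space_brk[OF x u(1)]
    by (metis cmat.scale_minus_left minus_equation_iff)
  then have "- \<beta> u * b x y = b x (brk X u y)"
    using form_brk[OF wh(1,3,2)] form_scale(1)[OF wh(1,2), of "- \<beta> u"] by simp
  also have "\<dots> = \<gamma> u * b x y"
    using weight_space_brk[OF y u(1)] wh by (simp add: form_scale)
  finally have "(\<beta> u + \<gamma> u) * b x y = 0" by (simp add: distrib_right eq_neg_iff_add_eq_0[symmetric] neg_eq_iff_add_eq_0)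
  then show ?thesis using u(2) by simp
qed

lemma h_root_orthogonal: "u \<in> h \<Longrightarrow> \<beta> \<in> roots \<Longrightarrow> b u (E \<beta>) = 0"
  "u \<in> h \<Longrightarrow> \<beta> \<in> roots \<Longrightarrow> b (E \<beta>) u = 0"
proof -
  assume u: "u \<in> h" and \<beta>: "\<beta> \<in> roots"
  obtain v where v: "v \<in> h" "\<beta> v \<noteq> 0" using root_nonzeroE[OF \<beta>] .
  have u0: "u \<in> weight_space X h 0" using u by (simp add: zero_weight_space)
  show "b u (E \<beta>) = 0"
    using weight_spaces_orthogonal[OF u0 root_vector[OF \<beta>] v(1)] v(2) by simp
  show "b (E \<beta>) u = 0"
    using weight_spaces_orthogonal[OF root_vector[OF \<beta>] u0 v(1)] v(2) by simp
qed

text \<open>By non-degeneracy \<open>E \<beta>\<close> pairs nontrivially with some y, and by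
  orthogonality of weight spaces only a component of y of weight -\<beta> can contribute. Since the
  form is even, the two root vectors have the same parity.\<close>

lemma neg_root:
  assumes \<beta>: "\<beta> \<in> roots"
  shows "- \<beta> \<in> roots" "b (E (- \<beta>)) (E \<beta>) \<noteq> 0" "par (- \<beta>) = par \<beta>"
proof -
  have wh: "E \<beta> \<in> whole X" by (rule root_vector_whole[OF \<beta>])
  obtain y where y: "y \<in> whole X" "b (E \<beta>) y \<noteq> 0"
    using form_nondeg root_vector_nonzero[OF \<beta>] wh unfolding nondegenerate_on_def by blast
  obtain u c where uc: "u \<in> h" "y = u + (\<Sum>\<gamma>\<in>roots. cscale (c \<gamma>) (E \<gamma>))"
    using root_decomposition[OF y(1)] .
  have "b (E \<beta>) y = b (E \<beta>) u + (\<Sum>\<gamma>\<in>roots. c \<gamma> * b (E \<beta>) (E \<gamma>))"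
    unfolding uc(2) using root_vector_whole h_whole[OF uc(1)]
    by (simp add: form_add form_sum_right wh form_scale sum_whole scale_whole)
  then have "(\<Sum>\<gamma>\<in>roots. c \<gamma> * b (E \<beta>) (E \<gamma>)) \<noteq> 0"
    using y(2) h_root_orthogonal(2)[OF uc(1) \<beta>] by simp
  then obtain \<gamma> where \<gamma>: "\<gamma> \<in> roots" "c \<gamma> * b (E \<beta>) (E \<gamma>) \<noteq> 0"
    by (rule sum.not_neutral_contains_not_neutral)
  have nz: "b (E \<beta>) (E \<gamma>) \<noteq> 0" using \<gamma>(2) by simp
  have "\<gamma> = - \<beta>"
  proof
    fix v
    show "\<gamma> v = (- \<beta>) v"
    proof (cases "v \<in> h")
      case True
      then have "\<beta> v + \<gamma> v = 0"
        using weight_spaces_orthogonal[OF root_vector[OF \<beta>] root_vector[OF \<gamma>(1)]] nz by blast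
      then show ?thesis by (simp add: add_eq_0_iff)
    next
      case False
      then show ?thesis using roots_dual[OF \<beta>] roots_dual[OF \<gamma>(1)] by (simp add: dual_space_def)
    qed
  qed
  with \<gamma>(1) nz show neg: "- \<beta> \<in> roots" and "b (E (- \<beta>)) (E \<beta>) \<noteq> 0"
    using form_swap[OF par_cases par_cases root_vector_part[OF \<beta>] root_vector_part[OF \<gamma>(1)]]
    by auto
  show "par (- \<beta>) = par \<beta>"
  proof (rule ccontr)
    assume "par (- \<beta>) \<noteq> par \<beta>"
    then have "b (E \<beta>) (E (- \<beta>)) = 0"
      using form_parity root_vector_part[OF \<beta>] root_vector_part[OF neg]
        par_cases[of \<beta>] par_cases[of "- \<beta>"] by auto
    then show False using nz \<open>\<gamma> = - \<beta>\<close> by simp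
  qed
qed

section \<open>The involution on roots\<close>

definition invol_root :: "(cmat \<Rightarrow> complex) \<Rightarrow> cmat \<Rightarrow> complex" where
  "invol_root \<beta> u = (if u \<in> h then \<beta> (invol X u) else 0)"

lemma invol_weight_space:
  assumes "x \<in> weight_space X h \<beta>"
  shows "invol X x \<in> weight_space X h (invol_root \<beta>)"
proof -
  have x: "x \<in> whole X" by (rule weight_space_whole[OF assms])
  have "brk X u (invol X x) = cscale (invol_root \<beta> u) (invol X x)" if u: "u \<in> h" for u
  proof -
    have "brk X u (invol X x) = invol X (brk X (invol X u) x)"
      using invol_h[OF u] x by (simp add: invol_brk h_whole u invol_invol)
    also have "\<dots> = cscale (invol_root \<beta> u) (invol X x)"
      using weight_space_brk[OF assms invol_h[OF u]] x u by (simp add: invol_scale invol_root_def)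
    finally show ?thesis .
  qed
  then show ?thesis using x by (simp add: weight_space_def invol_whole)
qed

lemma invol_nonzero: "x \<in> whole X \<Longrightarrow> x \<noteq> 0 \<Longrightarrow> invol X x \<noteq> 0"
  using invol_invol[of x] invol_scale[of 0 0] cmat.subspace_0[OF subspace_whole] by auto

lemma invol_root_roots:
  assumes \<beta>: "\<beta> \<in> roots"
  shows "invol_root \<beta> \<in> roots"
proof (rule rootI)
  show "invol X (E \<beta>) \<in> weight_space X h (invol_root \<beta>)"
    by (rule invol_weight_space[OF root_vector[OF \<beta>]])
  show nz: "invol X (E \<beta>) \<noteq> 0"
    by (rule invol_nonzero[OF root_vector_whole[OF \<beta>] root_vector_nonzero[OF \<beta>]])
  show "invol_root \<beta> \<in> dual_space h"
    using weight_space_brk[OF invol_weight_space[OF root_vector[OF \<beta>]]]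
    by (intro weight_dual[OF nz _ _ h_subspace]) (auto simp: invol_root_def)
  obtain u where u: "u \<in> h" "\<beta> u \<noteq> 0" using root_nonzeroE[OF \<beta>] .
  then have "invol_root \<beta> (invol X u) \<noteq> 0"
    by (simp add: invol_root_def invol_h invol_invol h_whole)
  then show "invol_root \<beta> \<noteq> 0" by auto
qed

lemma invol_root_vectorE:
  assumes \<beta>: "\<beta> \<in> roots"
  obtains c where "invol X (E \<beta>) = cscale c (E (invol_root \<beta>))" "par (invol_root \<beta>) = par \<beta>"
proof -
  obtain c where c: "invol X (E \<beta>) = cscale c (E (invol_root \<beta>))"
    using root_spaceE[OF invol_root_roots[OF \<beta>] invol_weight_space[OF root_vector[OF \<beta>]]] .
  have "c \<noteq> 0"
    using c invol_nonzero[OF root_vector_whole[OF \<beta>] root_vector_nonzero[OF \<beta>]] by auto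
  then have "E (invol_root \<beta>) = cscale (1 / c) (invol X (E \<beta>))" by (simp add: c)
  then have "E (invol_root \<beta>) \<in> part X (par \<beta>)"
    using invol_part[OF par_cases root_vector_part[OF \<beta>]]
      cmat.subspace_scale[OF subspace_part[OF par_cases]] by metis
  then have "par (invol_root \<beta>) = par \<beta>"
    by (rule root_vector_part_iff[OF invol_root_roots[OF \<beta>] par_cases])
  then show thesis using that c by blast
qed

end

section \<open>Projection to the Cartan subspace and the form on its dual\<close>

context cartan_setting
begin

definition res :: "(cmat \<Rightarrow> complex) \<Rightarrow> cmat \<Rightarrow> complex" where
  "res \<beta> u = (if u \<in> a then \<beta> u else 0)"

definition a_proj :: "cmat \<Rightarrow> cmat" where
  "a_proj u = cscale (1/2) (u - invol X u)"

text \<open>Projecting to the -1 eigenspace of \<theta> does not leave h, so the result commutes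
  with a; and a is its own centraliser in that eigenspace.\<close>

lemma a_proj_mem:
  assumes u: "u \<in> h"
  shows "a_proj u \<in> a"
proof (rule a_self_centralising)
  have pu: "a_proj u \<in> h"
    unfolding a_proj_def
    by (intro cmat.subspace_scale[OF h_subspace] cmat.subspace_diff[OF h_subspace] u invol_h)
  have wh: "u \<in> whole X" "invol X u \<in> whole X" "u - invol X u \<in> whole X"
    using u invol_whole cmat.subspace_diff[OF subspace_whole] by (simp_all add: h_whole)
  then have "invol X (a_proj u) = - a_proj u"
    by (simp add: a_proj_def invol_scale invol_diff invol_invol
        cmat.scale_minus_right[symmetric])
  then show "a_proj u \<in> pp X"
    using h_whole[OF pu] by (simp add: pp_def)
  show "brk X v (a_proj u) = 0" if "v \<in> a" for v
    using h_commute a_h that pu by blast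
qed

lemma minus_a_proj_kk:
  assumes "u \<in> h"
  shows "u - a_proj u \<in> kk X"
proof -
  have "u - a_proj u = cscale (1/2) (u + invol X u)"
    by (simp add: a_proj_def cscale_def fun_eq_iff field_simps)
  moreover have "cscale c x \<in> kk X" if "x \<in> kk X" for c x
    using that by (simp add: kk_def invol_scale scale_whole)
  ultimately show ?thesis using plus_invol_kk[OF h_whole[OF assms]] by simp
qed

lemma a_whole: "u \<in> a \<Longrightarrow> u \<in> whole X"
  by (rule h_whole[OF a_h])

lemma a_proj_a: "u \<in> a \<Longrightarrow> a_proj u = u"
  using a_pp[of u] by (simp add: a_proj_def pp_def cscale_def fun_eq_iff)

lemma a_proj_add: "u \<in> h \<Longrightarrow> v \<in> h \<Longrightarrow> a_proj (u + v) = a_proj u + a_proj v"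
  by (simp add: a_proj_def invol_add h_whole cscale_def fun_eq_iff algebra_simps)

lemma a_proj_scale: "u \<in> h \<Longrightarrow> a_proj (cscale c u) = cscale c (a_proj u)"
  by (simp add: a_proj_def invol_scale h_whole cmat.scale_right_diff_distrib mult.commute)

lemma form_uminus: "x \<in> whole X \<Longrightarrow> y \<in> whole X \<Longrightarrow> b x (- y) = - b x y"
  using form_scale(2)[of x y "-1"] by simp

lemma form_diff_left:
  assumes "x \<in> whole X" "y \<in> whole X" "z \<in> whole X"
  shows "b (x - y) z = b x z - b y z"
  using form_add(1)[of "x - y" y z] assms cmat.subspace_diff[OF subspace_whole] by simp

text \<open>\<theta> preserves the form and acts by 1 on x and by -1 on u.\<close>

lemma kk_a_orthogonal:
  assumes "x \<in> kk X" "u \<in> a"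
  shows "b x u = 0"
proof -
  have "b x u = b (invol X x) (invol X u)"
    using form_invol assms a_whole by (auto simp: kk_def)
  also have "\<dots> = - b x u"
    using assms a_pp[OF assms(2)] a_whole by (simp add: kk_def pp_def form_uminus)
  finally show ?thesis by simp
qed

lemma form_a_proj: "u \<in> h \<Longrightarrow> v \<in> a \<Longrightarrow> b (a_proj u) v = b u v"
  using kk_a_orthogonal[OF minus_a_proj_kk, of u v] form_diff_left[of u "a_proj u" v]
  by (simp add: h_whole a_whole a_proj_mem)

text \<open>Put p = \<open>E \<beta> - invol X (E \<beta>)\<close>. Since \<beta> vanishes on a and
  \<theta> maps a to itself, p commutes with a and hence lies in a, so ad h kills it. But a
  \<theta>-fixed v in h acts on p by \<beta> v, and v can be chosen with \<beta> v nonzero; thus p =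
  0.\<close>

lemma res_zero_kk:
  assumes \<beta>: "\<beta> \<in> roots" and "res \<beta> = 0"
  shows "E \<beta> \<in> kk X"
proof -
  have \<beta>a: "\<beta> u = 0" if "u \<in> a" for u
    using fun_cong[OF assms(2), of u] that by (simp add: res_def)
  note E = root_vector_whole[OF \<beta>]
  let ?p = "E \<beta> - invol X (E \<beta>)"
  have pw: "?p \<in> whole X"
    by (intro cmat.subspace_diff[OF subspace_whole] invol_whole E)
  have "invol X ?p = - ?p"
    by (simp add: invol_diff E invol_whole invol_invol)
  then have "?p \<in> pp X" using pw by (simp add: pp_def)
  have brk_p: "brk X u ?p = cscale (\<beta> u) (E \<beta>) - cscale (\<beta> (invol X u)) (invol X (E \<beta>))"
    if "u \<in> h" for u
    using weight_space_brk[OF root_vector[OF \<beta>] that]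
      weight_space_brk[OF invol_weight_space[OF root_vector[OF \<beta>]] that] that
    by (simp add: linear_map_diff[OF brk_linear_right] invol_root_def)
  have inv_a: "invol X u \<in> a \<and> invol X u = - u" if "u \<in> a" for u
    using a_pp[OF that] that cmat.subspace_neg[OF a_subspace] by (simp add: pp_def)
  have "brk X u ?p = 0" if "u \<in> a" for u
    using brk_p[OF a_h[OF that]] \<beta>a[OF that] \<beta>a[of "invol X u"] inv_a[OF that]
    by (metis cmat.scale_zero_left diff_zero)
  then have "?p \<in> a"
    by (rule a_self_centralising[OF \<open>?p \<in> pp X\<close>])
  obtain u where u: "u \<in> h" "\<beta> u \<noteq> 0" using root_nonzeroE[OF \<beta>] .
  \<comment> \<open>\<beta> vanishes on a, so removing the a-component of u does not change the
    value of \<beta>.\<close>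
  let ?v = "u - a_proj u"
  have v: "?v \<in> h" "invol X ?v = ?v"
    using minus_a_proj_kk[OF u(1)] cmat.subspace_diff[OF h_subspace u(1) a_h[OF a_proj_mem[OF u(1)]]]
    by (simp_all add: kk_def)
  have "\<beta> u = \<beta> (?v + a_proj u)" by simp
  also have "\<dots> = \<beta> ?v + \<beta> (a_proj u)"
    using roots_dual[OF \<beta>] v(1) a_h[OF a_proj_mem[OF u(1)]]
    unfolding dual_space_def by blast
  finally have "\<beta> ?v \<noteq> 0" using u \<beta>a[OF a_proj_mem[OF u(1)]] by simp
  moreover have "brk X ?v ?p = cscale (\<beta> ?v) ?p"
    unfolding brk_p[OF v(1)] v(2) by (simp add: cmat.scale_right_diff_distrib)
  moreover have "brk X ?v ?p = 0"
    by (rule h_commute[OF v(1) a_h[OF \<open>?p \<in> a\<close>]])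
  ultimately have "?p = 0" by simp
  then show ?thesis using E by (simp add: kk_def)
qed

lemma h_nondegenerate:
  assumes u: "u \<in> h" and "\<And>v. v \<in> h \<Longrightarrow> b u v = 0"
  shows "u = 0"
proof -
  have "b u y = 0" if yX: "y \<in> whole X" for y
  proof -
    obtain v c where y: "v \<in> h" "y = v + (\<Sum>\<beta>\<in>roots. cscale (c \<beta>) (E \<beta>))"
      using root_decomposition[OF yX] .
    show ?thesis
      unfolding y(2) using root_vector_whole y(1) u assms(2)
      by (simp add: form_add form_sum_right form_scale sum_whole scale_whole h_whole
          h_root_orthogonal)
  qed
  then show ?thesis
    using form_nondeg h_whole[OF u] unfolding nondegenerate_on_def by blast
qed

lemma hs_mem: "k < length hs \<Longrightarrow> hs ! k \<in> h"
  using orth_basis(1) cmat.span_base by (auto simp: is_basis_def)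

lemma h_zeroI:
  assumes u: "u \<in> h" and z: "\<And>k. k < length hs \<Longrightarrow> b u (hs ! k) = 0"
  shows "u = 0"
proof (rule h_nondegenerate[OF u])
  fix v assume "v \<in> h"
  then have "v \<in> cmat.span (set hs)" using orth_basis(1) by (simp add: is_basis_def)
  then have "v \<in> h \<and> b u v = 0"
  proof (rule cmat.span_induct)
    show "cmat.subspace {v. v \<in> h \<and> b u v = 0}"
      using u by (auto simp: cmat.subspace_def form_zero form_add form_scale h_whole
          cmat.subspace_0[OF h_subspace] cmat.subspace_add[OF h_subspace]
          cmat.subspace_scale[OF h_subspace])
    show "x \<in> h \<and> b u x = 0" if "x \<in> set hs" for x
      using that z hs_mem by (auto simp: in_set_conv_nth)
  qed
  then show "b u v = 0" by blast
qed

lemma hs_norm_nonzero: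
  assumes k: "k < length hs"
  shows "b (hs ! k) (hs ! k) \<noteq> 0"
proof
  assume "b (hs ! k) (hs ! k) = 0"
  then have "hs ! k = 0"
    using orth_basis(2) k \<open>b (hs ! k) (hs ! k) = 0\<close> by (intro h_zeroI hs_mem) metis+
  then have "0 \<in> set hs" using k nth_mem by metis
  then show False
    using orth_basis(1) cmat.dependent_zero by (auto simp: is_basis_def)
qed

lemma sum_h: "(\<And>i. i \<in> I \<Longrightarrow> f i \<in> h) \<Longrightarrow> sum f I \<in> h"
  by (rule cmat.subspace_sum[OF h_subspace])

lemma scale_h: "x \<in> h \<Longrightarrow> cscale c x \<in> h"
  by (rule cmat.subspace_scale[OF h_subspace])

lemma form_sum_scale:
  assumes "x \<in> whole X" "\<And>i. i \<in> I \<Longrightarrow> f i \<in> whole X"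
  shows "b x (\<Sum>i\<in>I. cscale (c i) (f i)) = (\<Sum>i\<in>I. c i * b x (f i))"
proof -
  have "b x (\<Sum>i\<in>I. cscale (c i) (f i)) = (\<Sum>i\<in>I. b x (cscale (c i) (f i)))"
    by (rule form_sum_right) (simp_all add: assms scale_whole)
  also have "\<dots> = (\<Sum>i\<in>I. c i * b x (f i))"
    by (rule sum.cong) (simp_all add: assms form_scale)
  finally show ?thesis .
qed

lemma hs_whole: "k \<in> {..<length hs} \<Longrightarrow> hs ! k \<in> whole X"
  by (simp add: h_whole hs_mem)

lemma form_hs_sum:
  assumes "j < length hs"
  shows "b (hs ! j) (\<Sum>k<length hs. cscale (c k) (hs ! k)) = c j * b (hs ! j) (hs ! j)"
proof -
  have "b (hs ! j) (\<Sum>k<length hs. cscale (c k) (hs ! k)) =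
      (\<Sum>k<length hs. c k * b (hs ! j) (hs ! k))"
    using assms by (intro form_sum_scale hs_whole) simp_all
  also have "\<dots> = (\<Sum>k<length hs. if k = j then c j * b (hs ! j) (hs ! j) else 0)"
    using orth_basis(2) assms by (intro sum.cong) auto
  finally show ?thesis using assms by simp
qed

lemma hs_expansion:
  assumes u: "u \<in> h"
  shows "u = (\<Sum>k<length hs. cscale (b u (hs ! k) / b (hs ! k) (hs ! k)) (hs ! k))" (is "u = ?s")
proof -
  have s: "?s \<in> h" by (intro sum_h scale_h hs_mem) simp
  have "u - ?s = 0"
  proof (rule h_zeroI)
    show "u - ?s \<in> h" by (rule cmat.subspace_diff[OF h_subspace u s])
    show "b (u - ?s) (hs ! j) = 0" if "j < length hs" for j
      using form_hs_sum[OF that, of "\<lambda>k. b u (hs ! k) / b (hs ! k) (hs ! k)"]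
        hs_norm_nonzero[OF that] form_h_swap[OF s hs_mem[OF that]]
      by (simp add: form_diff_left h_whole u s hs_mem that)
  qed
  then show ?thesis by simp
qed

lemma form_parseval:
  assumes "u \<in> h" "v \<in> h"
  shows "b u v = (\<Sum>k<length hs. b u (hs ! k) * b v (hs ! k) / b (hs ! k) (hs ! k))"
proof -
  have "b u v = b u (\<Sum>k<length hs. cscale (b v (hs ! k) / b (hs ! k) (hs ! k)) (hs ! k))"
    using hs_expansion[OF assms(2)] by simp
  then show ?thesis
    by (subst (asm) form_sum_scale) (simp_all add: h_whole[OF assms(1)] hs_whole mult.commute)
qed

lemma dual_space_sum:
  assumes "\<phi> \<in> dual_space c" "cmat.subspace c" "\<And>i. i \<in> I \<Longrightarrow> f i \<in> c"
  shows "\<phi> (\<Sum>i\<in>I. cscale (k i) (f i)) = (\<Sum>i\<in>I. k i * \<phi> (f i))"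
proof -
  have add: "\<phi> (x + y) = \<phi> x + \<phi> y" if "x \<in> c" "y \<in> c" for x y
    using assms(1) that unfolding dual_space_def by blast
  have sc: "\<phi> (cscale l x) = l * \<phi> x" if "x \<in> c" for x l
    using assms(1) that unfolding dual_space_def by blast
  have "\<phi> 0 = 0" using sc[of 0 0] cmat.subspace_0[OF assms(2)] by simp
  then show ?thesis
    using assms(3)
    by (induction I rule: infinite_finite_induct)
       (simp_all add: add sc cmat.subspace_scale[OF assms(2)] cmat.subspace_sum[OF assms(2)])
qed

lemma dual_vector:
  assumes \<phi>: "\<phi> \<in> dual_space a"
  shows "dual_vector a b \<phi> \<in> a \<and> (\<forall>w\<in>a. b (dual_vector a b \<phi>) w = \<phi> w)"
proof -
  \<comment> \<open>The vector of h that represents the functional \<phi> composed with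
    \<open>a_proj\<close>, expanded in the orthogonal basis. Its projection to a represents
    \<phi>.\<close>
  define v where
    "v = (\<Sum>k<length hs. cscale (\<phi> (a_proj (hs ! k)) / b (hs ! k) (hs ! k)) (hs ! k))"
  have v: "v \<in> h" unfolding v_def by (intro sum_h scale_h hs_mem) simp
  have "b (a_proj v) w = \<phi> w" if w: "w \<in> a" for w
  proof -
    let ?c = "\<lambda>k. b w (hs ! k) / b (hs ! k) (hs ! k)"
    have wh: "w \<in> h" by (rule a_h[OF w])
    have proj_sum: "a_proj (\<Sum>k\<in>I. cscale (?c k) (hs ! k)) = (\<Sum>k\<in>I. cscale (?c k) (a_proj (hs ! k)))"
      if "I \<subseteq> {..<length hs}" for I
    proof -
      have "finite I" using that finite_subset by blast
      have z: "a_proj 0 = 0" using a_proj_scale[of 0 0] cmat.subspace_0[OF h_subspace] by simp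
      from \<open>finite I\<close> that show ?thesis
        by (induction I) (simp_all only: z sum.empty sum.insert not_False_eq_True insert_subset
            a_proj_add a_proj_scale scale_h sum_h hs_mem lessThan_iff, auto simp: subset_iff
            a_proj_add a_proj_scale scale_h sum_h hs_mem)
    qed
    have "\<phi> w = \<phi> (a_proj (\<Sum>k<length hs. cscale (?c k) (hs ! k)))"
      using hs_expansion[OF wh] a_proj_a[OF w] by simp
    also have "\<dots> = (\<Sum>k<length hs. ?c k * \<phi> (a_proj (hs ! k)))"
      by (subst proj_sum[OF order_refl], rule dual_space_sum[OF \<phi> a_subspace])
         (simp add: a_proj_mem hs_mem)
    also have "\<dots> = b w v"
      unfolding v_def by (subst form_sum_scale) (simp_all add: h_whole wh hs_whole mult.commute)
    also have "\<dots> = b (a_proj v) w"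
      using form_h_swap[OF wh v] form_a_proj[OF v w] by simp
    finally show ?thesis ..
  qed
  then have ex: "a_proj v \<in> a \<and> (\<forall>w\<in>a. b (a_proj v) w = \<phi> w)"
    using a_proj_mem[OF v] by blast
  moreover have "t = a_proj v" if t: "t \<in> a \<and> (\<forall>w\<in>a. b t w = \<phi> w)" for t
  proof -
    have "t - a_proj v \<in> a" using t ex cmat.subspace_diff[OF a_subspace] by blast
    moreover have "b (t - a_proj v) w = 0" if "w \<in> a" for w
      using t ex that by (simp add: form_diff_left a_whole)
    ultimately have "t - a_proj v = 0"
      using form_nondeg_a unfolding nondegenerate_on_def by blast
    then show ?thesis by simp
  qed
  ultimately show ?thesis
    unfolding dual_vector_def by (rule theI)
qed

lemma es_independent: "cmat.independent (set es)" "cmat.span (set es) = a" "distinct es"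
  using basis_a by (auto simp: is_basis_def)

lemma es_mem: "i < length es \<Longrightarrow> es ! i \<in> a"
  using es_independent(2) cmat.span_base nth_mem by metis

lemma es_representation:
  assumes "u \<in> a"
  shows "u = (\<Sum>i<length es. cscale (cmat.representation (set es) u (es ! i)) (es ! i))"
proof -
  have "(\<Sum>v\<in>set es. cscale (cmat.representation (set es) u v) v) = u"
    using es_independent assms by (intro cmat.sum_representation_eq) auto
  moreover have "bij_betw ((!) es) {..<length es} (set es)"
    using es_independent(3) by (rule bij_betw_nth) simp_all
  ultimately show ?thesis
    by (simp add: sum.reindex_bij_betw[where g = "\<lambda>v. cscale (cmat.representation (set es) u v) v"])
qed

lemma coord:
  assumes i: "i < length es"
  shows "coord a es i \<in> dual_space a \<and>
    (\<forall>j<length es. coord a es i (es ! j) = (if j = i then 1 else 0))"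
proof -
  define \<phi> where "\<phi> u = (if u \<in> a then cmat.representation (set es) u (es ! i) else 0)" for u
  have "\<phi> \<in> dual_space a"
    using es_independent cmat.representation_add[OF es_independent(1)]
      cmat.representation_scale[OF es_independent(1)]
      cmat.subspace_add[OF a_subspace] cmat.subspace_scale[OF a_subspace]
    by (simp add: dual_space_def \<phi>_def)
  moreover have "\<phi> (es ! j) = (if j = i then 1 else 0)" if "j < length es" for j
    using cmat.representation_basis[OF es_independent(1), of "es ! j"] that i es_mem
      nth_eq_iff_index_eq[OF es_independent(3)] by (auto simp: \<phi>_def)
  ultimately have ex: "\<phi> \<in> dual_space a \<and> (\<forall>j<length es. \<phi> (es ! j) = (if j = i then 1 else 0))"
    by blast
  moreover have "\<psi> = \<phi>"
    if \<psi>: "\<psi> \<in> dual_space a \<and> (\<forall>j<length es. \<psi> (es ! j) = (if j = i then 1 else 0))" for \<psi>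
  proof
    fix u
    show "\<psi> u = \<phi> u"
    proof (cases "u \<in> a")
      case True
      let ?r = "\<lambda>j. cmat.representation (set es) u (es ! j)"
      have "\<chi> u = (\<Sum>j<length es. ?r j * \<chi> (es ! j))" if "\<chi> \<in> dual_space a" for \<chi>
        using dual_space_sum[OF that a_subspace, of "{..<length es}" "(!) es" ?r] es_mem
          es_representation[OF True] by simp
      then have "\<psi> u = (\<Sum>j<length es. ?r j * \<psi> (es ! j))" "\<phi> u = (\<Sum>j<length es. ?r j * \<phi> (es ! j))"
        using \<psi> ex by blast+
      then show ?thesis using \<psi> ex by simp
    next
      case False
      then show ?thesis using \<psi> ex by (simp add: dual_space_def)
    qed
  qed
  ultimately show ?thesis unfolding coord_def by (rule theI)
qed

lemma coord_expansion:
  assumes u: "u \<in> a"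
  shows "u = (\<Sum>i<length es. cscale (coord a es i u) (es ! i))"
proof -
  let ?r = "\<lambda>j. cmat.representation (set es) u (es ! j)"
  have "coord a es i u = ?r i" if i: "i < length es" for i
  proof -
    have "coord a es i u = (\<Sum>j<length es. ?r j * coord a es i (es ! j))"
      using dual_space_sum[of "coord a es i" a "{..<length es}" "(!) es" ?r] es_mem coord[OF i]
        es_representation[OF u] a_subspace by simp
    also have "\<dots> = (\<Sum>j<length es. if j = i then ?r i else 0)"
      using coord[OF i] by (intro sum.cong) auto
    finally show ?thesis using i by simp
  qed
  then show ?thesis using es_representation[OF u] by simp
qed

text \<open>The i-th coordinate of the dual vector t of \<phi> is the pairing of t with the dual
  vector of that coordinate. These are the coefficients in \<open>root_deriv\<close>, which thereby
  becomes the derivative in the direction t.\<close>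

lemma dual_vector_expansion:
  assumes \<phi>: "\<phi> \<in> dual_space a"
  shows "dual_vector a b \<phi> = (\<Sum>i<length es. cscale (dual_form a b \<phi> (coord a es i)) (es ! i))"
proof -
  note t = dual_vector[OF \<phi>]
  have "dual_form a b \<phi> (coord a es i) = coord a es i (dual_vector a b \<phi>)" if i: "i < length es" for i
    using dual_vector[of "coord a es i"] coord[OF i] t form_h_swap a_h
    unfolding dual_form_def by metis
  then show ?thesis
    using coord_expansion[of "dual_vector a b \<phi>"] t by simp
qed

text \<open>Parseval's identity for hs, since pairing with a vector of a factors through the projection
  onto a.\<close>

lemma dual_form_coord:
  assumes i: "i < length es" and j: "j < length es"
  shows "dual_form a b (coord a es i) (coord a es j) =
    (\<Sum>k<length hs. coord a es i (a_proj (hs ! k)) * coord a es j (a_proj (hs ! k))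
      / b (hs ! k) (hs ! k))"
proof -
  have "b (dual_vector a b (coord a es l)) (hs ! k) = coord a es l (a_proj (hs ! k))"
    if "l < length es" "k < length hs" for k l
  proof -
    note t = dual_vector[of "coord a es l"] coord[OF that(1)]
    have "coord a es l (a_proj (hs ! k)) = b (dual_vector a b (coord a es l)) (a_proj (hs ! k))"
      using t a_proj_mem[OF hs_mem[OF that(2)]] by simp
    also have "\<dots> = b (hs ! k) (dual_vector a b (coord a es l))"
      using form_h_swap[OF a_h a_h] form_a_proj[OF hs_mem[OF that(2)]] t
        a_proj_mem[OF hs_mem[OF that(2)]] by metis
    also have "\<dots> = b (dual_vector a b (coord a es l)) (hs ! k)"
      using form_h_swap[OF hs_mem[OF that(2)] a_h] t by blast
    finally show ?thesis ..
  qed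
  then show ?thesis
    using form_parseval[OF a_h a_h] dual_vector[of "coord a es i"] dual_vector[of "coord a es j"]
      coord i j by (simp add: dual_form_def)
qed

end

section \<open>Restriction of roots and superdimensions\<close>

context cartan_setting
begin

lemma res_dual: "\<beta> \<in> roots \<Longrightarrow> res \<beta> \<in> dual_space a"
  using roots_dual[of \<beta>] a_h cmat.subspace_add[OF a_subspace] cmat.subspace_scale[OF a_subspace]
  by (simp add: dual_space_def res_def)

lemma res_uminus: "res (- \<beta>) = - res \<beta>"
  by (simp add: res_def fun_eq_iff)

text \<open>The sign is that of supersymmetry. Between the coefficient
  \<open>1 / b (E (- \<beta>)) (E \<beta>)\<close> of the Casimir element and the bracket of the two
  root vectors it leaves a factor \<open>(-1) ^ par \<beta>\<close>, so that odd roots count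
  negatively.\<close>

lemma par_swap_sign:
  assumes \<beta>: "\<beta> \<in> roots"
  shows "b (E \<beta>) (E (- \<beta>)) = (-1) ^ par \<beta> * b (E (- \<beta>)) (E \<beta>)"
proof -
  have "par \<beta> * par (- \<beta>) = par \<beta>"
    unfolding neg_root(3)[OF \<beta>] by (simp add: par_def)
  then show ?thesis
    using form_swap[OF par_cases par_cases root_vector_part[OF \<beta>] root_vector_part[OF neg_root(1)[OF \<beta>]]]
    by (simp only:)
qed

lemma root_bracket_h:
  assumes \<beta>: "\<beta> \<in> roots"
  shows "brk X (E \<beta>) (E (- \<beta>)) \<in> h"
proof -
  have "brk X (E \<beta>) (E (- \<beta>)) \<in> weight_space X h (\<beta> + - \<beta>)"
    using h_even by (intro brk_weight_space root_vector \<beta> neg_root) auto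
  then show ?thesis by (simp add: zero_weight_space)
qed

text \<open>Invariance gives b([E_\<beta>, E_-\<beta>], v) = b(E_\<beta>, [E_-\<beta>, v]) =
  \<beta>(v) b(E_\<beta>, E_-\<beta>) for v in a, and the form is non-degenerate on a.\<close>

lemma root_bracket_a_proj:
  assumes \<beta>: "\<beta> \<in> roots"
  shows "a_proj (brk X (E \<beta>) (E (- \<beta>))) =
    cscale (b (E \<beta>) (E (- \<beta>))) (dual_vector a b (res \<beta>))" (is "a_proj ?z = cscale ?c ?t")
proof -
  note t = dual_vector[OF res_dual[OF \<beta>]]
  note wh = root_vector_whole[OF \<beta>] root_vector_whole[OF neg_root(1)[OF \<beta>]]
  have z: "?z \<in> h" by (rule root_bracket_h[OF \<beta>])
  have ct: "cscale ?c ?t \<in> a" using t cmat.subspace_scale[OF a_subspace] by blast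
  have "b (a_proj ?z - cscale ?c ?t) v = 0" if v: "v \<in> a" for v
  proof -
    have "brk X v (E (- \<beta>)) = cscale (- \<beta> v) (E (- \<beta>))"
      using weight_space_brk[OF root_vector[OF neg_root(1)[OF \<beta>]] a_h[OF v]] by simp
    then have "brk X (E (- \<beta>)) v = cscale (\<beta> v) (E (- \<beta>))"
      using brk_swap_even[OF h_even[OF a_h[OF v]] wh(2)]
      by (metis cmat.scale_minus_left minus_minus)
    then have "b ?z v = \<beta> v * ?c"
      using form_brk[OF wh a_whole[OF v]] by (simp add: form_scale wh)
    moreover have "b (cscale ?c ?t) v = ?c * \<beta> v"
      using t v by (simp add: form_scale a_whole res_def)
    ultimately show ?thesis
      using form_a_proj[OF z v] a_proj_mem[OF z] ct v by (simp add: form_diff_left a_whole)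
  qed
  moreover have "a_proj ?z - cscale ?c ?t \<in> a"
    by (rule cmat.subspace_diff[OF a_subspace a_proj_mem[OF z] ct])
  ultimately have "a_proj ?z - cscale ?c ?t = 0"
    using form_nondeg_a unfolding nondegenerate_on_def by blast
  then show ?thesis by simp
qed

lemma invol_root_uminus: "invol_root (- \<beta>) = - invol_root \<beta>"
  by (simp add: invol_root_def fun_eq_iff)

lemma invol_root_invol_root: "\<beta> \<in> roots \<Longrightarrow> invol_root (invol_root \<beta>) = \<beta>"
  using roots_dual[of \<beta>] by (auto simp: invol_root_def fun_eq_iff invol_invol invol_h h_whole dual_space_def)

lemma res_neg_invol_root:
  assumes \<beta>: "\<beta> \<in> roots"
  shows "res (- invol_root \<beta>) = res \<beta>"
proof
  fix u
  have "\<beta> (- u) = - \<beta> u" if "u \<in> a"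
  proof -
    have "\<beta> (cscale (-1) u) = -1 * \<beta> u"
      using roots_dual[OF \<beta>] a_h[OF that] unfolding dual_space_def by blast
    then show ?thesis by simp
  qed
  then show "res (- invol_root \<beta>) u = res \<beta> u"
    using a_pp[of u] a_h[of u] by (simp add: res_def invol_root_def pp_def)
qed

text \<open>The terms of \<open>\<beta>\<close> and \<open>-\<theta>\<beta>\<close>, which have the same restriction to a, cancel.\<close>

lemma sum_brk_invol_zero:
  "(\<Sum>\<beta>\<in>{\<beta> \<in> roots. res \<beta> = \<alpha>}.
     cscale (1 / b (E (- \<beta>)) (E \<beta>)) (brk X (invol X (E \<beta>)) (E (- \<beta>)))) = 0"
  (is "sum ?T ?S = 0")
proof -
  let ?\<tau> = "\<lambda>\<beta>. - invol_root \<beta>"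
  have \<tau>: "?\<tau> \<beta> \<in> roots" "?\<tau> (?\<tau> \<beta>) = \<beta>" "res (?\<tau> \<beta>) = res \<beta>" if "\<beta> \<in> roots" for \<beta>
    using that neg_root(1) invol_root_roots invol_root_invol_root res_neg_invol_root
    by (simp_all add: invol_root_uminus)
  \<comment> \<open>With \<gamma> = \<theta>\<beta>, the term of \<beta> is a multiple of
    [E_\<gamma>, E_-\<beta>] and that of -\<gamma> a multiple of [E_-\<beta>, E_\<gamma>], so only
    the constants have to be compared. A root with -\<theta>\<beta> = \<beta> is included: its term
    equals its own negative.\<close>
  have anti: "?T (?\<tau> \<beta>) = - ?T \<beta>" if \<beta>: "\<beta> \<in> roots" for \<beta>
  proof -
    define \<gamma> where "\<gamma> = invol_root \<beta>"
    have \<gamma>: "\<gamma> \<in> roots" unfolding \<gamma>_def by (rule invol_root_roots[OF \<beta>])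
    have \<gamma>\<beta>: "invol_root (- \<gamma>) = - \<beta>"
      by (simp add: invol_root_uminus \<gamma>_def invol_root_invol_root \<beta>)
    obtain c where c: "invol X (E \<beta>) = cscale c (E \<gamma>)" "par \<gamma> = par \<beta>"
      using invol_root_vectorE[OF \<beta>] unfolding \<gamma>_def by blast
    obtain d where d: "invol X (E (- \<gamma>)) = cscale d (E (- \<beta>))"
      using invol_root_vectorE[OF neg_root(1)[OF \<gamma>]] unfolding \<gamma>\<beta> by blast
    note wh = root_vector_whole[OF \<beta>] root_vector_whole[OF neg_root(1)[OF \<beta>]]
      root_vector_whole[OF \<gamma>] root_vector_whole[OF neg_root(1)[OF \<gamma>]]
    let ?e = "(-1) ^ par \<beta> :: complex"
    let ?n = "b (E (- \<beta>)) (E \<beta>)" and ?m = "b (E \<gamma>) (E (- \<gamma>))"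
    let ?w = "brk X (E \<gamma>) (E (- \<beta>))"
    have ee: "?e * ?e = 1" by (simp add: par_def)
    have n: "?n \<noteq> 0" by (rule neg_root(2)[OF \<beta>])
    have m_eq: "?m = ?e * b (E (- \<gamma>)) (E \<gamma>)"
      using par_swap_sign[OF \<gamma>] c(2) by simp
    have m: "?m \<noteq> 0" using m_eq neg_root(2)[OF \<gamma>] by simp
    \<comment> \<open>The constants c and d depend on the choice of root vectors;
      \<theta>-invariance of the form ties them together.\<close>
    have "d * ?n = b (invol X (E (- \<gamma>))) (E \<beta>)"
      by (simp add: d form_scale wh)
    also have "\<dots> = b (invol X (invol X (E (- \<gamma>)))) (invol X (E \<beta>))"
      using form_invol wh(1) invol_whole[OF wh(4)] by simp
    also have "\<dots> = c * b (E (- \<gamma>)) (E \<gamma>)"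
      by (simp add: invol_invol c form_scale wh)
    finally have dn: "d * ?n = c * b (E (- \<gamma>)) (E \<gamma>)" .
    have "par (- \<beta>) * par \<gamma> = par \<beta>"
      using neg_root(3)[OF \<beta>] c(2) by (simp add: par_def split: if_splits)
    then have swap: "brk X (E (- \<beta>)) (E \<gamma>) = cscale (- ?e) ?w"
      using brk_swap[OF par_cases par_cases root_vector_part[OF neg_root(1)[OF \<beta>]]
          root_vector_part[OF \<gamma>]] by simp
    have "?T (- \<gamma>) = cscale (- (d * ?e / ?m)) ?w"
      by (simp add: d brk_scale_left swap mult.commute)
    moreover have "?T \<beta> = cscale (c / ?n) ?w"
      by (simp add: c brk_scale_left)
    moreover have "d * ?e / ?m = c / ?n"
    proof -
      have "d * ?e * ?n = ?e * (c * b (E (- \<gamma>)) (E \<gamma>))"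
        using dn by (simp add: mult_ac)
      also have "\<dots> = c * ?m" by (simp add: m_eq)
      finally show ?thesis using n m by (simp add: frac_eq_eq)
    qed
    ultimately show ?thesis by (simp add: \<gamma>_def)
  qed
  have "sum ?T ?S = (\<Sum>\<beta>\<in>?S. ?T (?\<tau> \<beta>))"
    by (rule sum.reindex_bij_witness[where i = ?\<tau> and j = ?\<tau>]) (use \<tau> in auto)
  also have "\<dots> = (\<Sum>\<beta>\<in>?S. - ?T \<beta>)"
    using anti by (intro sum.cong) auto
  also have "\<dots> = - sum ?T ?S" by (rule sum_negf)
  finally show ?thesis by (simp add: fun_eq_iff)
qed

lemma root_vector_restricted: "\<beta> \<in> roots \<Longrightarrow> E \<beta> \<in> weight_space X a (res \<beta>)"
  using root_vector[of \<beta>] a_h by (simp add: weight_space_def res_def)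

text \<open>In the decomposition of x along h and the root lines, ad v - \<alpha> v multiplies the
  h-part by -\<alpha> v and the \<beta>-part by \<beta> v - \<alpha> v. As it kills x, independence
  of weights leaves only the roots that restrict to \<alpha>; comparing parities then selects those
  of parity s.\<close>

lemma restricted_weight_space:
  assumes \<alpha>: "\<alpha> \<in> dual_space a" "\<alpha> \<noteq> 0" and s: "s \<in> {0,1}"
  shows "weight_space X a \<alpha> \<inter> part X s = cmat.span (E ` {\<beta> \<in> roots. res \<beta> = \<alpha> \<and> par \<beta> = s})"
    (is "?L = cmat.span ?B")
proof
  show "cmat.span ?B \<subseteq> ?L"
    using root_vector_restricted root_vector_part
    by (intro cmat.span_minimal cmat.subspace_inter subspace_weight_space subspace_part[OF s]) auto
  show "?L \<subseteq> cmat.span ?B"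
  proof
    fix x assume x: "x \<in> ?L"
    then have "x \<in> whole X" using weight_space_whole by blast
    then obtain u c where uc: "u \<in> h" "x = u + (\<Sum>\<beta>\<in>roots. cscale (c \<beta>) (E \<beta>))"
      by (rule root_decomposition)
    have coeff: "cscale (\<alpha> v) u = 0 \<and> (\<forall>\<beta>\<in>roots. (\<beta> v - \<alpha> v) * c \<beta> = 0)" if v: "v \<in> a" for v
    proof -
      \<comment> \<open>The h-part enters as the vector of weight 0, which is not a root, so that a
        single family indexed by weights suffices.\<close>
      define w where "w \<beta> = (if \<beta> = 0 then cscale (- \<alpha> v) u
        else cscale ((\<beta> v - \<alpha> v) * c \<beta>) (E \<beta>))" for \<beta>
      have nz: "0 \<notin> roots" by (simp add: nonzero_weights_def)
      have "brk X v x = (\<Sum>\<beta>\<in>roots. cscale (\<beta> v * c \<beta>) (E \<beta>))"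
        unfolding uc(2) brk_add_right linear_map_sum[OF brk_linear_right] brk_scale_right
        using h_commute[OF a_h[OF v] uc(1)] weight_space_brk[OF root_vector a_h[OF v]]
        by (simp add: mult.commute)
      moreover have "brk X v x = cscale (\<alpha> v) x"
        using x v by (simp add: weight_space_def)
      ultimately have "(\<Sum>\<beta>\<in>roots. cscale (\<beta> v * c \<beta>) (E \<beta>)) - cscale (\<alpha> v) x = 0" by simp
      then have "(\<Sum>\<beta>\<in>roots. cscale ((\<beta> v - \<alpha> v) * c \<beta>) (E \<beta>)) + cscale (- \<alpha> v) u = 0"
        unfolding uc(2) left_diff_distrib cmat.scale_left_diff_distrib sum_subtractf
          cmat.scale_right_distrib cmat.scale_sum_right cmat.scale_scale
        by (simp add: algebra_simps)
      moreover have "(\<Sum>\<beta>\<in>roots. w \<beta>) = (\<Sum>\<beta>\<in>roots. cscale ((\<beta> v - \<alpha> v) * c \<beta>) (E \<beta>))"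
        using nz by (intro sum.cong) (auto simp: w_def)
      ultimately have zero: "(\<Sum>\<beta>\<in>insert 0 roots. w \<beta>) = 0"
        using finite_roots nz by (simp add: w_def[of 0] add.commute)
      have wt: "w \<beta> \<in> weight_space X h \<beta>" if "\<beta> \<in> insert 0 roots" for \<beta>
        using that uc(1) cmat.subspace_scale[OF subspace_weight_space root_vector]
        by (auto simp: w_def zero_weight_space scale_h simp del: cmat.scale_minus_left)
      have dual: "insert 0 roots \<subseteq> dual_space h" using roots_dual zero_dual_space by blast
      have w0: "w \<beta> = 0" if "\<beta> \<in> insert 0 roots" for \<beta>
        by (rule weight_vectors_independent[OF _ dual wt zero that]) (simp_all add: finite_roots)
      have "(\<beta> v - \<alpha> v) * c \<beta> = 0" if \<beta>: "\<beta> \<in> roots" for \<beta>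
      proof -
        have "cscale ((\<beta> v - \<alpha> v) * c \<beta>) (E \<beta>) = 0"
        proof -
          have "\<beta> \<noteq> 0" using \<beta> nz by blast
          then show ?thesis using w0[of \<beta>] \<beta> by (simp add: w_def)
        qed
        then show ?thesis using root_vector_nonzero[OF \<beta>] by (simp only: cmat.scale_eq_0_iff) simp
      qed
      moreover have "cscale (\<alpha> v) u = 0" using w0[of 0] by (simp add: w_def)
      ultimately show ?thesis by blast
    qed
    obtain v where v: "v \<in> a" "\<alpha> v \<noteq> 0"
      using dual_space_neqE[OF \<alpha>(1) zero_dual_space \<alpha>(2)] by auto
    then have u0: "u = 0" using coeff[OF v(1)] by auto
    have c_res: "c \<beta> = 0" if \<beta>: "\<beta> \<in> roots" "res \<beta> \<noteq> \<alpha>" for \<beta>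
    proof -
      obtain v where "v \<in> a" "res \<beta> v \<noteq> \<alpha> v"
        using dual_space_neqE[OF res_dual[OF \<beta>(1)] \<alpha>(1) \<beta>(2)] .
      then show ?thesis using coeff[of v] \<beta>(1) by (auto simp: res_def)
    qed
    let ?O = "{\<beta> \<in> roots. par \<beta> \<noteq> s}" and ?I = "{\<beta> \<in> roots. par \<beta> = s}"
    let ?f = "\<lambda>\<beta>. cscale (c \<beta>) (E \<beta>)"
    have split: "x = sum ?f ?I + sum ?f ?O"
    proof -
      have "roots = ?I \<union> ?O" "?I \<inter> ?O = {}" by blast+
      then have "sum ?f roots = sum ?f ?I + sum ?f ?O"
        using finite_roots sum.union_disjoint[of ?I ?O ?f] by auto
      then show ?thesis using uc(2) u0 by simp
    qed
    have other: "1 - s \<in> {0,1}" "\<And>\<beta>. par \<beta> \<noteq> s \<Longrightarrow> par \<beta> = 1 - s"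
      using s by (auto simp: par_def split: if_splits)
    have "sum ?f ?O \<in> part X (1 - s)"
      using root_vector_part other(2) cmat.subspace_scale[OF subspace_part[OF other(1)]]
      by (intro cmat.subspace_sum[OF subspace_part[OF other(1)]]) (metis (mono_tags, lifting) mem_Collect_eq)
    moreover have "sum ?f ?I \<in> part X s"
      using root_vector_part cmat.subspace_scale[OF subspace_part[OF s]]
      by (intro cmat.subspace_sum[OF subspace_part[OF s]]) blast
    then have "sum ?f ?O \<in> part X s"
      using x split cmat.subspace_diff[OF subspace_part[OF s], of x "sum ?f ?I"] by simp
    ultimately have "sum ?f ?O \<in> part X 0 \<inter> part X 1" using s by auto
    then have "sum ?f ?O = 0" using part_Int by blast
    moreover have "sum ?f ?I \<in> cmat.span ?B"
    proof (rule cmat.span_sum)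
      fix \<beta> assume "\<beta> \<in> ?I"
      then show "?f \<beta> \<in> cmat.span ?B"
        using c_res[of \<beta>] cmat.span_scale[OF cmat.span_base, of "E \<beta>" ?B "c \<beta>"] cmat.span_zero
        by (cases "res \<beta> = \<alpha>") auto
    qed
    ultimately show "x \<in> cmat.span ?B" using split by simp
  qed
qed

lemma dim_restricted_weight_space:
  assumes "\<alpha> \<in> dual_space a" "\<alpha> \<noteq> 0" "s \<in> {0,1}"
  shows "cmat.dim (weight_space X a \<alpha> \<inter> part X s) = card {\<beta> \<in> roots. res \<beta> = \<alpha> \<and> par \<beta> = s}"
proof -
  let ?S = "{\<beta> \<in> roots. res \<beta> = \<alpha> \<and> par \<beta> = s}"
  have "cmat.independent (E ` ?S)"
    by (rule cmat.independent_mono[OF root_vectors_independent]) auto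
  moreover have "card (E ` ?S) = card ?S"
    by (rule card_image) (rule inj_on_subset[OF root_vectors_inj], auto)
  ultimately show ?thesis
    unfolding restricted_weight_space[OF assms] cmat.dim_span
    by (simp add: cmat.dim_eq_card_independent)
qed

lemma mult_super_eq:
  assumes "\<alpha> \<in> dual_space a" "\<alpha> \<noteq> 0"
  shows "mult_super X a \<alpha> = (\<Sum>\<beta>\<in>{\<beta> \<in> roots. res \<beta> = \<alpha>}. (-1) ^ par \<beta>)"
proof -
  let ?S = "{\<beta> \<in> roots. res \<beta> = \<alpha>}"
  let ?p = "\<lambda>s. {\<beta> \<in> roots. res \<beta> = \<alpha> \<and> par \<beta> = s}"
  have "?S = ?p 0 \<union> ?p 1" "?p 0 \<inter> ?p 1 = {}" using par_cases by auto
  then have "(\<Sum>\<beta>\<in>?S. (-1) ^ par \<beta>) = (\<Sum>\<beta>\<in>?p 0. (-1) ^ par \<beta>) + (\<Sum>\<beta>\<in>?p 1. (-1) ^ par \<beta> :: int)"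
    using finite_roots by (metis (mono_tags, lifting) finite_Collect_conjI finite_Un finite_subset
        mem_Collect_eq subsetI sum.union_disjoint)
  also have "(\<Sum>\<beta>\<in>?p 0. (-1) ^ par \<beta>) = int (card (?p 0))" by simp
  also have "(\<Sum>\<beta>\<in>?p 1. (-1) ^ par \<beta>) = - int (card (?p 1))" by simp
  finally show ?thesis
    using dim_restricted_weight_space[OF assms, of 0] dim_restricted_weight_space[OF assms, of 1]
    by (simp add: mult_super_def)
qed

lemma restricted_roots: "nonzero_weights X a = res ` {\<beta> \<in> roots. res \<beta> \<noteq> 0}"
proof
  show "res ` {\<beta> \<in> roots. res \<beta> \<noteq> 0} \<subseteq> nonzero_weights X a"
  proof clarify
    fix \<beta> assume "\<beta> \<in> roots" "res \<beta> \<noteq> 0"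
    then show "res \<beta> \<in> nonzero_weights X a"
      using res_dual[of \<beta>] root_vector_restricted[of \<beta>] root_vector_nonzero[of \<beta>]
      unfolding nonzero_weights_def by blast
  qed
  show "nonzero_weights X a \<subseteq> res ` {\<beta> \<in> roots. res \<beta> \<noteq> 0}"
  proof
    fix \<alpha> assume \<alpha>: "\<alpha> \<in> nonzero_weights X a"
    then have \<alpha>': "\<alpha> \<in> dual_space a" "\<alpha> \<noteq> 0" by (auto simp: nonzero_weights_def)
    obtain x where x: "x \<in> weight_space X a \<alpha>" "x \<noteq> 0"
      using \<alpha> cmat.subspace_0[OF subspace_weight_space] by (auto simp: nonzero_weights_def)
    obtain x0 x1 where x01: "x = x0 + x1" "x0 \<in> part X 0" "x1 \<in> part X 1"
      using weight_space_whole[OF x(1)] by (rule wholeE)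
    have a_even: "a \<subseteq> part X 0" using a_h h_even by blast
    have w: "x0 \<in> weight_space X a \<alpha>" "x1 \<in> weight_space X a \<alpha>"
      using weight_space_graded[OF a_even, of x0 x1 \<alpha>] x x01 by simp_all
    show "\<alpha> \<in> res ` {\<beta> \<in> roots. res \<beta> \<noteq> 0}"
    proof (rule ccontr)
      assume none: "\<alpha> \<notin> res ` {\<beta> \<in> roots. res \<beta> \<noteq> 0}"
      then have none: "{\<beta> \<in> roots. res \<beta> = \<alpha> \<and> par \<beta> = s} = {}" for s using \<alpha>'(2) by blast
      have "weight_space X a \<alpha> \<inter> part X s = {0}" if "s \<in> {0,1}" for s
        unfolding restricted_weight_space[OF \<alpha>' that] none by simp
      then have "x0 = 0" "x1 = 0" using w x01 by blast+
      then show False using x(2) x01(1) by simp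
    qed
  qed
qed

end

section \<open>Functionals on the enveloping algebra\<close>

lemma free_ring_simps [simp]:
  "monoid.mult (free_ring G) = (*)" "one (free_ring G) = 1"
  "zero (free_ring G) = 0" "add (free_ring G) = (+)"
  by (simp_all add: free_ring_def)

lemma free_carrier_iff:
  "t \<in> carrier (free_ring G) \<longleftrightarrow> (\<forall>w\<in>Poly_Mapping.keys t. set (letters w) \<subseteq> whole G)"
  by (simp add: free_ring_def)

lemma free_carrier_zero: "0 \<in> carrier (free_ring G)"
  by (simp add: free_carrier_iff)

lemma free_carrier_single: "set (letters w) \<subseteq> whole G \<Longrightarrow> Poly_Mapping.single w c \<in> carrier (free_ring G)"
  by (simp add: free_carrier_iff)

lemma free_carrier_one: "1 \<in> carrier (free_ring G)"
  using free_carrier_single[of 0 G 1] unfolding single_one by (simp add: zero_word_def)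

lemma free_carrier_gen: "x \<in> whole G \<Longrightarrow> gen x \<in> carrier (free_ring G)"
  unfolding gen_def by (rule free_carrier_single) simp

lemma free_carrier_scal: "scal c \<in> carrier (free_ring G)"
  unfolding scal_def by (rule free_carrier_single) (simp add: zero_word_def)

lemma free_carrier_add:
  "s \<in> carrier (free_ring G) \<Longrightarrow> t \<in> carrier (free_ring G) \<Longrightarrow> s + t \<in> carrier (free_ring G)"
  using Poly_Mapping.keys_add[of s t] unfolding free_carrier_iff by blast

lemma free_carrier_uminus: "s \<in> carrier (free_ring G) \<Longrightarrow> - s \<in> carrier (free_ring G)"
  by (simp add: free_carrier_iff)

lemma free_carrier_diff:
  "s \<in> carrier (free_ring G) \<Longrightarrow> t \<in> carrier (free_ring G) \<Longrightarrow> s - t \<in> carrier (free_ring G)"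
  using free_carrier_add[of s G "- t"] free_carrier_uminus[of t G] by simp

lemma free_carrier_mult:
  assumes "s \<in> carrier (free_ring G)" "t \<in> carrier (free_ring G)"
  shows "s * t \<in> carrier (free_ring G)"
  unfolding free_carrier_iff
proof
  fix w assume "w \<in> Poly_Mapping.keys (s * t)"
  then obtain u v where "w = u + v" "u \<in> Poly_Mapping.keys s" "v \<in> Poly_Mapping.keys t"
    using keys_mult[of s t] by blast
  then show "set (letters w) \<subseteq> whole G"
    using assms by (auto simp: free_carrier_iff plus_word_def)
qed

lemma free_carrier_power: "s \<in> carrier (free_ring G) \<Longrightarrow> s ^ n \<in> carrier (free_ring G)"
  by (induction n) (simp_all add: free_carrier_one free_carrier_mult)

lemma free_carrier_prod_list:
  "(\<And>s. s \<in> set l \<Longrightarrow> s \<in> carrier (free_ring G)) \<Longrightarrow> prod_list l \<in> carrier (free_ring G)"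
  by (induction l) (simp_all add: free_carrier_one free_carrier_mult)

lemma free_carrier_sum:
  "(\<And>i. i \<in> I \<Longrightarrow> f i \<in> carrier (free_ring G)) \<Longrightarrow> sum f I \<in> carrier (free_ring G)"
  by (induction I rule: infinite_finite_induct) (simp_all add: free_carrier_zero free_carrier_add)

lemmas free_carrier = free_carrier_zero free_carrier_one free_carrier_gen free_carrier_scal
  free_carrier_add free_carrier_uminus free_carrier_diff free_carrier_mult free_carrier_power
  free_carrier_prod_list free_carrier_sum

lemma ring_free_ring: "ring (free_ring G)"
proof (rule ringI)
  show "abelian_group (free_ring G)"
    by (rule abelian_groupI)
       (auto simp: free_carrier add_ac intro!: bexI[of _ "- x" for x])
  show "Group.monoid (free_ring G)"
    by (rule monoidI) (simp_all add: free_carrier mult.assoc)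
qed (simp_all add: algebra_simps)

lemma scal_commute: "scal c * t = t * scal c"
proof (induction t rule: Poly_Mapping.update_induct)
  case (update f w k)
  have "Poly_Mapping.update w k f = f + Poly_Mapping.single w k"
    using update(1) by (intro poly_mapping_eqI)
      (auto simp: lookup_update lookup_add lookup_single in_keys_iff when_def)
  moreover have "scal c * Poly_Mapping.single w k = Poly_Mapping.single w k * scal c"
    by (simp add: scal_def mult_single mult.commute)
  ultimately show ?case using update(3) by (simp add: distrib_left distrib_right)
qed simp

text \<open>A linear functional on the enveloping algebra, pulled back to the free algebra.
  Vanishing is demanded for relations between arbitrary factors, hence on the two-sided ideal that
  they generate.\<close>

locale uea_functional = sym_superpair X for X :: "'a sym_pair_scheme" +
  fixes F :: "free_alg \<Rightarrow> complex"
  assumes F_add: "\<lbrakk>s \<in> carrier (free_ring X); t \<in> carrier (free_ring X)\<rbrakk> \<Longrightarrow> F (s + t) = F s + F t"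
    and F_scal: "t \<in> carrier (free_ring X) \<Longrightarrow> F (scal c * t) = c * F t"
    and F_relation: "\<lbrakk>u \<in> carrier (free_ring X); v \<in> carrier (free_ring X); r \<in> env_relations X\<rbrakk>
      \<Longrightarrow> F (u * r * v) = 0"
begin

lemma F_zero: "F 0 = 0"
  using F_add[of 0 0] by (simp add: free_carrier)

lemma F_uminus: "t \<in> carrier (free_ring X) \<Longrightarrow> F (- t) = - F t"
  using F_add[of t "- t"] by (simp add: free_carrier F_zero add_eq_0_iff)

lemma F_diff:
  "s \<in> carrier (free_ring X) \<Longrightarrow> t \<in> carrier (free_ring X) \<Longrightarrow> F (s - t) = F s - F t"
  using F_add[of s "- t"] by (simp add: free_carrier F_uminus)

lemma F_scal_inner:
  assumes "u \<in> carrier (free_ring X)" "v \<in> carrier (free_ring X)"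
  shows "F (u * (scal c * v)) = c * F (u * v)"
proof -
  have "u * (scal c * v) = scal c * (u * v)"
    by (simp add: scal_commute[of c u] mult.assoc[symmetric])
  then show ?thesis using assms by (simp add: F_scal free_carrier)
qed

lemma F_gen_add:
  assumes "u \<in> carrier (free_ring X)" "v \<in> carrier (free_ring X)" "x \<in> whole X" "y \<in> whole X"
  shows "F (u * gen (x + y) * v) = F (u * gen x * v) + F (u * gen y * v)"
proof -
  have "gen (x + y) - gen x - gen y \<in> env_relations X"
    using assms(3,4) unfolding env_relations_def by blast
  then have "F (u * (gen (x + y) - gen x - gen y) * v) = 0"
    by (rule F_relation[OF assms(1,2)])
  moreover have "u * (gen (x + y) - gen x - gen y) * v =
      u * gen (x + y) * v - u * gen x * v - u * gen y * v"
    by (simp add: algebra_simps)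
  ultimately show ?thesis
    using assms cmat.subspace_add[OF subspace_whole assms(3,4)]
    by (simp add: F_diff free_carrier diff_eq_eq add.commute)
qed

lemma F_gen_scale:
  assumes "u \<in> carrier (free_ring X)" "v \<in> carrier (free_ring X)" "x \<in> whole X"
  shows "F (u * gen (cscale c x) * v) = c * F (u * gen x * v)"
proof -
  have "gen (cscale c x) - scal c * gen x \<in> env_relations X"
    using assms(3) unfolding env_relations_def by blast
  then have "F (u * (gen (cscale c x) - scal c * gen x) * v) = 0"
    by (rule F_relation[OF assms(1,2)])
  moreover have "u * (gen (cscale c x) - scal c * gen x) * v =
      u * gen (cscale c x) * v - u * (scal c * (gen x * v))"
    by (simp add: algebra_simps)
  ultimately show ?thesis
    using assms cmat.subspace_scale[OF subspace_whole assms(3)]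
    by (simp add: F_diff F_scal_inner free_carrier mult.assoc)
qed

lemma F_swap:
  assumes "u \<in> carrier (free_ring X)" "v \<in> carrier (free_ring X)"
    and st: "s \<in> {0,1}" "t \<in> {0,1}" "x \<in> part X s" "y \<in> part X t"
  shows "F (u * (gen x * gen y) * v) =
    (-1) ^ (s * t) * F (u * (gen y * gen x) * v) + F (u * gen (brk X x y) * v)"
proof -
  have xy: "x \<in> whole X" "y \<in> whole X" using st part_whole by blast+
  have "gen x * gen y - scal ((-1) ^ (s * t)) * (gen y * gen x) - gen (brk X x y) \<in> env_relations X"
    using st unfolding env_relations_def by blast
  then have "F (u * (gen x * gen y - scal ((-1) ^ (s * t)) * (gen y * gen x) - gen (brk X x y)) * v) = 0"
    by (rule F_relation[OF assms(1,2)])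
  moreover have "u * (gen x * gen y - scal ((-1) ^ (s * t)) * (gen y * gen x) - gen (brk X x y)) * v =
      u * (gen x * gen y) * v - u * (scal ((-1) ^ (s * t)) * (gen y * gen x * v)) - u * gen (brk X x y) * v"
    by (simp add: algebra_simps)
  ultimately show ?thesis
    using assms(1,2) xy brk_whole[OF xy]
    by (simp add: F_diff F_scal_inner free_carrier mult.assoc diff_eq_eq add.commute)
qed

lemma F_gen_zero:
  assumes "u \<in> carrier (free_ring X)" "v \<in> carrier (free_ring X)"
  shows "F (u * gen 0 * v) = 0"
  using F_gen_scale[OF assms cmat.subspace_0[OF subspace_whole], of 0] by simp

text \<open>Commutation takes place in the quotient and is observed only through F. Demanding it
  between arbitrary factors u and v makes the set closed under products, so that whole monomials can
  be moved past \<open>gen y\<close>.\<close>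

definition commutes_with :: "cmat \<Rightarrow> free_alg set" where
  "commutes_with y = {t \<in> carrier (free_ring X). \<forall>u\<in>carrier (free_ring X). \<forall>v\<in>carrier (free_ring X).
     F (u * (t * gen y) * v) = F (u * (gen y * t) * v)}"

lemma commutes_withD:
  "t \<in> commutes_with y \<Longrightarrow> u \<in> carrier (free_ring X) \<Longrightarrow> v \<in> carrier (free_ring X)
    \<Longrightarrow> F (u * (t * gen y) * v) = F (u * (gen y * t) * v)"
  "t \<in> commutes_with y \<Longrightarrow> t \<in> carrier (free_ring X)"
  by (auto simp: commutes_with_def)

lemma commutes_with_one: "1 \<in> commutes_with y"
  by (simp add: commutes_with_def free_carrier)

lemma commutes_with_mult:
  assumes "s \<in> commutes_with y" "t \<in> commutes_with y"
  shows "s * t \<in> commutes_with y"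
proof -
  have "F (u * (s * t * gen y) * v) = F (u * (gen y * (s * t)) * v)"
    if "u \<in> carrier (free_ring X)" "v \<in> carrier (free_ring X)" for u v
  proof -
    have "F (u * (s * t * gen y) * v) = F ((u * s) * (t * gen y) * v)"
      by (simp add: mult.assoc)
    also have "\<dots> = F ((u * s) * (gen y * t) * v)"
      using assms that by (intro commutes_withD(1)) (simp_all add: commutes_withD free_carrier)
    also have "\<dots> = F (u * (s * gen y) * (t * v))"
      by (simp add: mult.assoc)
    also have "\<dots> = F (u * (gen y * s) * (t * v))"
      using assms that by (intro commutes_withD(1)) (simp_all add: commutes_withD free_carrier)
    finally show ?thesis by (simp add: mult.assoc)
  qed
  then show ?thesis
    using assms by (simp add: commutes_with_def free_carrier_mult)
qed

lemma commutes_with_power: "s \<in> commutes_with y \<Longrightarrow> s ^ n \<in> commutes_with y"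
  by (induction n) (simp_all add: commutes_with_one commutes_with_mult)

lemma commutes_with_prod_list:
  "(\<And>s. s \<in> set l \<Longrightarrow> s \<in> commutes_with y) \<Longrightarrow> prod_list l \<in> commutes_with y"
  by (induction l) (simp_all add: commutes_with_one commutes_with_mult)

lemma commutes_with_gen:
  assumes "x \<in> part X 0" "y \<in> part X 0" "brk X x y = 0"
  shows "gen x \<in> commutes_with y"
proof -
  have "x \<in> whole X" using assms(1) part_whole by blast
  then show ?thesis
    using F_swap[of _ _ 0 0 x y] assms
    by (simp add: commutes_with_def free_carrier F_gen_zero)
qed

end

section \<open>From functionals on the enveloping algebra to functionals on the free algebra\<close>

context sym_superpair
begin

lemma env_relations_carrier: "env_relations X \<subseteq> carrier (free_ring X)"
proof -
  have "gen (x + y) - gen x - gen y \<in> carrier (free_ring X)" if "x \<in> whole X" "y \<in> whole X" for x y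
    using that cmat.subspace_add[OF subspace_whole that] by (simp add: free_carrier)
  moreover have "gen (cscale c x) - scal c * gen x \<in> carrier (free_ring X)" if "x \<in> whole X" for c x
    using that cmat.subspace_scale[OF subspace_whole that] by (simp add: free_carrier)
  moreover have "gen x * gen y - scal ((-1) ^ (s * t)) * (gen y * gen x) - gen (brk X x y)
      \<in> carrier (free_ring X)"
    if "s \<in> {0,1}" "t \<in> {0,1}" "x \<in> part X s" "y \<in> part X t" for x y s t
    using part_whole[OF that(1,3)] part_whole[OF that(2,4)] brk_whole by (simp add: free_carrier)
  ultimately show ?thesis unfolding env_relations_def by blast
qed

lemma ideal_env_ideal: "ideal (env_ideal X) (free_ring X)"
  unfolding env_ideal_def by (rule ring.genideal_ideal[OF ring_free_ring env_relations_carrier])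

lemma env_class_carrier: "t \<in> carrier (free_ring X) \<Longrightarrow> env_class X t \<in> carrier (UEA X)"
proof -
  interpret ideal "env_ideal X" "free_ring X" by (rule ideal_env_ideal)
  show "t \<in> carrier (free_ring X) \<Longrightarrow> env_class X t \<in> carrier (UEA X)"
    unfolding UEA_def env_class_def FactRing_def using a_rcosetsI[OF a_subset] by simp
qed

lemma env_class_mult:
  assumes "s \<in> carrier (free_ring X)" "t \<in> carrier (free_ring X)"
  shows "env_class X s \<otimes>\<^bsub>UEA X\<^esub> env_class X t = env_class X (s * t)"
proof -
  interpret ideal "env_ideal X" "free_ring X" by (rule ideal_env_ideal)
  show ?thesis
    using rcoset_mult_add[OF assms] by (simp add: UEA_def env_class_def FactRing_def)
qed

lemma env_class_add:
  assumes "s \<in> carrier (free_ring X)" "t \<in> carrier (free_ring X)"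
  shows "env_class X s \<oplus>\<^bsub>UEA X\<^esub> env_class X t = env_class X (s + t)"
proof -
  interpret ideal "env_ideal X" "free_ring X" by (rule ideal_env_ideal)
  show ?thesis
    using a_rcos_sum[OF assms] by (simp add: UEA_def env_class_def FactRing_def)
qed

lemma env_class_relation:
  assumes "u \<in> carrier (free_ring X)" "v \<in> carrier (free_ring X)" "r \<in> env_relations X"
  shows "env_class X (u * r * v) = env_class X 0"
proof -
  interpret ideal "env_ideal X" "free_ring X" by (rule ideal_env_ideal)
  have "r \<in> env_ideal X"
    unfolding env_ideal_def using ring.genideal_self[OF ring_free_ring env_relations_carrier] assms(3)
    by blast
  then have "u * r * v \<in> env_ideal X"
    using I_l_closed I_r_closed assms(1,2) by auto
  moreover have "0 \<in> env_ideal X" using additive_subgroup.zero_closed[OF additive_subgroup_axioms] by simp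
  ultimately show ?thesis
    unfolding env_class_def using a_rcos_const by metis
qed

lemma uea_functional_of_dual:
  assumes f: "f \<in> uea_dual X"
  shows "uea_functional X (\<lambda>t. f (env_class X t))"
proof
  have add: "f (u \<oplus>\<^bsub>UEA X\<^esub> v) = f u + f v" if "u \<in> carrier (UEA X)" "v \<in> carrier (UEA X)" for u v
    using f that by (simp add: uea_dual_def)
  show f_add: "f (env_class X (s + t)) = f (env_class X s) + f (env_class X t)"
    if "s \<in> carrier (free_ring X)" "t \<in> carrier (free_ring X)" for s t
    using add[OF env_class_carrier env_class_carrier] that by (simp add: env_class_add)
  show "f (env_class X (scal c * t)) = c * f (env_class X t)" if "t \<in> carrier (free_ring X)" for c t
  proof -
    have "f (env_class X (scal c) \<otimes>\<^bsub>UEA X\<^esub> env_class X t) = c * f (env_class X t)"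
      using f env_class_carrier[OF that] unfolding uea_dual_def by blast
    then show ?thesis
      by (simp only: env_class_mult[OF free_carrier_scal that])
  qed
  show "f (env_class X (u * r * v)) = 0"
    if "u \<in> carrier (free_ring X)" "v \<in> carrier (free_ring X)" "r \<in> env_relations X" for u v r
    using f_add[of 0 0] that by (simp add: env_class_relation free_carrier)
qed

end

section \<open>Power series\<close>

lemma mcoeff_simps [simp]:
  "mcoeff 0 M = 0" "mcoeff (f + g) M = mcoeff f M + mcoeff g M"
  "mcoeff (- f) M = - mcoeff f M" "mcoeff (f - g) M = mcoeff f M - mcoeff g M"
  "mcoeff 1 M = (if M = {#} then 1 else 0)"
  "mcoeff (mconst c) M = (if M = {#} then c else 0)"
  "mcoeff (mpartial i f) M = of_nat (count M i + 1) * mcoeff f (add_mset i M)"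
  by (simp_all add: zero_mfps.rep_eq plus_mfps.rep_eq uminus_mfps.rep_eq minus_mfps.rep_eq
      one_mfps.rep_eq mconst.rep_eq mpartial.rep_eq)

lemma mcoeff_mult_empty [simp]: "mcoeff (f * g) {#} = mcoeff f {#} * mcoeff g {#}"
  by (simp add: times_mfps.rep_eq)

lemma mcoeff_mconst_mult [simp]: "mcoeff (mconst c * f) M = c * mcoeff f M"
proof -
  have "mcoeff (mconst c * f) M = (\<Sum>A\<in>{A. A \<subseteq># M}. if A = {#} then c * mcoeff f (M - A) else 0)"
    unfolding times_mfps.rep_eq by (rule sum.cong) auto
  then show ?thesis by (simp add: sum.delta finite_sub_mset)
qed

lemma mconst_hom:
  "mconst 0 = 0" "mconst 1 = 1" "mconst (c + d) = mconst c + mconst d"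
  "mconst (c * d) = mconst c * mconst d" "mconst (- c) = - mconst c"
  by (rule mfps_eqI; simp)+

lemma mconst_sum: "mconst (\<Sum>i\<in>I. c i) = (\<Sum>i\<in>I. mconst (c i))"
  by (induction I rule: infinite_finite_induct) (simp_all add: mconst_hom)

lemma mpartial_add: "mpartial i (f + g) = mpartial i f + mpartial i g"
  by (rule mfps_eqI) (simp add: algebra_simps)

lemma mpartial_zero: "mpartial i 0 = 0" "mpartial i (mconst c) = 0" "mpartial i 1 = 0"
  by (rule mfps_eqI; simp)+

text \<open>Every nonempty monomial is hit by the derivative in one of its variables, with a factor
  that is nonzero in characteristic 0.\<close>

lemma eq_mconst_of_mpartial_zero:
  assumes "\<And>i. mpartial i f = 0"
  shows "f = mconst (mcoeff f {#})"
proof (rule mfps_eqI)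
  fix M
  show "mcoeff f M = mcoeff (mconst (mcoeff f {#})) M"
  proof (cases M)
    case (add i N)
    have "of_nat (count N i + 1) * mcoeff f M = mcoeff (mpartial i f) N"
      by (simp add: add)
    also have "\<dots> = 0" by (simp add: assms)
    finally show ?thesis using add by (simp del: of_nat_add of_nat_Suc)
  qed simp
qed

text \<open>Only the factor with index i changes. The identity is cross-multiplied because
  \<open>g i (count M i)\<close> may be zero.\<close>

lemma prod_count_add_mset:
  fixes i n :: nat
  assumes "i < n"
  shows "(\<Prod>k<n. g k (count (add_mset i M) k)) * g i (count M i) =
    (\<Prod>k<n. g k (count M k)) * (g i (count M i + 1) :: complex)"
proof -
  have "(\<Prod>k<n. g k (count N k)) = g i (count N i) * (\<Prod>k\<in>{..<n} - {i}. g k (count N k))" for N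
    using assms by (intro prod.remove) auto
  moreover have "(\<Prod>k\<in>{..<n} - {i}. g k (count (add_mset i M) k)) =
      (\<Prod>k\<in>{..<n} - {i}. g k (count M k))"
    by (rule prod.cong) auto
  moreover have "count (add_mset i M) i = count M i + 1" by simp
  ultimately show ?thesis by (simp only: mult_ac)
qed

lemma mpartial_mexp:
  "mpartial i (mexp es \<phi>) = (if i < length es then mconst (\<phi> (es ! i)) * mexp es \<phi> else 0)"
proof (rule mfps_eqI)
  fix M
  let ?n = "length es" and ?g = "\<lambda>k c. \<phi> (es ! k) ^ c / fact c"
  show "mcoeff (mpartial i (mexp es \<phi>)) M =
      mcoeff (if i < ?n then mconst (\<phi> (es ! i)) * mexp es \<phi> else 0) M"
  proof (cases "i < ?n \<and> set_mset M \<subseteq> {..<?n}")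
    case True
    have "(of_nat (count M i + 1) * (\<Prod>k<?n. ?g k (count (add_mset i M) k))) * ?g i (count M i) =
        of_nat (count M i + 1) * ((\<Prod>k<?n. ?g k (count M k)) * ?g i (count M i + 1))"
      using prod_count_add_mset[of i ?n ?g M] True by (simp only: mult.assoc)
    also have "\<dots> = (\<phi> (es ! i) * (\<Prod>k<?n. ?g k (count M k))) * ?g i (count M i)"
      by (simp add: field_simps del: of_nat_add of_nat_Suc)
    finally have eq: "(of_nat (count M i + 1) * (\<Prod>k<?n. ?g k (count (add_mset i M) k))) * ?g i (count M i) =
      (\<phi> (es ! i) * (\<Prod>k<?n. ?g k (count M k))) * ?g i (count M i)" .
    \<comment> \<open>If \<phi> is nonzero on \<open>es ! i\<close>, the common factor in
      \<open>eq\<close> can be cancelled. Otherwise both sides vanish, since variable i has a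
      positive exponent in \<open>add_mset i M\<close>.\<close>
    show ?thesis
    proof (cases "\<phi> (es ! i) = 0")
      case False
      then have "?g i (count M i) \<noteq> 0" by simp
      with eq have "of_nat (count M i + 1) * (\<Prod>k<?n. ?g k (count (add_mset i M) k)) =
          \<phi> (es ! i) * (\<Prod>k<?n. ?g k (count M k))"
        by (simp only: mult_cancel_right simp_thms)
      moreover have "set_mset (add_mset i M) \<subseteq> {..<?n}" using True by simp
      ultimately show ?thesis
        using True by (simp only: mcoeff_simps mcoeff_mconst_mult mexp.rep_eq if_True simp_thms)
    next
      case True
      then have "?g i (count (add_mset i M) i) = 0" by simp
      then have "(\<Prod>k<?n. ?g k (count (add_mset i M) k)) = 0"
        using True \<open>i < ?n \<and> set_mset M \<subseteq> {..<?n}\<close>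
        by (intro prod_zero bexI[of _ i]) simp_all
      then have "mcoeff (mexp es \<phi>) (add_mset i M) = 0"
        by (simp only: mexp.rep_eq if_cancel)
      then show ?thesis
        using True \<open>i < ?n \<and> set_mset M \<subseteq> {..<?n}\<close> by simp
    qed
  next
    case False
    then show ?thesis by (auto simp: mexp.rep_eq)
  qed
qed

lemma mcoeff_mexp_empty [simp]: "mcoeff (mexp es \<phi>) {#} = 1"
  by (simp add: mexp.rep_eq)

text \<open>By the product rule all partial derivatives of the product vanish, so it equals its
  constant term.\<close>

lemma mexp_minus: "mexp es \<phi> * mexp es (\<lambda>v. - \<phi> v) = 1"
proof -
  let ?f = "mexp es \<phi> * mexp es (\<lambda>v. - \<phi> v)"
  have "mpartial i ?f = 0" for i
    by (simp add: mpartial_mult mpartial_mexp mconst_hom)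
  then have "?f = mconst (mcoeff ?f {#})" by (rule eq_mconst_of_mpartial_zero)
  then show ?thesis by (simp add: mconst_hom)
qed

lemma mexp_neq_one:
  assumes i: "i < length es" "\<phi> (es ! i) \<noteq> 0"
  shows "mexp es \<phi> - 1 \<noteq> 0"
proof
  assume "mexp es \<phi> - 1 = 0"
  then have "mpartial i (mexp es \<phi>) = 0" by (simp add: mpartial_zero)
  then have "mcoeff (mconst (\<phi> (es ! i)) * mexp es \<phi>) {#} = 0"
    using i(1) by (simp only: mpartial_mexp if_True mcoeff_simps)
  then show False using i(2) by simp
qed

section \<open>The power series attached to a zonal functional\<close>

locale zonal_series = uea_functional X F for X :: "'a sym_pair_scheme" and F +
  fixes es :: "cmat list"
  assumes es_even: "i < length es \<Longrightarrow> es ! i \<in> part X 0"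
    and es_pp: "i < length es \<Longrightarrow> es ! i \<in> pp X"
    and es_commute: "i < length es \<Longrightarrow> j < length es \<Longrightarrow> brk X (es ! i) (es ! j) = 0"
    and F_kk_left: "x \<in> kk X \<Longrightarrow> u \<in> carrier (free_ring X) \<Longrightarrow> F (gen x * u) = 0"
    and F_kk_right: "x \<in> kk X \<Longrightarrow> u \<in> carrier (free_ring X) \<Longrightarrow> F (u * gen x) = 0"
begin

definition es_monomial :: "nat multiset \<Rightarrow> free_alg" where
  "es_monomial M = prod_list (map (\<lambda>i. gen (es ! i) ^ count M i) [0..<length es])"

text \<open>The series of the restriction to \<open>S(a)\<close> of the functional sending u to \<open>F (u * v)\<close>.\<close>

definition ser :: "free_alg \<Rightarrow> mfps" where
  "ser v = Mfps (\<lambda>M. if set_mset M \<subseteq> {..<length es}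
     then F (es_monomial M * v) / (\<Prod>i<length es. fact (count M i)) else 0)"

lemma mcoeff_ser: "mcoeff (ser v) M = (if set_mset M \<subseteq> {..<length es}
     then F (es_monomial M * v) / (\<Prod>i<length es. fact (count M i)) else 0)"
  by (simp add: ser_def Mfps_inverse)

lemma es_whole: "i < length es \<Longrightarrow> es ! i \<in> whole X"
  using es_even part_whole by blast

lemma es_monomial_carrier: "es_monomial M \<in> carrier (free_ring X)"
  unfolding es_monomial_def by (intro free_carrier_prod_list) (auto intro!: free_carrier simp: es_whole)

lemma ser_add:
  assumes "v \<in> carrier (free_ring X)" "w \<in> carrier (free_ring X)"
  shows "ser (v + w) = ser v + ser w"
  by (rule mfps_eqI)
     (simp add: mcoeff_ser distrib_left F_add free_carrier es_monomial_carrier assms add_divide_distrib)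

lemma ser_scal:
  assumes "v \<in> carrier (free_ring X)"
  shows "ser (scal c * v) = mconst c * ser v"
  by (rule mfps_eqI) (simp add: mcoeff_ser F_scal_inner es_monomial_carrier assms)

lemma ser_zero: "ser 0 = 0"
  by (rule mfps_eqI) (simp add: mcoeff_ser F_zero)

lemma ser_sum:
  "(\<And>i. i \<in> I \<Longrightarrow> v i \<in> carrier (free_ring X)) \<Longrightarrow> ser (\<Sum>i\<in>I. v i) = (\<Sum>i\<in>I. ser (v i))"
  by (induction I rule: infinite_finite_induct) (simp_all add: ser_zero ser_add free_carrier_sum)

lemma ser_gen_add:
  assumes "v \<in> carrier (free_ring X)" "x \<in> whole X" "y \<in> whole X"
  shows "ser (gen (x + y) * v) = ser (gen x * v) + ser (gen y * v)"
  by (rule mfps_eqI)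
     (simp add: mcoeff_ser F_gen_add es_monomial_carrier assms add_divide_distrib
       flip: mult.assoc)

lemma ser_gen_scale:
  assumes "v \<in> carrier (free_ring X)" "x \<in> whole X"
  shows "ser (gen (cscale c x) * v) = mconst c * ser (gen x * v)"
  by (rule mfps_eqI)
     (simp add: mcoeff_ser F_gen_scale es_monomial_carrier assms flip: mult.assoc)

lemma ser_gen_zero: "v \<in> carrier (free_ring X) \<Longrightarrow> ser (gen 0 * v) = 0"
  using ser_gen_scale[of v 0 0] cmat.subspace_0[OF subspace_whole] by (simp add: mconst_hom)

lemma ser_gen_sum:
  assumes v: "v \<in> carrier (free_ring X)" and f: "\<And>i. i \<in> I \<Longrightarrow> f i \<in> whole X"
  shows "ser (gen (\<Sum>i\<in>I. cscale (c i) (f i)) * v) = (\<Sum>i\<in>I. mconst (c i) * ser (gen (f i) * v))"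
  using f
proof (induction I rule: infinite_finite_induct)
  case (insert i I)
  have "cscale (c i) (f i) \<in> whole X" "(\<Sum>i\<in>I. cscale (c i) (f i)) \<in> whole X"
    using insert.prems by (auto intro!: cmat.subspace_scale[OF subspace_whole]
        cmat.subspace_sum[OF subspace_whole])
  moreover have "ser (gen (\<Sum>i\<in>I. cscale (c i) (f i)) * v) = (\<Sum>i\<in>I. mconst (c i) * ser (gen (f i) * v))"
    by (rule insert.IH) (use insert.prems in auto)
  moreover have "f i \<in> whole X" using insert.prems by blast
  ultimately show "ser (gen (\<Sum>i\<in>insert i I. cscale (c i) (f i)) * v) =
      (\<Sum>i\<in>insert i I. mconst (c i) * ser (gen (f i) * v))"
    by (simp only: sum.insert[OF insert.hyps] ser_gen_add[OF v] ser_gen_scale[OF v])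
qed (simp_all add: ser_gen_zero v)

lemma ser_swap:
  assumes "v \<in> carrier (free_ring X)"
    and "s \<in> {0,1}" "t \<in> {0,1}" "x \<in> part X s" "y \<in> part X t"
  shows "ser (gen x * (gen y * v)) =
    mconst ((-1) ^ (s * t)) * ser (gen y * (gen x * v)) + ser (gen (brk X x y) * v)"
  by (rule mfps_eqI)
     (use F_swap[OF es_monomial_carrier assms] in
       \<open>simp add: mcoeff_ser add_divide_distrib mult.assoc\<close>)

lemma ser_kk_right:
  assumes "v \<in> carrier (free_ring X)" "x \<in> kk X"
  shows "ser (v * gen x) = 0"
  by (rule mfps_eqI)
     (simp add: mcoeff_ser F_kk_right free_carrier es_monomial_carrier assms flip: mult.assoc)

lemma ser_kk: "x \<in> kk X \<Longrightarrow> ser (gen x) = 0"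
  using ser_kk_right[of 1 x] by (simp add: free_carrier)

lemma mcoeff_ser_empty: "mcoeff (ser v) {#} = F v"
proof -
  have "es_monomial {#} = prod_list (map (\<lambda>i. 1) [0..<length es])"
    unfolding es_monomial_def by simp
  also have "\<dots> = 1" by (induction es) simp_all
  finally show ?thesis by (simp add: mcoeff_ser)
qed

text \<open>The monomials are ordered by index, so a new factor \<open>es ! i\<close> stands in the
  middle. It is moved to the right end through the later factors, with which it commutes.\<close>

lemma F_es_monomial_add_mset:
  assumes i: "i < length es" and v: "v \<in> carrier (free_ring X)"
  shows "F (es_monomial (add_mset i M) * v) = F (es_monomial M * (gen (es ! i) * v))"
proof -
  let ?n = "length es" and ?p = "\<lambda>M k. gen (es ! k) ^ count M k" and ?g = "gen (es ! i)"
  let ?P' = "\<lambda>M. prod_list (map (?p M) [0..<i])" and ?Q' = "\<lambda>M. prod_list (map (?p M) [Suc i..<?n])"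
  let ?P = "?P' M" and ?Q = "?Q' M"
  have split: "[0..<?n] = [0..<i] @ i # [Suc i..<?n]"
    using upt_add_eq_append[of 0 i "?n - i"] upt_conv_Cons[OF i] i by simp
  have mono: "es_monomial M = ?P' M * ?g ^ count M i * ?Q' M" for M
    unfolding es_monomial_def split by (simp add: mult.assoc)
  have P': "map (?p (add_mset i M)) [0..<i] = map (?p M) [0..<i]"
    and Q': "map (?p (add_mset i M)) [Suc i..<?n] = map (?p M) [Suc i..<?n]"
    by auto
  have P: "?P \<in> carrier (free_ring X)"
    using i by (intro free_carrier_prod_list) (auto intro!: free_carrier simp: es_whole)
  have Q: "?Q \<in> commutes_with (es ! i)"
    using i by (intro commutes_with_prod_list)
      (auto intro!: commutes_with_power commutes_with_gen es_even es_commute)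
  have g: "?g \<in> carrier (free_ring X)" using i by (intro free_carrier es_whole)
  have "F (es_monomial (add_mset i M) * v) = F ((?P * ?g ^ count M i) * (?g * ?Q) * v)"
    unfolding mono[of "add_mset i M"] P' Q' by (simp add: power_Suc2 mult.assoc del: power_Suc)
  also have "\<dots> = F ((?P * ?g ^ count M i) * (?Q * ?g) * v)"
    using P g v by (intro commutes_withD(1)[OF Q, symmetric]) (simp_all add: free_carrier)
  also have "\<dots> = F (es_monomial M * (?g * v))"
    unfolding mono[of M] by (simp add: mult.assoc)
  finally show ?thesis .
qed

lemma mpartial_ser:
  assumes v: "v \<in> carrier (free_ring X)"
  shows "mpartial i (ser v) = (if i < length es then ser (gen (es ! i) * v) else 0)"
proof (rule mfps_eqI)
  fix M
  let ?n = "length es"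
  show "mcoeff (mpartial i (ser v)) M = mcoeff (if i < ?n then ser (gen (es ! i) * v) else 0) M"
  proof (cases "i < ?n \<and> set_mset M \<subseteq> {..<?n}")
    case True
    have "(\<Prod>k<?n. fact (count (add_mset i M) k)) * fact (count M i) =
        (\<Prod>k<?n. fact (count M k)) * (fact (count M i + 1) :: complex)"
      using prod_count_add_mset[of i ?n "\<lambda>k c. fact c" M] True by simp
    also have "\<dots> = of_nat (count M i + 1) * (\<Prod>k<?n. fact (count M k)) * fact (count M i)"
      by (simp only: Suc_eq_plus1[symmetric] fact_Suc of_nat_mult of_nat_fact mult_ac)
    finally have "(\<Prod>k<?n. fact (count (add_mset i M) k)) =
        of_nat (count M i + 1) * (\<Prod>k<?n. fact (count M k) :: complex)"
      by (simp only: mult_cancel_right fact_nonzero simp_thms)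
    moreover have "of_nat (count M i + 1) \<noteq> (0 :: complex)"
      by (simp only: of_nat_eq_0_iff)
    ultimately show ?thesis
      using True F_es_monomial_add_mset[of i v M] v by (simp add: mcoeff_ser del: of_nat_add)
  qed (auto simp: mcoeff_ser)
qed

text \<open>By induction on monomials: the recurrence expresses each coefficient of \<open>G v\<close> through
  coefficients of lower degree of series of the same family.\<close>

lemma zero_of_mpartial_recurrence:
  assumes "\<And>v i. v \<in> carrier (free_ring X) \<Longrightarrow> i < length es \<Longrightarrow>
      mpartial i (G v) = G (gen (es ! i) * v) + mconst (k i) * G v"
    and "\<And>v i. v \<in> carrier (free_ring X) \<Longrightarrow> \<not> i < length es \<Longrightarrow> mpartial i (G v) = 0"
    and "\<And>v. v \<in> carrier (free_ring X) \<Longrightarrow> mcoeff (G v) {#} = 0"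
    and "v \<in> carrier (free_ring X)"
  shows "G v = 0"
proof -
  have "mcoeff (G v) M = 0" if "v \<in> carrier (free_ring X)" for v M
    using that
  proof (induction M arbitrary: v)
    case (add i M)
    have "mcoeff (mpartial i (G v)) M = 0"
    proof (cases "i < length es")
      case True
      then have "gen (es ! i) * v \<in> carrier (free_ring X)"
        using add.prems by (intro free_carrier es_whole)
      then show ?thesis using True add assms(1) by simp
    next
      case False
      then show ?thesis using add.prems assms(2) by simp
    qed
    then show ?case by (simp del: of_nat_add of_nat_Suc)
  qed (rule assms(3))
  then show ?thesis using assms(4) by (intro mfps_eqI) simp
qed

lemma ser_weight_vector:
  assumes s: "s \<in> {0,1}" and x: "x \<in> part X s"
    and wt: "\<And>i. i < length es \<Longrightarrow> brk X (es ! i) x = cscale (\<alpha> (es ! i)) x"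
    and v: "v \<in> carrier (free_ring X)"
  shows "ser (gen x * v) = - (mexp es (\<lambda>u. 2 * \<alpha> u) * ser (gen (invol X x) * v))"
proof -
  let ?Q = "mexp es (\<lambda>u. 2 * \<alpha> u)" and ?y = "invol X x"
  define G where "G v = ser (gen x * v) + ?Q * ser (gen ?y * v)" for v
  have xw: "x \<in> whole X" by (rule part_whole[OF s x])
  have y: "?y \<in> part X s" "?y \<in> whole X" using invol_part[OF s x] invol_whole[OF xw] .
  have wt_y: "brk X (es ! i) ?y = cscale (- \<alpha> (es ! i)) ?y" if i: "i < length es" for i
  proof -
    have inv: "invol X (es ! i) = - es ! i" using es_pp[OF i] by (simp add: pp_def)
    have "brk X (es ! i) ?y = invol X (brk X (invol X (es ! i)) x)"
      using es_whole[OF i] xw by (simp add: invol_brk invol_whole invol_invol)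
    also have "brk X (invol X (es ! i)) x = cscale (- \<alpha> (es ! i)) x"
      using brk_scale_left[of "-1" "es ! i" x] wt[OF i] by (simp add: inv)
    finally show ?thesis using xw by (simp only: invol_scale)
  qed
  have swap: "ser (gen (es ! i) * (gen z * w)) = ser (gen z * (gen (es ! i) * w)) +
      mconst c * ser (gen z * w)"
    if "i < length es" "w \<in> carrier (free_ring X)" "z \<in> part X s" "brk X (es ! i) z = cscale c z"
    for i w z c
    using ser_swap[OF that(2) _ s es_even[OF that(1)] that(3)] ser_gen_scale[OF that(2) part_whole[OF s that(3)]]
    by (simp add: that(4) mconst_hom)
  have "G v = 0"
  proof (rule zero_of_mpartial_recurrence[where k = "\<lambda>i. \<alpha> (es ! i)", OF _ _ _ v])
    fix w assume w: "w \<in> carrier (free_ring X)"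
    then have c: "gen x * w \<in> carrier (free_ring X)" "gen ?y * w \<in> carrier (free_ring X)"
      using xw y by (simp_all add: free_carrier)
    show "mpartial i (G w) = G (gen (es ! i) * w) + mconst (\<alpha> (es ! i)) * G w" if i: "i < length es" for i
    proof -
      let ?A = "mconst (\<alpha> (es ! i))"
      have A2: "mconst (2 * \<alpha> (es ! i)) = ?A + ?A"
        by (simp only: mult_2 mconst_hom(3))
      have "mpartial i (G w) = ser (gen (es ! i) * (gen x * w)) +
          (mconst (2 * \<alpha> (es ! i)) * ?Q * ser (gen ?y * w) + ?Q * ser (gen (es ! i) * (gen ?y * w)))"
        using i by (simp only: G_def mpartial_add mpartial_mult mpartial_mexp mpartial_ser c if_True)
      also have "\<dots> = G (gen (es ! i) * w) + ?A * G w"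
        unfolding G_def A2 swap[OF i w x wt[OF i]] swap[OF i w y(1) wt_y[OF i]] mconst_hom(5)
        by (simp add: algebra_simps)
      finally show ?thesis .
    qed
    show "mpartial i (G w) = 0" if "\<not> i < length es" for i
      using that by (simp add: G_def mpartial_add mpartial_mult mpartial_mexp mpartial_ser c)
    have "gen (x + ?y) * w = 1 * gen (x + ?y) * w" by simp
    have "F (gen x * w) + F (gen ?y * w) = 0"
      using F_gen_add[of 1 w x ?y] F_kk_left[OF plus_invol_kk[OF xw] w] w xw y
      by (simp add: free_carrier)
    then show "mcoeff (G w) {#} = 0"
      by (simp add: G_def mcoeff_ser_empty)
  qed
  then show ?thesis by (simp add: G_def add_eq_0_iff2)
qed

lemma ser_radial:
  assumes s: "s \<in> {0,1}" "t \<in> {0,1}" and x: "x \<in> part X s" and y: "y \<in> part X t"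
    and wt: "\<And>i. i < length es \<Longrightarrow> brk X (es ! i) x = cscale (\<alpha> (es ! i)) x"
  shows "(mexp es (\<lambda>u. 2 * \<alpha> u) - 1) * ser (gen x * gen y) =
    mexp es (\<lambda>u. 2 * \<alpha> u) * ser (gen (brk X x y + brk X (invol X x) y))"
proof -
  let ?Q = "mexp es (\<lambda>u. 2 * \<alpha> u)" and ?z = "invol X x"
  define g where "g = gen (brk X x y + brk X ?z y)"
  have w: "x \<in> whole X" "?z \<in> whole X" "y \<in> whole X" "x + ?z \<in> whole X"
    using part_whole s x y invol_whole cmat.subspace_add[OF subspace_whole] by blast+
  \<comment> \<open>\<theta> is even, so the sum stays homogeneous and can be moved past y with a
    single sign.\<close>
  have xz: "x + ?z \<in> part X s"
    by (rule cmat.subspace_add[OF subspace_part[OF s(1)] x invol_part[OF s(1) x]])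
  have "ser (gen x * gen y) + ser (gen ?z * gen y) = ser (gen (x + ?z) * gen y)"
    using w by (simp add: ser_gen_add free_carrier)
  also have "\<dots> = ser (gen (brk X (x + ?z) y))"
    using ser_swap[OF free_carrier_one s xz y] ser_kk_right[OF free_carrier_gen[OF w(3)] plus_invol_kk[OF w(1)]]
    by simp
  also have "\<dots> = ser g" by (simp only: brk_add_left g_def)
  \<comment> \<open>Multiplying by e^{2\<alpha>} makes the term with \<theta>x expressible through
    the term with x.\<close>
  finally have "?Q * ser g = ?Q * ser (gen x * gen y) + ?Q * ser (gen ?z * gen y)"
    by (simp add: distrib_left[symmetric])
  also have "?Q * ser (gen ?z * gen y) = - ser (gen x * gen y)"
    using ser_weight_vector[OF s(1) x wt free_carrier_gen[OF w(3)]] by simp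
  finally show ?thesis by (simp add: algebra_simps flip: g_def)
qed

end

section \<open>The radial part of the Casimir element\<close>

locale radial_setting =
  cartan_setting X a h b es hs E + zonal_series X F es
  for X a h b es hs E F
begin

text \<open>The contribution to the Casimir element of all roots with restriction \<alpha>. The
  value \<alpha> = 0 collects the roots that vanish on a.\<close>

definition root_part :: "(cmat \<Rightarrow> complex) \<Rightarrow> mfps" where
  "root_part \<alpha> = (\<Sum>\<beta>\<in>{\<beta> \<in> roots. res \<beta> = \<alpha>}.
     mconst (1 / b (E (- \<beta>)) (E \<beta>)) * ser (gen (E \<beta>) * gen (E (- \<beta>))))"

abbreviation exp2 :: "(cmat \<Rightarrow> complex) \<Rightarrow> mfps" where
  "exp2 \<alpha> \<equiv> mexp es (\<lambda>v. 2 * \<alpha> v)"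

lemma ser_h:
  assumes u: "u \<in> h"
  shows "ser (gen u) = ser (gen (a_proj u))"
proof -
  have "ser (gen (a_proj u + (u - a_proj u)) * 1) = ser (gen (a_proj u) * 1) + ser (gen (u - a_proj u) * 1)"
    using a_whole[OF a_proj_mem[OF u]] minus_a_proj_kk[OF u]
    by (intro ser_gen_add) (simp_all add: free_carrier kk_def)
  then show ?thesis by (simp add: ser_kk[OF minus_a_proj_kk[OF u]])
qed

lemma root_part_equation:
  assumes \<alpha>: "\<alpha> \<in> dual_space a" "\<alpha> \<noteq> 0"
  shows "(exp2 \<alpha> - 1) * root_part \<alpha> =
    exp2 \<alpha> * (mconst (of_int (mult_super X a \<alpha>)) * ser (gen (dual_vector a b \<alpha>)))"
proof -
  let ?S = "{\<beta> \<in> roots. res \<beta> = \<alpha>}" and ?n = "\<lambda>\<beta>. b (E (- \<beta>)) (E \<beta>)"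
  let ?x = "\<lambda>\<beta>. brk X (E \<beta>) (E (- \<beta>))" and ?y = "\<lambda>\<beta>. brk X (invol X (E \<beta>)) (E (- \<beta>))"
  let ?t = "dual_vector a b \<alpha>"
  have wh: "?x \<beta> \<in> whole X" "?y \<beta> \<in> whole X" if "\<beta> \<in> ?S" for \<beta>
    using that root_vector_whole neg_root(1) by (simp_all add: brk_whole invol_whole)
  have root_term: "(exp2 \<alpha> - 1) * ser (gen (E \<beta>) * gen (E (- \<beta>))) =
      exp2 \<alpha> * (ser (gen (?x \<beta>)) + ser (gen (?y \<beta>)))" if \<beta>: "\<beta> \<in> ?S" for \<beta>
  proof -
    have r: "\<beta> \<in> roots" using \<beta> by simp
    have wt: "brk X (es ! i) (E \<beta>) = cscale (\<alpha> (es ! i)) (E \<beta>)" if "i < length es" for i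
      using weight_space_brk[OF root_vector_restricted[OF r] es_mem[OF that]] \<beta> by simp
    have "(exp2 \<alpha> - 1) * ser (gen (E \<beta>) * gen (E (- \<beta>))) = exp2 \<alpha> * ser (gen (?x \<beta> + ?y \<beta>))"
      by (rule ser_radial[OF par_cases par_cases root_vector_part[OF r]
            root_vector_part[OF neg_root(1)[OF r]] wt])
    then show ?thesis
      using ser_gen_add[OF free_carrier_one wh(1)[OF \<beta>] wh(2)[OF \<beta>]] by simp
  qed
  have x: "mconst (1 / ?n \<beta>) * ser (gen (?x \<beta>)) = mconst ((-1) ^ par \<beta>) * ser (gen ?t)"
    if \<beta>: "\<beta> \<in> ?S" for \<beta>
  proof -
    have r: "\<beta> \<in> roots" using \<beta> by simp
    have t: "?t \<in> whole X" using dual_vector[OF \<alpha>(1)] a_whole by blast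
    have "ser (gen (?x \<beta>)) = mconst (b (E \<beta>) (E (- \<beta>))) * ser (gen ?t)"
      using ser_h[OF root_bracket_h[OF r]] ser_gen_scale[OF free_carrier_one t] \<beta>
      by (simp add: root_bracket_a_proj)
    then have "mconst (1 / ?n \<beta>) * ser (gen (?x \<beta>)) =
        mconst (1 / ?n \<beta> * b (E \<beta>) (E (- \<beta>))) * ser (gen ?t)"
      by (simp only: mconst_hom mult.assoc)
    also have "1 / ?n \<beta> * b (E \<beta>) (E (- \<beta>)) = (-1) ^ par \<beta>"
      using par_swap_sign[OF r] neg_root(2)[OF r] by simp
    finally show ?thesis .
  qed
  have y: "(\<Sum>\<beta>\<in>?S. mconst (1 / ?n \<beta>) * ser (gen (?y \<beta>))) = 0"
  proof -
    have "(\<Sum>\<beta>\<in>?S. mconst (1 / ?n \<beta>) * ser (gen (?y \<beta>))) =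
        ser (gen (\<Sum>\<beta>\<in>?S. cscale (1 / ?n \<beta>) (?y \<beta>)) * 1)"
      using ser_gen_sum[OF free_carrier_one wh(2), where c = "\<lambda>\<beta>. 1 / ?n \<beta>" and I = ?S] by simp
    also have "\<dots> = 0"
      unfolding sum_brk_invol_zero by (rule ser_gen_zero[OF free_carrier_one])
    finally show ?thesis .
  qed
  have "(exp2 \<alpha> - 1) * root_part \<alpha> =
      (\<Sum>\<beta>\<in>?S. mconst (1 / ?n \<beta>) * ((exp2 \<alpha> - 1) * ser (gen (E \<beta>) * gen (E (- \<beta>)))))"
    by (simp add: root_part_def sum_distrib_left mult.left_commute)
  also have "\<dots> = (\<Sum>\<beta>\<in>?S. exp2 \<alpha> * (mconst (1 / ?n \<beta>) * ser (gen (?x \<beta>)) +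
      mconst (1 / ?n \<beta>) * ser (gen (?y \<beta>))))"
    using root_term by (intro sum.cong refl) (simp only: distrib_left mult.left_commute)
  also have "\<dots> = exp2 \<alpha> * ((\<Sum>\<beta>\<in>?S. mconst (1 / ?n \<beta>) * ser (gen (?x \<beta>))) +
      (\<Sum>\<beta>\<in>?S. mconst (1 / ?n \<beta>) * ser (gen (?y \<beta>))))"
    by (simp only: sum_distrib_left[symmetric] sum.distrib)
  also have "(\<Sum>\<beta>\<in>?S. mconst (1 / ?n \<beta>) * ser (gen (?x \<beta>))) =
      (\<Sum>\<beta>\<in>?S. mconst ((-1) ^ par \<beta>) * ser (gen ?t))"
    by (rule sum.cong) (simp_all only: x)
  also have "\<dots> = mconst (of_int (mult_super X a \<alpha>)) * ser (gen ?t)"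
    by (simp add: mult_super_eq[OF \<alpha>] mconst_sum sum_distrib_right)
  finally show ?thesis by (simp only: y add_0_right)
qed

lemma dual_vector_uminus:
  assumes \<alpha>: "\<alpha> \<in> dual_space a" "- \<alpha> \<in> dual_space a"
  shows "dual_vector a b (- \<alpha>) = - dual_vector a b \<alpha>"
proof -
  note t = dual_vector[OF \<alpha>(1)] dual_vector[OF \<alpha>(2)]
  let ?d = "dual_vector a b (- \<alpha>) + dual_vector a b \<alpha>"
  have "?d \<in> a" using t cmat.subspace_add[OF a_subspace] by blast
  moreover have "b ?d w = 0" if "w \<in> a" for w
    using t that by (simp add: form_add a_whole)
  ultimately have "?d = 0"
    using form_nondeg_a unfolding nondegenerate_on_def by blast
  then show ?thesis by (simp add: add_eq_0_iff2)
qed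

lemma uminus_roots: "(\<Sum>\<beta>\<in>{\<beta> \<in> roots. res \<beta> = - \<alpha>}. f \<beta>) = (\<Sum>\<beta>\<in>{\<beta> \<in> roots. res \<beta> = \<alpha>}. f (- \<beta>))"
  by (rule sum.reindex_bij_witness[where i = uminus and j = uminus])
     (auto simp: res_uminus neg_root(1))

text \<open>Negation matches the roots over \<alpha> with those over -\<alpha> and preserves parity,
  so both multiplicities agree, while the dual vector changes sign. Multiplying the equation for
  -\<alpha> by e^{2\<alpha>} turns its left factor into 1 - e^{2\<alpha>} and removes the
  exponential on the right; the two equations can then be added.\<close>

lemma root_part_pair:
  assumes \<alpha>: "\<alpha> \<in> dual_space a" "- \<alpha> \<in> dual_space a" "\<alpha> \<noteq> 0"
  shows "(exp2 \<alpha> - 1) * (root_part \<alpha> + root_part (- \<alpha>)) =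
    (exp2 \<alpha> + 1) * (mconst (of_int (mult_super X a \<alpha>)) * ser (gen (dual_vector a b \<alpha>)))"
proof -
  let ?w = "mconst (of_int (mult_super X a \<alpha>)) * ser (gen (dual_vector a b \<alpha>))"
  have t: "dual_vector a b \<alpha> \<in> whole X" using dual_vector[OF \<alpha>(1)] a_whole by blast
  have "mult_super X a (- \<alpha>) = mult_super X a \<alpha>"
    using \<alpha> by (simp add: mult_super_eq uminus_roots neg_root(3))
  moreover have "ser (gen (- dual_vector a b \<alpha>)) = - ser (gen (dual_vector a b \<alpha>))"
    using ser_gen_scale[OF free_carrier_one t, of "-1"] by (simp add: mconst_hom)
  ultimately have neg: "(exp2 (- \<alpha>) - 1) * root_part (- \<alpha>) = - (exp2 (- \<alpha>) * ?w)"
    using root_part_equation[of "- \<alpha>"] \<alpha> by (simp add: dual_vector_uminus)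
  have inv: "exp2 \<alpha> * exp2 (- \<alpha>) = 1"
    using mexp_minus[of es "\<lambda>v. 2 * \<alpha> v"] by simp
  have "(exp2 \<alpha> * exp2 (- \<alpha>) - exp2 \<alpha>) * root_part (- \<alpha>) =
      exp2 \<alpha> * ((exp2 (- \<alpha>) - 1) * root_part (- \<alpha>))"
    by (simp add: algebra_simps)
  also have "\<dots> = - ((exp2 \<alpha> * exp2 (- \<alpha>)) * ?w)"
    unfolding neg by (simp add: mult.assoc)
  finally have "(exp2 \<alpha> - 1) * root_part (- \<alpha>) = ?w"
    unfolding inv by (simp add: algebra_simps)
  then show ?thesis
    using root_part_equation[OF \<alpha>(1,3)] by (simp add: distrib_left distrib_right)
qed

lemma ser_h_commute:
  assumes "u \<in> h" "v \<in> h"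
  shows "ser (gen u * gen v) = ser (gen v * gen u)"
  using ser_swap[OF free_carrier_one _ _ h_even[OF assms(1)] h_even[OF assms(2)]] h_commute[OF assms]
    ser_gen_zero[OF free_carrier_one]
  by (simp add: mconst_hom)

text \<open>h is commutative, so the \<theta>-fixed component of either factor can be moved to the
  right end, where it is killed.\<close>

lemma ser_h_square:
  assumes u: "u \<in> h"
  shows "ser (gen u * gen u) = ser (gen (a_proj u) * gen (a_proj u))"
proof -
  let ?p = "a_proj u" and ?k = "u - a_proj u"
  have p: "?p \<in> h" by (rule a_h[OF a_proj_mem[OF u]])
  have k: "?k \<in> h" "?k \<in> kk X" by (rule cmat.subspace_diff[OF h_subspace u p], rule minus_a_proj_kk[OF u])
  have zero: "ser (gen ?k * gen v) = 0" if "v \<in> h" for v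
    using ser_h_commute[OF k(1) that] ser_kk_right[OF free_carrier_gen[OF h_whole[OF that]] k(2)] by simp
  have step: "ser (gen u * gen v) = ser (gen ?p * gen v)" if "v \<in> h" for v
    using ser_gen_add[OF free_carrier_gen[OF h_whole[OF that]] h_whole[OF p] h_whole[OF k(1)]] zero[OF that]
    by simp
  show ?thesis
    using step[OF u] step[OF p] ser_h_commute[OF u p] by simp
qed

lemma ser_a_square:
  assumes p: "p \<in> a"
  shows "ser (gen p * gen p) = (\<Sum>i<length es. \<Sum>j<length es.
    mconst (coord a es i p * coord a es j p) * ser (gen (es ! i) * gen (es ! j)))"
proof -
  have expand: "ser (gen p * gen v) =
      (\<Sum>i<length es. mconst (coord a es i p) * ser (gen (es ! i) * gen v))" if "v \<in> h" for v
  proof -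
    have "ser (gen p * gen v) = ser (gen (\<Sum>i<length es. cscale (coord a es i p) (es ! i)) * gen v)"
      using coord_expansion[OF p] by simp
    also have "\<dots> = (\<Sum>i<length es. mconst (coord a es i p) * ser (gen (es ! i) * gen v))"
      using that by (intro ser_gen_sum) (simp_all add: free_carrier h_whole es_whole)
    finally show ?thesis .
  qed
  have inner: "ser (gen (es ! i) * gen p) =
      (\<Sum>j<length es. mconst (coord a es j p) * ser (gen (es ! i) * gen (es ! j)))"
    if i: "i < length es" for i
  proof -
    have ih: "es ! i \<in> h" by (rule a_h[OF es_mem[OF i]])
    have "ser (gen (es ! i) * gen p) = ser (gen p * gen (es ! i))"
      by (rule ser_h_commute[OF ih a_h[OF p]])
    also have "\<dots> = (\<Sum>j<length es. mconst (coord a es j p) * ser (gen (es ! j) * gen (es ! i)))"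
      by (rule expand[OF ih])
    also have "\<dots> = (\<Sum>j<length es. mconst (coord a es j p) * ser (gen (es ! i) * gen (es ! j)))"
      by (intro sum.cong refl) (simp add: ser_h_commute ih a_h es_mem)
    finally show ?thesis .
  qed
  show ?thesis
    unfolding expand[OF a_h[OF p]]
    by (intro sum.cong refl) (simp add: inner sum_distrib_left mconst_hom mult.assoc)
qed

text \<open>Once the sums are interchanged, the inner sum over hs is the one evaluated in
  \<open>dual_form_coord\<close>.\<close>

lemma ser_cartan_part:
  "(\<Sum>k<length hs. mconst (1 / b (hs ! k) (hs ! k)) * ser (gen (hs ! k) * gen (hs ! k))) =
   (\<Sum>i<length es. \<Sum>j<length es.
      mconst (dual_form a b (coord a es i) (coord a es j)) * ser (gen (es ! i) * gen (es ! j)))"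
proof -
  let ?c = "\<lambda>i k. coord a es i (a_proj (hs ! k))" and ?n = "\<lambda>k. b (hs ! k) (hs ! k)"
  let ?e = "\<lambda>i j. ser (gen (es ! i) * gen (es ! j))"
  have "(\<Sum>k<length hs. mconst (1 / ?n k) * ser (gen (hs ! k) * gen (hs ! k))) =
      (\<Sum>k<length hs. \<Sum>i<length es. \<Sum>j<length es. mconst (?c i k * ?c j k / ?n k) * ?e i j)"
  proof (intro sum.cong refl)
    fix k assume "k \<in> {..<length hs}"
    then have k: "hs ! k \<in> h" using hs_mem by simp
    have m: "mconst (1 / ?n k) * (mconst c * f) = mconst (c / ?n k) * f" for c f
      by (simp add: mult.assoc[symmetric] mconst_hom(4)[symmetric])
    show "mconst (1 / ?n k) * ser (gen (hs ! k) * gen (hs ! k)) =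
        (\<Sum>i<length es. \<Sum>j<length es. mconst (?c i k * ?c j k / ?n k) * ?e i j)"
      unfolding ser_h_square[OF k] ser_a_square[OF a_proj_mem[OF k]] sum_distrib_left m ..
  qed
  also have "\<dots> = (\<Sum>i<length es. \<Sum>k<length hs. \<Sum>j<length es.
      mconst (?c i k * ?c j k / ?n k) * ?e i j)"
    by (rule sum.swap)
  also have "\<dots> = (\<Sum>i<length es. \<Sum>j<length es. \<Sum>k<length hs.
      mconst (?c i k * ?c j k / ?n k) * ?e i j)"
    by (intro sum.cong refl sum.swap)
  also have "\<dots> = (\<Sum>i<length es. \<Sum>j<length es.
      mconst (dual_form a b (coord a es i) (coord a es j)) * ?e i j)"
    by (intro sum.cong refl) (simp add: dual_form_coord mconst_sum sum_distrib_right)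
  finally show ?thesis .
qed

lemma root_part_zero: "root_part 0 = 0"
  unfolding root_part_def
proof (rule sum.neutral, intro ballI)
  fix \<beta> assume "\<beta> \<in> {\<beta> \<in> roots. res \<beta> = 0}"
  then have \<beta>: "\<beta> \<in> roots" "res (- \<beta>) = 0" by (simp_all add: res_uminus)
  have "E (- \<beta>) \<in> kk X" by (rule res_zero_kk[OF neg_root(1)[OF \<beta>(1)] \<beta>(2)])
  then have "ser (gen (E \<beta>) * gen (E (- \<beta>))) = 0"
    by (rule ser_kk_right[OF free_carrier_gen[OF root_vector_whole[OF \<beta>(1)]]])
  then show "mconst (1 / b (E (- \<beta>)) (E \<beta>)) * ser (gen (E \<beta>) * gen (E (- \<beta>))) = 0" by simp
qed

lemma restricted_root_dual: "\<alpha> \<in> nonzero_weights X a \<Longrightarrow> \<alpha> \<in> dual_space a \<and> \<alpha> \<noteq> 0"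
  by (simp add: nonzero_weights_def)

lemma finite_restricted_roots: "finite (nonzero_weights X a)"
  using finite_roots by (simp add: restricted_roots)

lemma ser_root_part:
  assumes P: "positive_half (nonzero_weights X a) P"
  shows "(\<Sum>\<beta>\<in>roots. mconst (1 / b (E (- \<beta>)) (E \<beta>)) * ser (gen (E \<beta>) * gen (E (- \<beta>)))) =
    (\<Sum>\<alpha>\<in>P. root_part \<alpha> + root_part (- \<alpha>))"
proof -
  let ?R = "nonzero_weights X a"
  have R: "P \<inter> uminus ` P = {}" "P \<union> uminus ` P = ?R"
    using P by (auto simp: positive_half_def)
  have fin: "finite P" "finite (uminus ` P)"
    using finite_restricted_roots R(2) by (metis finite_Un)+
  \<comment> \<open>The roots are grouped by their restriction; 0 is adjoined for those that vanish
    on a.\<close>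
  have "res ` roots \<subseteq> insert 0 ?R" unfolding restricted_roots by blast
  then have "(\<Sum>\<beta>\<in>roots. mconst (1 / b (E (- \<beta>)) (E \<beta>)) * ser (gen (E \<beta>) * gen (E (- \<beta>)))) =
      (\<Sum>\<alpha>\<in>insert 0 ?R. root_part \<alpha>)"
    unfolding root_part_def
    by (intro sum.group[symmetric] finite_roots) (simp_all add: finite_restricted_roots)
  also have "\<dots> = (\<Sum>\<alpha>\<in>?R. root_part \<alpha>)"
    using finite_restricted_roots restricted_root_dual root_part_zero
    by (subst sum.insert) auto
  also have "\<dots> = (\<Sum>\<alpha>\<in>P. root_part \<alpha>) + (\<Sum>\<alpha>\<in>uminus ` P. root_part \<alpha>)"
    unfolding R(2)[symmetric] by (rule sum.union_disjoint[OF fin R(1)])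
  also have "(\<Sum>\<alpha>\<in>uminus ` P. root_part \<alpha>) = (\<Sum>\<alpha>\<in>P. root_part (- \<alpha>))"
    by (subst sum.reindex) (auto simp: inj_on_def)
  finally have "(\<Sum>\<beta>\<in>roots. mconst (1 / b (E (- \<beta>)) (E \<beta>)) * ser (gen (E \<beta>) * gen (E (- \<beta>)))) =
      (\<Sum>\<alpha>\<in>P. root_part \<alpha>) + (\<Sum>\<alpha>\<in>P. root_part (- \<alpha>))" .
  then show ?thesis by (simp only: sum.distrib)
qed

end

section \<open>Passage to the fraction field\<close>

lemma Fract_one_hom:
  "Fract (f + g) 1 = Fract f 1 + Fract (g :: mfps) 1" "Fract (f * g) 1 = Fract f 1 * Fract g 1"
  "Fract (f - g) 1 = Fract f 1 - Fract g 1" "Fract 0 1 = (0 :: mfps fract)" "Fract 1 1 = (1 :: mfps fract)"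
  by (simp_all add: Zero_fract_def One_fract_def)

lemma Fract_one_sum: "Fract (\<Sum>i\<in>I. f i) 1 = (\<Sum>i\<in>I. Fract (f i :: mfps) 1)"
  by (induction I rule: infinite_finite_induct) (simp_all add: Fract_one_hom)

lemma Fract_one_of_int: "Fract (mconst (of_int k)) 1 = (of_int k :: mfps fract)"
proof -
  have nat: "Fract (mconst (of_nat n)) 1 = (of_nat n :: mfps fract)" for n
    by (induction n) (simp_all add: mconst_hom Fract_one_hom del: add_fract)
  show ?thesis
  proof (cases k rule: int_diff_cases)
    case (diff m n)
    have "mconst (of_nat m - of_nat n) = mconst (of_nat m) - mconst (of_nat n)"
      by (rule mfps_eqI) simp
    then show ?thesis
      by (simp add: diff Fract_one_hom nat del: diff_fract)
  qed
qed

lemma fract_partial_one: "fract_partial i (Fract f 1) = Fract (mpartial i f) 1"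
  by (simp add: fract_partial_Fract mpartial_zero)

context radial_setting
begin

lemma ser_sum_scal:
  assumes "\<And>i. i \<in> I \<Longrightarrow> v i \<in> carrier (free_ring X)"
  shows "ser (\<Sum>i\<in>I. scal (c i) * v i) = (\<Sum>i\<in>I. mconst (c i) * ser (v i))"
proof -
  have "ser (\<Sum>i\<in>I. scal (c i) * v i) = (\<Sum>i\<in>I. ser (scal (c i) * v i))"
    using assms by (intro ser_sum free_carrier_mult[OF free_carrier_scal])
  also have "\<dots> = (\<Sum>i\<in>I. mconst (c i) * ser (v i))"
    using assms by (intro sum.cong refl ser_scal)
  finally show ?thesis .
qed

lemma laplacian_ser:
  "laplacian b a es (Fract (ser 1) 1) = Fract (\<Sum>i<length es. \<Sum>j<length es.
     mconst (dual_form a b (coord a es i) (coord a es j)) * ser (gen (es ! i) * gen (es ! j))) 1"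
  unfolding laplacian_def Fract_one_sum
  by (intro sum.cong refl)
     (simp add: fract_partial_one mpartial_ser free_carrier es_whole Fract_one_hom del: mult_fract)

lemma root_deriv_ser:
  assumes \<alpha>: "\<alpha> \<in> dual_space a"
  shows "root_deriv b a es \<alpha> (Fract (ser 1) 1) = Fract (ser (gen (dual_vector a b \<alpha>))) 1"
proof -
  have "ser (gen (dual_vector a b \<alpha>) * 1) =
      (\<Sum>i<length es. mconst (dual_form a b \<alpha> (coord a es i)) * ser (gen (es ! i) * 1))"
    unfolding dual_vector_expansion[OF \<alpha>]
    by (rule ser_gen_sum) (simp_all add: free_carrier es_whole)
  then show ?thesis
    unfolding root_deriv_def
    by (simp add: Fract_one_sum fract_partial_one mpartial_ser free_carrier Fract_one_hom del: mult_fract)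
qed

text \<open>A nonzero functional is nonzero on some basis vector, and the exponential then has a
  nonzero linear coefficient in that variable.\<close>

lemma exp2_neq_one:
  assumes "\<alpha> \<in> dual_space a" "\<alpha> \<noteq> 0"
  shows "exp2 \<alpha> - 1 \<noteq> 0"
proof -
  obtain u where u: "u \<in> a" "\<alpha> u \<noteq> 0"
    using dual_space_neqE[OF assms(1) zero_dual_space assms(2)] by auto
  have "\<alpha> u = (\<Sum>i<length es. coord a es i u * \<alpha> (es ! i))"
    using dual_space_sum[OF assms(1) a_subspace, of "{..<length es}" "(!) es" "\<lambda>i. coord a es i u"]
      es_mem coord_expansion[OF u(1)] by simp
  then obtain i where "i < length es" "\<alpha> (es ! i) \<noteq> 0"
    using u(2) by (metis (no_types, lifting) lessThan_iff mult_zero_right sum.neutral)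
  then show ?thesis by (intro mexp_neq_one) simp_all
qed

lemma radial_part:
  assumes P: "positive_half (nonzero_weights X a) P"
  shows "Fract (ser ((\<Sum>i<length hs. scal (1 / b (hs ! i) (hs ! i)) * (gen (hs ! i) * gen (hs ! i))) +
      (\<Sum>\<alpha>\<in>roots. scal (1 / b (E (- \<alpha>)) (E \<alpha>)) * (gen (E \<alpha>) * gen (E (- \<alpha>)))))) 1 =
    L_rad X b a es P (Fract (ser 1) 1)"
proof -
  let ?F = "Fract (ser 1) 1"
  have c1: "gen (hs ! i) * gen (hs ! i) \<in> carrier (free_ring X)" if "i \<in> {..<length hs}" for i
    using hs_whole[OF that] by (simp add: free_carrier)
  have c2: "gen (E \<beta>) * gen (E (- \<beta>)) \<in> carrier (free_ring X)" if "\<beta> \<in> roots" for \<beta>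
    using root_vector_whole that neg_root(1) by (simp add: free_carrier)
  let ?A = "\<Sum>i<length hs. scal (1 / b (hs ! i) (hs ! i)) * (gen (hs ! i) * gen (hs ! i))"
  let ?B = "\<Sum>\<alpha>\<in>roots. scal (1 / b (E (- \<alpha>)) (E \<alpha>)) * (gen (E \<alpha>) * gen (E (- \<alpha>)))"
  have AB: "ser (?A + ?B) = ser ?A + ser ?B"
    by (intro ser_add free_carrier_sum free_carrier_mult[OF free_carrier_scal] c1 c2)
  have A: "ser ?A = (\<Sum>i<length hs. mconst (1 / b (hs ! i) (hs ! i)) * ser (gen (hs ! i) * gen (hs ! i)))"
    by (rule ser_sum_scal) (rule c1)
  have B: "ser ?B = (\<Sum>\<alpha>\<in>roots. mconst (1 / b (E (- \<alpha>)) (E \<alpha>)) * ser (gen (E \<alpha>) * gen (E (- \<alpha>))))"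
    by (rule ser_sum_scal) (rule c2)
  have "Fract (ser (?A + ?B)) 1 = laplacian b a es ?F + (\<Sum>\<alpha>\<in>P. Fract (root_part \<alpha> + root_part (- \<alpha>)) 1)"
    unfolding AB A B ser_cartan_part ser_root_part[OF P] laplacian_ser
    by (simp only: Fract_one_hom(1) Fract_one_sum)
  also have "(\<Sum>\<alpha>\<in>P. Fract (root_part \<alpha> + root_part (- \<alpha>)) 1) =
      (\<Sum>\<alpha>\<in>P. of_int (mult_super X a \<alpha>) * (Fract (exp2 \<alpha> + 1) 1 / Fract (exp2 \<alpha> - 1) 1) *
        root_deriv b a es \<alpha> ?F)"
  proof (intro sum.cong refl)
    fix \<alpha> assume "\<alpha> \<in> P"
    have R: "P \<union> uminus ` P = nonzero_weights X a"
      using P unfolding positive_half_def by (rule conjunct2)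
    have "\<alpha> \<in> nonzero_weights X a" "- \<alpha> \<in> nonzero_weights X a"
      unfolding R[symmetric] using \<open>\<alpha> \<in> P\<close> by (rule UnI1, intro UnI2 imageI)
    then have \<alpha>: "\<alpha> \<in> dual_space a" "- \<alpha> \<in> dual_space a" "\<alpha> \<noteq> 0"
      using restricted_root_dual by blast+
    have nz: "Fract (exp2 \<alpha> - 1) 1 \<noteq> 0"
      using exp2_neq_one[OF \<alpha>(1,3)] by (simp add: eq_fract Zero_fract_def)
    have solve: "S = m * (B / A) * d" if "A \<noteq> 0" "A * S = B * (m * d)" for A B S m d :: "mfps fract"
      using that by (simp add: field_simps)
    have "Fract (exp2 \<alpha> - 1) 1 * Fract (root_part \<alpha> + root_part (- \<alpha>)) 1 =
      Fract (exp2 \<alpha> + 1) 1 * (of_int (mult_super X a \<alpha>) * Fract (ser (gen (dual_vector a b \<alpha>))) 1)"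
      unfolding Fract_one_of_int[symmetric] Fract_one_hom(2)[symmetric] root_part_pair[OF \<alpha>] ..
    from solve[OF nz this] show "Fract (root_part \<alpha> + root_part (- \<alpha>)) 1 =
      of_int (mult_super X a \<alpha>) * (Fract (exp2 \<alpha> + 1) 1 / Fract (exp2 \<alpha> - 1) 1) *
        root_deriv b a es \<alpha> ?F"
      unfolding root_deriv_ser[OF \<alpha>(1)] .
  qed
  also have "laplacian b a es ?F + \<dots> = L_rad X b a es P ?F"
  proof -
    \<comment> \<open>\<open>L_rad\<close> is a function on the localisation with an unspecified
      value elsewhere, so membership has to be checked; the denominator is 1.\<close>
    have "ser 1 \<in> power_series (length es)"
      by (auto simp: power_series_def mcoeff_ser split: if_splits)
    then have "?F \<in> localised es (nonzero_weights X a)"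
      unfolding localised_def using denominators.one by blast
    then show ?thesis by (simp add: L_rad_def)
  qed
  finally show ?thesis .
qed

end

theorem proposition3p3:
  fixes X :: sym_pair
    and a h :: "cmat set"
    and b :: "cmat \<Rightarrow> cmat \<Rightarrow> complex"
    and es hs :: "cmat list"
    and E :: "(cmat \<Rightarrow> complex) \<Rightarrow> cmat"
    and P :: "(cmat \<Rightarrow> complex) set"
  assumes pair: "X \<in> classical_pairs"
    and cartan_subspace: "even_cartan_subspace X a"
    and form: "invariant_form X b"
    and form_nondeg: "nondegenerate_on (whole X) b"
    and form_invol: "\<forall>x\<in>whole X. \<forall>y\<in>whole X. b (invol X x) (invol X y) = b x y"
    and form_nondeg_a: "nondegenerate_on a b"
    and cartan_subalgebra: "cartan_subalgebra X h" "a \<subseteq> h" "invol X ` h \<subseteq> h"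
    and orth_basis: "is_basis hs h"
      "\<forall>i<length hs. \<forall>j<length hs. i \<noteq> j \<longrightarrow> b (hs ! i) (hs ! j) = 0"
    and root_vectors: "root_vectors X h E"
    and basis_a: "is_basis es a"
    and positive: "positive_half (nonzero_weights X a) P"
  shows "\<forall>f\<in>zonal X.
    i_star X es (laplace_beltrami X (casimir X b h hs E) f) =
    L_rad X b a es P (i_star X es f)"
proof (intro ballI)
  fix f assume f: "f \<in> zonal X"
  then have dual: "f \<in> uea_dual X" by (simp add: zonal_def)
  interpret sym_superpair X by (rule sym_superpair_classical[OF pair])
  interpret cartan_setting X a h b es hs E
    by (intro cartan_setting.intro sym_superpair_axioms cartan_setting_axioms.intro)
       (fact assms)+
  let ?F = "\<lambda>t. f (env_class X t)"
  \<comment> \<open>Zonality is a condition on classes. Multiplicativity of \<open>env_class\<close>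
    turns it into vanishing on products in the free algebra with a \<theta>-fixed element at either
    end.\<close>
  have left: "?F (gen x * u) = 0" and right: "?F (u * gen x) = 0"
    if x: "x \<in> kk X" and u: "u \<in> carrier (free_ring X)" for x u
  proof -
    have g: "gen x \<in> carrier (free_ring X)" using x by (simp add: free_carrier kk_def)
    have "f (env_class X (gen x) \<otimes>\<^bsub>UEA X\<^esub> env_class X u) = 0 \<and>
        f (env_class X u \<otimes>\<^bsub>UEA X\<^esub> env_class X (gen x)) = 0"
      using f x env_class_carrier[OF u] unfolding zonal_def by blast
    then show "?F (gen x * u) = 0" "?F (u * gen x) = 0"
      by (simp_all only: env_class_mult[OF g u] env_class_mult[OF u g])
  qed
  interpret radial_setting X a h b es hs E ?F
  proof (intro radial_setting.intro cartan_setting_axioms zonal_series.intro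
      uea_functional_of_dual dual zonal_series_axioms.intro)
    show "es ! i \<in> part X 0" if "i < length es" for i
      by (rule h_even[OF a_h[OF es_mem[OF that]]])
    show "es ! i \<in> pp X" if "i < length es" for i
      by (rule a_pp[OF es_mem[OF that]])
    show "brk X (es ! i) (es ! j) = 0" if "i < length es" "j < length es" for i j
      by (rule h_commute[OF a_h[OF es_mem[OF that(1)]] a_h[OF es_mem[OF that(2)]]])
  qed (fact left right)+
  \<comment> \<open>A representative of the Casimir element in the free algebra.\<close>
  define C where "C = (\<Sum>i<length hs. scal (1 / b (hs ! i) (hs ! i)) * (gen (hs ! i) * gen (hs ! i))) +
    (\<Sum>\<alpha>\<in>roots. scal (1 / b (E (- \<alpha>)) (E \<alpha>)) * (gen (E \<alpha>) * gen (E (- \<alpha>))))"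
  have C: "C \<in> carrier (free_ring X)"
    unfolding C_def
    by (intro free_carrier_add free_carrier_sum free_carrier_mult free_carrier_scal free_carrier_gen
        hs_whole root_vector_whole neg_root(1))
  have "restrict_series X es f = ser 1"
    by (rule mfps_eqI) (simp add: restrict_series.rep_eq mcoeff_ser es_monomial_def)
  \<comment> \<open>The operator multiplies by the Casimir element on the right, which is the side
    on which \<open>ser\<close> takes its argument.\<close>
  moreover have "restrict_series X es (laplace_beltrami X (env_class X C) f) = ser C"
  proof (rule mfps_eqI)
    fix M
    have "laplace_beltrami X (env_class X C) f (env_class X (es_monomial M)) = ?F (es_monomial M * C)"
      by (simp add: laplace_beltrami_def env_class_mult[OF es_monomial_carrier C])
    then show "mcoeff (restrict_series X es (laplace_beltrami X (env_class X C) f)) M = mcoeff (ser C) M"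
      by (simp add: restrict_series.rep_eq mcoeff_ser es_monomial_def)
  qed
  moreover have "casimir X b h hs E = env_class X C"
    by (simp add: casimir_def C_def)
  ultimately show "i_star X es (laplace_beltrami X (casimir X b h hs E) f) =
      L_rad X b a es P (i_star X es f)"
    using radial_part[OF positive] by (simp add: i_star_def C_def)
qed

end
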